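(* Let $s\ge 0$ and let $\varphi\in F^2(\mathbb{C}^n)$. Then the integral operator $S_\varphi$, $$S_{\varphi}F(z)= \int_{\mathbb{C}^n} F(w)\, e^{z \cdot\bar{w}}\, \varphi(z- \bar{w})\, d\lambda(w),\qquad z\in\mathbb{C}^n,$$ is bounded on $F^{s,2}(\mathbb{C}^n)$ if and only if there exists a multiplier $m\in\mathcal{M}(W_H^{s,2}(\mathbb{R}^n))$ such that $$\varphi (z)= \left(\frac{2}{\pi}\right)^{n/2} \int_{\mathbb{R}^{n}}m(x)\,e^{-2\left(x-\frac{i}{2}z\right)^{2}}dx, \qquad z\in \mathbb{C}^{n}.$$ In particular, $\varphi \in F^{s,2}(\mathbb{C}^n)$ if $S_{\varphi }$ is bounded on $F^{s,2}(\mathbb{C}^n)$.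
   Context: Notation: $\mathbb{N}_0=\{0,1,2,\dots\}$; $z\cdot\bar w=\sum_{j=1}^n z_j\overline{w_j}$; for $\zeta\in\mathbb{C}^n$, $\zeta^2=\sum_{j=1}^n\zeta_j^2$; $d\lambda(w)=\pi^{-n}e^{-|w|^2}dw$ is the Gaussian measure on $\mathbb{C}^n$ ($dw$ is Lebesgue measure). Fock space: $F^2(\mathbb{C}^n)$ is the set of entire functions $F$ on $\mathbb{C}^n$ with $\|F\|_{F^2(\mathbb{C}^n)}=\left(\int_{\mathbb{C}^n}|F|^2d\lambda\right)^{1/2}<\infty$. The functions $e_\alpha(z)=z^\alpha/\sqrt{\alpha!}$, $\alpha\in\mathbb{N}_0^n$, form an orthonormal basis of it. Fractional Fock-Sobolev space of order $s\in\mathbb{R}$: $F^{s,2}(\mathbb{C}^n)$ is the space of $f=\sum_{\alpha\in\mathbb{N}_0^n}c_\alpha e_\alpha$ with $\|f\|_{F^{s,2}(\mathbb{C}^n)}=\left(\sum_{\alpha}(2|\alpha|+n)^s|c_\alpha|^2\right)^{1/2}<\infty$. Hermite functions: for $k\in\mathbb{N}_0$, $h_k(x)=(\sqrt{\pi}\,2^kk!)^{-1/2}e^{-x^2/2}(-1)^k e^{x^2}\frac{d^k}{dx^k}(e^{-x^2})$, and $h_\alpha(x)=\prod_{j=1}^nh_{\alpha_j}(x_j)$ for $\alpha\in\mathbb{N}_0^n$, $x\in\mathbb{R}^n$. These form an orthonormal basis of $L^2(\mathbb{R}^n)$ and satisfy $Hh_\alpha=(2|\alpha|+n)h_\alpha$,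 where $H=-\Delta+|x|^2$. The fractional power is $H^{s}f=\sum_\alpha(2|\alpha|+n)^{s}\langle f,h_\alpha\rangle h_\alpha$. Fractional Hermite-Sobolev space ($s\ge 0$): $W_H^{s,2}(\mathbb{R}^n)=\{f\in L^2(\mathbb{R}^n): H^{s/2}f\in L^2(\mathbb{R}^n)\}$ with norm $\|f\|_{W_H^{s,2}(\mathbb{R}^n)}=\|H^{s/2}f\|_{L^2(\mathbb{R}^n)}$. Multipliers: $\mathcal{M}(W_H^{s,2}(\mathbb{R}^n))$ is the set of functions $g$ on $\mathbb{R}^n$ for which there is $M$ with $\|gf\|_{W_H^{s,2}(\mathbb{R}^n)}\le M\|f\|_{W_H^{s,2}(\mathbb{R}^n)}$ for all $f\in W_H^{s,2}(\mathbb{R}^n)$. *)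

theory Defs
  imports "HOL-Analysis.Analysis"
begin

text \<open>
  \<open>\<complex>\<^sup>n\<close> and \<open>\<real>\<^sup>n\<close> are rendered as \<^typ>\<open>complex ^ 'n\<close> and \<^typ>\<open>real ^ 'n\<close>, so \<open>n\<close> is \<open>CARD('n)\<close>;
  a multi-index is a function \<^typ>\<open>'n \<Rightarrow> nat\<close>.
\<close>

definition multi_deg :: "('n::finite \<Rightarrow> nat) \<Rightarrow> nat" where
  "multi_deg \<alpha> = (\<Sum>j\<in>UNIV. \<alpha> j)"

text \<open>The eigenvalue \<open>2|\<alpha>| + n\<close> of the Hermite operator.\<close>

definition hermite_eigenvalue :: "('n::finite \<Rightarrow> nat) \<Rightarrow> real" where
  "hermite_eigenvalue \<alpha> = 2 * real (multi_deg \<alpha>) + real CARD('n)"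

definition vec_cnj :: "complex ^ 'n \<Rightarrow> complex ^ 'n" where
  "vec_cnj w = (\<chi> j. cnj (w $ j))"

definition dot_cnj :: "complex ^ 'n \<Rightarrow> complex ^ 'n \<Rightarrow> complex" where
  "dot_cnj z w = (\<Sum>j\<in>UNIV. z $ j * cnj (w $ j))"

text \<open>The bilinear (not Hermitian) square \<open>\<zeta>\<^sup>2\<close>.\<close>

definition vec_sq :: "complex ^ 'n \<Rightarrow> complex" where
  "vec_sq \<zeta> = (\<Sum>j\<in>UNIV. (\<zeta> $ j)\<^sup>2)"


subsection \<open>Fock and Fock-Sobolev spaces\<close>

definition gauss_measure :: "(complex ^ 'n) measure" where
  "gauss_measure = density lborel (\<lambda>w. ennreal (exp (- (norm w)\<^sup>2) / pi ^ CARD('n)))"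

text \<open>Holomorphic on all of \<open>\<complex>\<^sup>n\<close>: the real Frechet derivative exists and is complex linear everywhere.\<close>

definition entire_Cn :: "(complex ^ 'n \<Rightarrow> complex) \<Rightarrow> bool" where
  "entire_Cn F \<longleftrightarrow>
     (\<forall>z. \<exists>F'. (F has_derivative F') (at z) \<and> (\<forall>c v. F' (c *s v) = c * F' v))"

definition fock_space :: "(complex ^ 'n \<Rightarrow> complex) set" where
  "fock_space = {F. entire_Cn F \<and> integrable gauss_measure (\<lambda>z. (norm (F z))\<^sup>2)}"

definition fock_basis :: "('n::finite \<Rightarrow> nat) \<Rightarrow> complex ^ 'n \<Rightarrow> complex" where
  "fock_basis \<alpha> z =
     (\<Prod>j\<in>UNIV. (z $ j) ^ \<alpha> j) / complex_of_real (sqrt (\<Prod>j\<in>UNIV. fact (\<alpha> j)))"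

text \<open>
  \<open>f = \<Sum>\<^sub>\<alpha> c\<^sub>\<alpha> e\<^sub>\<alpha>\<close>, understood as unconditional pointwise convergence on \<open>\<complex>\<^sup>n\<close>. This makes sense
  for every real order, also for negative ones where \<open>f\<close> need not lie in the Fock space.
\<close>

definition fock_expansion :: "(('n::finite \<Rightarrow> nat) \<Rightarrow> complex) \<Rightarrow> (complex ^ 'n \<Rightarrow> complex) \<Rightarrow> bool" where
  "fock_expansion c f \<longleftrightarrow> (\<forall>z. ((\<lambda>\<alpha>. c \<alpha> * fock_basis \<alpha> z) has_sum f z) UNIV)"

definition fock_sobolev :: "real \<Rightarrow> (complex ^ 'n \<Rightarrow> complex) set" where
  "fock_sobolev s =
     {f. \<exists>c. fock_expansion c f \<and>
             (\<lambda>\<alpha>. hermite_eigenvalue \<alpha> powr s * (norm (c \<alpha>))\<^sup>2) summable_on UNIV}"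

text \<open>The coefficients are determined by \<open>f\<close>, being those of an everywhere convergent power series.\<close>

definition fock_coeff :: "(complex ^ 'n \<Rightarrow> complex) \<Rightarrow> ('n::finite \<Rightarrow> nat) \<Rightarrow> complex" where
  "fock_coeff f = (THE c. fock_expansion c f)"

definition fock_sobolev_norm :: "real \<Rightarrow> (complex ^ 'n \<Rightarrow> complex) \<Rightarrow> real" where
  "fock_sobolev_norm s f =
     sqrt (\<Sum>\<^sub>\<infinity>\<alpha>. hermite_eigenvalue \<alpha> powr s * (norm (fock_coeff f \<alpha>))\<^sup>2)"


subsection \<open>The integral operator\<close>

definition S_integrand ::
  "(complex ^ 'n \<Rightarrow> complex) \<Rightarrow> (complex ^ 'n \<Rightarrow> complex) \<Rightarrow> complex ^ 'n \<Rightarrow> complex ^ 'n \<Rightarrow> complex" where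
  "S_integrand \<phi> F z w = F w * exp (dot_cnj z w) * \<phi> (z - vec_cnj w)"

definition S_op ::
  "(complex ^ 'n \<Rightarrow> complex) \<Rightarrow> (complex ^ 'n \<Rightarrow> complex) \<Rightarrow> complex ^ 'n \<Rightarrow> complex" where
  "S_op \<phi> F z = (LINT w|gauss_measure. S_integrand \<phi> F z w)"

text \<open>
  For an arbitrary \<open>\<phi>\<close> in the Fock space the integral need not converge for every \<open>F\<close> and \<open>z\<close>, and
  \<^const>\<open>lebesgue_integral\<close> is \<open>0\<close> on non-integrable functions. Hence boundedness includes the
  requirement that the integral exists.
\<close>

definition S_bounded_on_fock_sobolev :: "real \<Rightarrow> (complex ^ 'n \<Rightarrow> complex) \<Rightarrow> bool" where
  "S_bounded_on_fock_sobolev s \<phi> \<longleftrightarrow>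
     (\<forall>F\<in>fock_sobolev s. \<forall>z. integrable gauss_measure (S_integrand \<phi> F z)) \<and>
     (\<exists>M. \<forall>F\<in>fock_sobolev s.
        S_op \<phi> F \<in> fock_sobolev s \<and>
        fock_sobolev_norm s (S_op \<phi> F) \<le> M * fock_sobolev_norm s F)"


subsection \<open>Hermite-Sobolev spaces and their multipliers\<close>

definition hermite_fun1 :: "nat \<Rightarrow> real \<Rightarrow> real" where
  "hermite_fun1 k x =
     (sqrt pi * 2 ^ k * fact k) powr (- 1 / 2) * exp (- x\<^sup>2 / 2) * (- 1) ^ k * exp (x\<^sup>2) *
     (deriv ^^ k) (\<lambda>y. exp (- y\<^sup>2)) x"

definition hermite_fun :: "('n::finite \<Rightarrow> nat) \<Rightarrow> real ^ 'n \<Rightarrow> real" where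
  "hermite_fun \<alpha> x = (\<Prod>j\<in>UNIV. hermite_fun1 (\<alpha> j) (x $ j))"

text \<open>
  Elements of \<open>L\<^sup>2\<close> are represented by Borel functions; no quotient by almost everywhere equality
  is formed.
\<close>

definition L2_space :: "(real ^ 'n \<Rightarrow> complex) set" where
  "L2_space = {f \<in> borel_measurable lborel. integrable lborel (\<lambda>x. (norm (f x))\<^sup>2)}"

definition L2_fnorm :: "(real ^ 'n \<Rightarrow> complex) \<Rightarrow> real" where
  "L2_fnorm f = sqrt (LINT x|lborel. (norm (f x))\<^sup>2)"

definition L2_inner :: "(real ^ 'n \<Rightarrow> complex) \<Rightarrow> (real ^ 'n \<Rightarrow> complex) \<Rightarrow> complex" where
  "L2_inner f g = (LINT x|lborel. f x * cnj (g x))"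

text \<open>
  \<open>H\<^sup>t f = g\<close> with \<open>g \<in> L\<^sup>2\<close>: the series
  \<open>\<Sum>\<^sub>\<alpha> (2|\<alpha>| + n)\<^sup>t \<langle>f, h\<^sub>\<alpha>\<rangle> h\<^sub>\<alpha>\<close> converges unconditionally to \<open>g\<close> in \<open>L\<^sup>2\<close>.
\<close>

definition hermite_power :: "real \<Rightarrow> (real ^ 'n \<Rightarrow> complex) \<Rightarrow> (real ^ 'n \<Rightarrow> complex) \<Rightarrow> bool" where
  "hermite_power t f g \<longleftrightarrow>
     g \<in> L2_space \<and>
     ((\<lambda>A. L2_fnorm (\<lambda>x. g x -
         (\<Sum>\<alpha>\<in>A. complex_of_real (hermite_eigenvalue \<alpha> powr t) *
                 L2_inner f (\<lambda>y. complex_of_real (hermite_fun \<alpha> y)) *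
                 complex_of_real (hermite_fun \<alpha> x)))) \<longlongrightarrow> 0)
       (finite_subsets_at_top UNIV)"

definition hermite_sobolev :: "real \<Rightarrow> (real ^ 'n \<Rightarrow> complex) set" where
  "hermite_sobolev s = {f \<in> L2_space. \<exists>g. hermite_power (s / 2) f g}"

text \<open>The function \<open>g\<close> is unique up to a null set, so the choice does not affect the norm.\<close>

definition hermite_sobolev_norm :: "real \<Rightarrow> (real ^ 'n \<Rightarrow> complex) \<Rightarrow> real" where
  "hermite_sobolev_norm s f = L2_fnorm (SOME g. hermite_power (s / 2) f g)"

definition hermite_multipliers :: "real \<Rightarrow> (real ^ 'n \<Rightarrow> complex) set" where
  "hermite_multipliers s =
     {g. \<exists>M. \<forall>f\<in>hermite_sobolev s.
           (\<lambda>x. g x * f x) \<in> hermite_sobolev s \<and>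
           hermite_sobolev_norm s (\<lambda>x. g x * f x) \<le> M * hermite_sobolev_norm s f}"

end

theory Submission
  imports Defs "HOL-Probability.Probability" "HOL-Complex_Analysis.Complex_Analysis"
begin

text \<open>
  Let \<open>K\<^sub>z(x) = (2/\<pi>)\<^bsup>n/4\<^esup> exp(-x\<^sup>2 + 2ixz + z\<^sup>2/2)\<close>. It is the generating function of the dilated Hermite
  functions \<open>2\<^bsup>n/4\<^esup> h\<^sub>\<alpha>(\<surd>2 x)\<close>, so \<open>Bf(z) = \<integral> f K\<^sub>z\<close> is unitary from \<open>L\<^sup>2(\<real>\<^sup>n)\<close> onto the Fock
  space. The formula for \<open>\<phi>\<close> reads \<open>\<phi>(z) = \<integral> m K\<^sub>0 K\<^sub>z\<close>, and the kernels satisfy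
  \<open>K\<^sub>z cnj(K\<^sub>w) = exp(z \<cdot> cnj w) K\<^sub>0 K\<^bsub>z - cnj w\<^esub>\<close>; hence \<open>S\<^sub>\<phi> B f = B (m f)\<close> for a multiplier \<open>m\<close>.

  Conversely \<open>S\<^sub>\<phi> 1 = \<phi>\<close> by the mean value property, so boundedness gives \<open>\<phi> = B u\<close> with \<open>u\<close> in the
  Sobolev space, and \<open>m = u / K\<^sub>0\<close> is the candidate. If \<open>S\<^sub>\<phi> B f = B v\<close>, evaluation at real points
  shows that \<open>u f\<close> and \<open>v K\<^sub>0\<close> have the same Fourier transform, that is, \<open>m f = v\<close>.

  This determines the multipliers of the Sobolev space built on the dilated Hermite functions. It
  has an equivalent norm: the matrix of the change of basis satisfies a recurrence coming from the
  Hermite differential equation, which settles the orders \<open>s = 2N\<close>, and interpolation does the rest.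
\<close>


subsection \<open>Square-integrable functions and orthonormal families\<close>

text \<open>The kernel in the formula for \<phi> expands in Hermite functions dilated by sqrt 2,
  whereas multipliers refer to the undilated operator H. Dilation does not commute with H, so the
  two scales of spaces must be compared, and this shapes much of the work. A function dilated by c
  solves -u'' + c^4 x^2 u = c^2 (2k+1) u. The Wronskian of two eigenfunctions with different c
  therefore leaves only a multiple of x^2 besides the eigenvalues, and x^2 moves a Hermite index by
  0 or 2. Hence one power of the weight in one basis costs one power in the other, coordinate by
  coordinate. Real points are used in the converse because K_z / K_0 has constant modulus there. At
  other points u K_z / K_0 may leave L2, and the pairing of Bargmann transforms is lost. In the
  direct implication m is a bare function. Measurability and integrability are read off from the
  products m K_z, which lie in the Sobolev space because K_z belongs to every order. Convergence of
  the integral defining S follows too: for fixed z the integrand is a product of two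
  square-integrable Bargmann transforms.\<close>

definition l2 :: "'a measure \<Rightarrow> ('a \<Rightarrow> complex) set" where
  "l2 M = {f \<in> borel_measurable M. integrable M (\<lambda>x. (norm (f x))\<^sup>2)}"

definition l2_inner :: "'a measure \<Rightarrow> ('a \<Rightarrow> complex) \<Rightarrow> ('a \<Rightarrow> complex) \<Rightarrow> complex" where
  "l2_inner M f g = (LINT x|M. f x * cnj (g x))"

definition l2_sq :: "'a measure \<Rightarrow> ('a \<Rightarrow> complex) \<Rightarrow> real" where
  "l2_sq M f = (LINT x|M. (norm (f x))\<^sup>2)"

lemma borel_measurable_cnj [measurable (raw)]:
  "f \<in> borel_measurable M \<Longrightarrow> (\<lambda>x. cnj (f x)) \<in> borel_measurable M"
  using measurable_compose[of f M borel cnj borel] borel_measurable_continuous_onI[OF continuous_on_cnj[OF continuous_on_id]] by simp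

lemma l2_measurable [measurable_dest]: "f \<in> l2 M \<Longrightarrow> f \<in> borel_measurable M"
  by (simp add: l2_def)

lemma l2_integrable_sq: "f \<in> l2 M \<Longrightarrow> integrable M (\<lambda>x. (norm (f x))\<^sup>2)"
  by (simp add: l2_def)

lemma l2I: "f \<in> borel_measurable M \<Longrightarrow> integrable M (\<lambda>x. (norm (f x))\<^sup>2) \<Longrightarrow> f \<in> l2 M"
  by (simp add: l2_def)

lemma l2I_bound:
  assumes "f \<in> borel_measurable M" "integrable M h" "\<And>x. (norm (f x))\<^sup>2 \<le> h x"
  shows "f \<in> l2 M"
proof (rule l2I[OF assms(1)], rule Bochner_Integration.integrable_bound[OF assms(2)])
  show "(\<lambda>x. (norm (f x))\<^sup>2) \<in> borel_measurable M" using assms(1) by simp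
  show "AE x in M. norm ((norm (f x))\<^sup>2) \<le> norm (h x)"
    using assms(3) by (auto intro: order_trans[OF _ abs_ge_self])
qed

lemma l2_zero [simp]: "(\<lambda>x. 0) \<in> l2 M"
  by (simp add: l2_def)

lemma l2_cnj: "f \<in> l2 M \<Longrightarrow> (\<lambda>x. cnj (f x)) \<in> l2 M"
  unfolding l2_def by (auto simp: borel_measurable_cnj)

lemma l2_mult_integrable:
  assumes "f \<in> l2 M" "g \<in> l2 M"
  shows "integrable M (\<lambda>x. f x * g x)"
proof (rule Bochner_Integration.integrable_bound)
  show "integrable M (\<lambda>x. (norm (f x))\<^sup>2 + (norm (g x))\<^sup>2)"
    using assms by (auto intro: l2_integrable_sq)
  show "(\<lambda>x. f x * g x) \<in> borel_measurable M"
    using assms by (auto dest!: l2_measurable)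
  have "norm (f x * g x) \<le> norm ((norm (f x))\<^sup>2 + (norm (g x))\<^sup>2)" for x
  proof -
    have "2 * norm (f x) * norm (g x) \<le> (norm (f x))\<^sup>2 + (norm (g x))\<^sup>2"
      using sum_squares_bound[of "norm (f x)" "norm (g x)"] by simp
    moreover have "norm (f x) * norm (g x) \<ge> 0" by simp
    ultimately have "norm (f x) * norm (g x) \<le> (norm (f x))\<^sup>2 + (norm (g x))\<^sup>2" by linarith
    thus ?thesis by (simp add: norm_mult)
  qed
  thus "AE x in M. norm (f x * g x) \<le> norm ((norm (f x))\<^sup>2 + (norm (g x))\<^sup>2)" by simp
qed

lemma l2_inner_integrable:
  assumes "f \<in> l2 M" "g \<in> l2 M"
  shows "integrable M (\<lambda>x. f x * cnj (g x))"
  using l2_mult_integrable[OF assms(1) l2_cnj[OF assms(2)]] .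

lemma l2_bounded_mult:
  assumes f: "f \<in> l2 M" and g: "g \<in> borel_measurable M" and b: "\<And>x. norm (g x) \<le> B"
  shows "(\<lambda>x. f x * g x) \<in> l2 M"
proof (rule l2I_bound)
  show "(\<lambda>x. f x * g x) \<in> borel_measurable M" using f g by (auto dest!: l2_measurable)
  show "integrable M (\<lambda>x. B\<^sup>2 * (norm (f x))\<^sup>2)" using l2_integrable_sq[OF f] by simp
  show "(norm (f x * g x))\<^sup>2 \<le> B\<^sup>2 * (norm (f x))\<^sup>2" for x
    using b[of x] by (auto simp: norm_mult power_mult_distrib mult.commute[of "B\<^sup>2"] intro!: mult_left_mono power_mono)
qed

lemma l2_scale: "f \<in> l2 M \<Longrightarrow> (\<lambda>x. c * f x) \<in> l2 M"
  using l2_bounded_mult[of f M "\<lambda>x. c" "norm c"] by (simp add: mult.commute)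

lemma l2_add:
  assumes "f \<in> l2 M" "g \<in> l2 M"
  shows "(\<lambda>x. f x + g x) \<in> l2 M"
proof (rule l2I_bound)
  show "(\<lambda>x. f x + g x) \<in> borel_measurable M" using assms by (auto dest!: l2_measurable)
  show "integrable M (\<lambda>x. 2 * (norm (f x))\<^sup>2 + 2 * (norm (g x))\<^sup>2)"
    using assms[THEN l2_integrable_sq] by simp
  show "(norm (f x + g x))\<^sup>2 \<le> 2 * (norm (f x))\<^sup>2 + 2 * (norm (g x))\<^sup>2" for x
  proof -
    have "(norm (f x + g x))\<^sup>2 \<le> (norm (f x) + norm (g x))\<^sup>2"
      by (intro power_mono norm_triangle_ineq) auto
    also have "\<dots> \<le> 2 * (norm (f x))\<^sup>2 + 2 * (norm (g x))\<^sup>2"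
      using sum_squares_bound[of "norm (f x)" "norm (g x)"] by (simp add: power2_sum)
    finally show ?thesis .
  qed
qed

lemma l2_diff:
  assumes "f \<in> l2 M" "g \<in> l2 M"
  shows "(\<lambda>x. f x - g x) \<in> l2 M"
  using l2_add[OF assms(1) l2_scale[OF assms(2), of "-1"]] by simp

lemma l2_sum: "(\<And>i. i \<in> A \<Longrightarrow> f i \<in> l2 M) \<Longrightarrow> (\<lambda>x. \<Sum>i\<in>A. f i x) \<in> l2 M"
  by (induction A rule: infinite_finite_induct) (auto intro: l2_add)

lemma l2_cong_AE:
  assumes "f \<in> l2 M" "g \<in> borel_measurable M" "AE x in M. f x = g x"
  shows "g \<in> l2 M"
proof (rule l2I[OF assms(2)])
  show "integrable M (\<lambda>x. (norm (g x))\<^sup>2)"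
    using l2_integrable_sq[OF assms(1)]
    by (rule Bochner_Integration.integrable_cong_AE_imp) (use assms in \<open>auto dest!: l2_measurable\<close>)
qed

lemma l2_inner_cong_AE:
  assumes "f \<in> borel_measurable M" "g \<in> borel_measurable M" "h \<in> borel_measurable M" "AE x in M. f x = g x"
  shows "l2_inner M f h = l2_inner M g h"
  unfolding l2_inner_def using assms by (intro integral_cong_AE) (auto intro!: borel_measurable_times borel_measurable_cnj)

lemma l2_inner_diff_left:
  assumes "f \<in> l2 M" "g \<in> l2 M" "h \<in> l2 M"
  shows "l2_inner M (\<lambda>x. f x - g x) h = l2_inner M f h - l2_inner M g h"
  unfolding l2_inner_def using assms by (simp add: left_diff_distrib l2_inner_integrable)

lemma l2_inner_scale_left: "l2_inner M (\<lambda>x. c * f x) h = c * l2_inner M f h"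
  unfolding l2_inner_def by (simp add: mult.assoc)

lemma l2_inner_sum_left:
  assumes "\<And>i. i \<in> A \<Longrightarrow> f i \<in> l2 M" "h \<in> l2 M"
  shows "l2_inner M (\<lambda>x. \<Sum>i\<in>A. f i x) h = (\<Sum>i\<in>A. l2_inner M (f i) h)"
  unfolding l2_inner_def sum_distrib_right
  by (rule Bochner_Integration.integral_sum) (use assms l2_inner_integrable in auto)

lemma l2_inner_commute: "l2_inner M f g = cnj (l2_inner M g f)"
proof -
  have "cnj (l2_inner M g f) = (LINT x|M. cnj (g x * cnj (f x)))"
    unfolding l2_inner_def by (simp del: complex_cnj_mult)
  thus ?thesis by (simp add: l2_inner_def mult.commute)
qed

lemma l2_inner_self: "l2_inner M f f = complex_of_real (l2_sq M f)"
proof -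
  have "l2_inner M f f = (LINT x|M. complex_of_real ((norm (f x))\<^sup>2))"
    unfolding l2_inner_def by (intro Bochner_Integration.integral_cong) (simp_all add: complex_norm_square[symmetric])
  also have "\<dots> = complex_of_real (l2_sq M f)"
    unfolding l2_sq_def by (rule integral_complex_of_real)
  finally show ?thesis .
qed

lemma l2_sq_nonneg [simp]: "l2_sq M f \<ge> 0"
  unfolding l2_sq_def by simp

lemma l2_sq_diff:
  assumes "f \<in> l2 M" "g \<in> l2 M"
  shows "l2_sq M (\<lambda>x. f x - g x) = l2_sq M f - 2 * Re (l2_inner M f g) + l2_sq M g"
proof -
  have "complex_of_real (l2_sq M (\<lambda>x. f x - g x)) = l2_inner M (\<lambda>x. f x - g x) (\<lambda>x. f x - g x)"
    by (rule l2_inner_self[symmetric])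
  also have "\<dots> = l2_inner M f (\<lambda>x. f x - g x) - l2_inner M g (\<lambda>x. f x - g x)"
    by (rule l2_inner_diff_left) (use assms l2_diff in auto)
  also have "\<dots> = cnj (l2_inner M f f - l2_inner M g f) - cnj (l2_inner M f g - l2_inner M g g)"
    using l2_inner_commute[of M _ "\<lambda>x. f x - g x"] by (simp add: l2_inner_diff_left assms)
  finally have "Re (complex_of_real (l2_sq M (\<lambda>x. f x - g x))) =
      Re (cnj (l2_inner M f f - l2_inner M g f) - cnj (l2_inner M f g - l2_inner M g g))" by simp
  moreover have "Re (l2_inner M g f) = Re (l2_inner M f g)"
    by (subst l2_inner_commute) simp
  ultimately show ?thesis by (simp add: l2_inner_self)
qed

text \<open>Discriminant argument: with p the inner product, the squared norm of f - t p g is a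
  nonnegative polynomial in the real variable t. Putting p into the multiplier makes the mixed term
  real.\<close>

lemma l2_Cauchy_Schwarz:
  assumes f: "f \<in> l2 M" and g: "g \<in> l2 M"
  shows "(norm (l2_inner M f g))\<^sup>2 \<le> l2_sq M f * l2_sq M g"
proof -
  define p where "p = l2_inner M f g"
  have key: "0 \<le> l2_sq M f - 2 * t * (norm p)\<^sup>2 + t\<^sup>2 * (norm p)\<^sup>2 * l2_sq M g" for t :: real
  proof -
    let ?c = "complex_of_real t * p"
    have "0 \<le> l2_sq M (\<lambda>x. f x - ?c * g x)" by simp
    also have "\<dots> = l2_sq M f - 2 * Re (l2_inner M f (\<lambda>x. ?c * g x)) + l2_sq M (\<lambda>x. ?c * g x)"
      by (rule l2_sq_diff) (use f g l2_scale in auto)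
    also have "l2_inner M f (\<lambda>x. ?c * g x) = cnj (?c * cnj p)"
      by (subst l2_inner_commute) (simp add: l2_inner_scale_left p_def l2_inner_commute[of M g f])
    also have "Re (cnj (?c * cnj p)) = t * (norm p)\<^sup>2"
      by (simp add: cmod_power2) (simp add: power2_eq_square algebra_simps)
    also have "l2_sq M (\<lambda>x. ?c * g x) = t\<^sup>2 * (norm p)\<^sup>2 * l2_sq M g"
      unfolding l2_sq_def by (simp add: norm_mult power_mult_distrib)
    finally show ?thesis by simp
  qed
  show ?thesis
  proof (cases "l2_sq M g = 0")
    case True
    have "(norm p)\<^sup>2 = 0"
    proof (rule ccontr)
      assume "(norm p)\<^sup>2 \<noteq> 0"
      \<comment> \<open>With \<open>l2_sq M g = 0\<close> the polynomial is affine in t, and this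
        value of t would make it negative.\<close>
      hence "2 * (l2_sq M f / (norm p)\<^sup>2 + 1) * (norm p)\<^sup>2 = 2 * l2_sq M f + 2 * (norm p)\<^sup>2"
        by (simp add: field_simps)
      moreover have "(norm p)\<^sup>2 > 0" using \<open>(norm p)\<^sup>2 \<noteq> 0\<close> by simp
      moreover have "0 \<le> l2_sq M f - 2 * (l2_sq M f / (norm p)\<^sup>2 + 1) * (norm p)\<^sup>2"
        using key[of "l2_sq M f / (norm p)\<^sup>2 + 1"] True by simp
      ultimately show False using l2_sq_nonneg[of M f] by linarith
    qed
    thus ?thesis using True by (simp add: p_def)
  next
    case False
    hence pos: "l2_sq M g > 0" using l2_sq_nonneg[of M g] by linarith
    have "0 \<le> l2_sq M f - (norm p)\<^sup>2 / l2_sq M g"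
      using key[of "1 / l2_sq M g"] pos by (simp add: power2_eq_square field_simps)
    thus ?thesis using pos by (simp add: p_def field_simps)
  qed
qed

section \<open>Orthonormal families: Bessel's inequality, expansions and the Riesz-Fischer
  theorem\<close>

locale orthonormal_family =
  fixes M :: "'a measure" and e :: "'i::countable \<Rightarrow> 'a \<Rightarrow> complex"
  assumes e_l2: "e i \<in> l2 M"
    and e_ortho: "l2_inner M (e i) (e j) = (if i = j then 1 else 0)"
begin

definition psum :: "('i \<Rightarrow> complex) \<Rightarrow> 'i set \<Rightarrow> 'a \<Rightarrow> complex" where
  "psum c A x = (\<Sum>i\<in>A. c i * e i x)"

text \<open>Convergence along the net of finite index sets, the same notion as in
  \<open>hermite_power\<close>, but with squared norms so that no roots appear.\<close>

definition l2_expansion :: "('i \<Rightarrow> complex) \<Rightarrow> ('a \<Rightarrow> complex) \<Rightarrow> bool" where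
  "l2_expansion c f \<longleftrightarrow> f \<in> l2 M \<and>
     ((\<lambda>A. l2_sq M (\<lambda>x. f x - psum c A x)) \<longlongrightarrow> 0) (finite_subsets_at_top UNIV)"

lemma psum_l2: "psum c A \<in> l2 M"
  unfolding psum_def[abs_def] by (intro l2_sum l2_scale e_l2)

lemma inner_psum: "g \<in> l2 M \<Longrightarrow> l2_inner M (psum c A) g = (\<Sum>i\<in>A. c i * l2_inner M (e i) g)"
  unfolding psum_def[abs_def] by (subst l2_inner_sum_left) (auto intro: l2_scale e_l2 simp: l2_inner_scale_left)

lemma inner_e_psum: "finite A \<Longrightarrow> l2_inner M (e i) (psum c A) = (if i \<in> A then cnj (c i) else 0)"
proof -
  assume A: "finite A"
  have "l2_inner M (psum c A) (e i) = (\<Sum>j\<in>A. if j = i then c j else 0)"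
    by (subst inner_psum[OF e_l2], intro sum.cong) (auto simp: e_ortho)
  thus ?thesis using A by (subst l2_inner_commute) simp
qed

lemma l2_sq_psum: "finite A \<Longrightarrow> l2_sq M (psum c A) = (\<Sum>i\<in>A. (norm (c i))\<^sup>2)"
proof -
  assume A: "finite A"
  have "complex_of_real (l2_sq M (psum c A)) = (\<Sum>i\<in>A. c i * l2_inner M (e i) (psum c A))"
    unfolding l2_inner_self[symmetric] by (rule inner_psum[OF psum_l2])
  also have "\<dots> = (\<Sum>i\<in>A. complex_of_real ((norm (c i))\<^sup>2))"
    using A by (intro sum.cong) (auto simp: inner_e_psum complex_norm_square[symmetric])
  also have "\<dots> = complex_of_real (\<Sum>i\<in>A. (norm (c i))\<^sup>2)" by simp
  finally show ?thesis using of_real_eq_iff by blast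
qed

lemma l2_sq_diff_coeffs:
  assumes f: "f \<in> l2 M" and A: "finite A"
  shows "l2_sq M (\<lambda>x. f x - psum (\<lambda>i. l2_inner M f (e i)) A x) = l2_sq M f - (\<Sum>i\<in>A. (norm (l2_inner M f (e i)))\<^sup>2)"
proof -
  let ?c = "\<lambda>i. l2_inner M f (e i)"
  have "l2_inner M f (psum ?c A) = cnj (\<Sum>i\<in>A. ?c i * cnj (?c i))"
    by (subst l2_inner_commute, subst inner_psum[OF f], subst (2) l2_inner_commute) simp
  also have "\<dots> = complex_of_real (\<Sum>i\<in>A. (norm (?c i))\<^sup>2)"
    by (simp add: complex_norm_square mult.commute del: of_real_power)
  finally have "Re (l2_inner M f (psum ?c A)) = (\<Sum>i\<in>A. (norm (?c i))\<^sup>2)" by simp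
  thus ?thesis using l2_sq_diff[OF f psum_l2, of ?c A] l2_sq_psum[OF A, of ?c] by simp
qed

lemma bessel_finite:
  assumes "f \<in> l2 M" "finite A"
  shows "(\<Sum>i\<in>A. (norm (l2_inner M f (e i)))\<^sup>2) \<le> l2_sq M f"
  using l2_sq_diff_coeffs[OF assms] l2_sq_nonneg[of M "\<lambda>x. f x - psum (\<lambda>i. l2_inner M f (e i)) A x"] by linarith

lemma bessel_summable:
  assumes "f \<in> l2 M"
  shows "(\<lambda>i. (norm (l2_inner M f (e i)))\<^sup>2) summable_on UNIV"
  by (rule nonneg_bdd_above_summable_on)
     (auto intro!: bdd_aboveI[where M="l2_sq M f"] bessel_finite assms)

text \<open>The inner product with a fixed g is continuous by Cauchy-Schwarz, so it can be applied
  term by term.\<close>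

lemma l2_expansion_inner:
  assumes f: "l2_expansion c f" and g: "g \<in> l2 M"
  shows "((\<lambda>i. c i * l2_inner M (e i) g) has_sum l2_inner M f g) UNIV"
proof -
  have fl: "f \<in> l2 M" using f by (simp add: l2_expansion_def)
  have "((\<lambda>A. l2_inner M f g - (\<Sum>i\<in>A. c i * l2_inner M (e i) g)) \<longlongrightarrow> 0) (finite_subsets_at_top UNIV)"
  proof (rule tendsto_norm_zero_cancel, rule tendsto_sandwich[where f="\<lambda>_. 0"])
    let ?b = "\<lambda>A. sqrt (l2_sq M (\<lambda>x. f x - psum c A x) * l2_sq M g)"
    have "norm (l2_inner M f g - (\<Sum>i\<in>A. c i * l2_inner M (e i) g)) \<le> ?b A" for A
    proof -
      have "l2_inner M f g - (\<Sum>i\<in>A. c i * l2_inner M (e i) g) = l2_inner M (\<lambda>x. f x - psum c A x) g"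
        using l2_inner_diff_left[OF fl psum_l2 g, of c A] inner_psum[OF g, of c A] by simp
      thus ?thesis using l2_Cauchy_Schwarz[OF l2_diff[OF fl psum_l2] g, of c A]
        by (simp add: real_le_rsqrt)
    qed
    thus "\<forall>\<^sub>F A in finite_subsets_at_top UNIV. norm (l2_inner M f g - (\<Sum>i\<in>A. c i * l2_inner M (e i) g)) \<le> ?b A"
      by simp
    have "((\<lambda>A. l2_sq M (\<lambda>x. f x - psum c A x)) \<longlongrightarrow> 0) (finite_subsets_at_top UNIV)"
      using f by (simp add: l2_expansion_def)
    hence "(?b \<longlongrightarrow> sqrt (0 * l2_sq M g)) (finite_subsets_at_top UNIV)"
      by (intro tendsto_real_sqrt tendsto_mult_right)
    thus "(?b \<longlongrightarrow> 0) (finite_subsets_at_top UNIV)" by simp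
  qed auto
  hence "((\<lambda>A. l2_inner M f g - (l2_inner M f g - (\<Sum>i\<in>A. c i * l2_inner M (e i) g))) \<longlongrightarrow> l2_inner M f g - 0)
      (finite_subsets_at_top UNIV)" by (intro tendsto_diff tendsto_const)
  thus ?thesis by (simp add: has_sum_def)
qed

lemma l2_expansion_l2: "l2_expansion c f \<Longrightarrow> f \<in> l2 M"
  by (simp add: l2_expansion_def)

lemma l2_expansion_coeff:
  assumes f: "l2_expansion c f"
  shows "l2_inner M f (e i) = c i"
proof -
  have "((\<lambda>j. c j * l2_inner M (e j) (e i)) has_sum l2_inner M f (e i)) UNIV"
    by (rule l2_expansion_inner[OF f e_l2])
  moreover have "((\<lambda>j. c j * l2_inner M (e j) (e i)) has_sum c i) UNIV"
    by (rule has_sum_finite_neutralI[where B="{i}"]) (auto simp: e_ortho)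
  ultimately show ?thesis using has_sum_unique by blast
qed

lemma l2_expansion_inner':
  assumes f: "l2_expansion c f" and g: "g \<in> l2 M"
  shows "((\<lambda>i. c i * cnj (l2_inner M g (e i))) has_sum l2_inner M f g) UNIV"
  using l2_expansion_inner[OF assms] l2_inner_commute[of M "e _" g] by simp

lemma l2_expansion_norm:
  assumes f: "l2_expansion c f"
  shows "((\<lambda>i. (norm (c i))\<^sup>2) has_sum l2_sq M f) UNIV"
proof -
  have "((\<lambda>i. c i * cnj (c i)) has_sum l2_inner M f f) UNIV"
    using l2_expansion_inner'[OF f l2_expansion_l2[OF f]] by (simp add: l2_expansion_coeff[OF f])
  hence "((\<lambda>i. complex_of_real ((norm (c i))\<^sup>2)) has_sum complex_of_real (l2_sq M f)) UNIV"
    by (simp add: complex_norm_square l2_inner_self del: of_real_power)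
  thus ?thesis using has_sum_of_real_iff by blast
qed

lemma tail_tendsto_0:
  fixes w :: "'i \<Rightarrow> real"
  assumes w: "w summable_on UNIV"
  shows "((\<lambda>A. infsum w UNIV - sum w A) \<longlongrightarrow> 0) (finite_subsets_at_top UNIV)"
proof -
  have "(sum w \<longlongrightarrow> infsum w UNIV) (finite_subsets_at_top UNIV)"
    using w by (simp add: has_sum_infsum has_sum_def[symmetric])
  from tendsto_diff[OF tendsto_const[of "infsum w UNIV"] this] show ?thesis by simp
qed

text \<open>Fatou's lemma turns pointwise convergence of partial sums into convergence in \<open>L\<^sup>2\<close>.\<close>

lemma l2_expansion_of_AE_limit:
  fixes X :: "nat \<Rightarrow> 'i set"
  assumes c: "(\<lambda>i. (norm (c i))\<^sup>2) summable_on UNIV"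
    and F: "F \<in> borel_measurable M"
    and X: "\<And>k. finite (X k)" "filterlim X (finite_subsets_at_top UNIV) sequentially"
    and lim: "AE x in M. (\<lambda>k. psum c (X k) x) \<longlonglongrightarrow> F x"
  shows "l2_expansion c F"
proof -
  let ?w = "\<lambda>i. (norm (c i))\<^sup>2"
  \<comment> \<open>Extended integrals allow this estimate before F is known to be square
    integrable; the choice A = {} then yields exactly that.\<close>
  have bound: "(\<integral>\<^sup>+x. ennreal ((norm (F x - psum c A x))\<^sup>2) \<partial>M) \<le> ennreal (infsum ?w UNIV - sum ?w A)"
    if A: "finite A" for A
  proof -
    have m: "psum c B \<in> borel_measurable M" for B using psum_l2 l2_measurable by blast
    have "(\<integral>\<^sup>+x. ennreal ((norm (F x - psum c A x))\<^sup>2) \<partial>M)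
        \<le> (\<integral>\<^sup>+x. liminf (\<lambda>k. ennreal ((norm (psum c (X k) x - psum c A x))\<^sup>2)) \<partial>M)"
    proof (rule nn_integral_mono_AE, use lim in eventually_elim)
      case (elim x)
      have "(\<lambda>k. ennreal ((norm (psum c (X k) x - psum c A x))\<^sup>2)) \<longlonglongrightarrow> ennreal ((norm (F x - psum c A x))\<^sup>2)"
        by (intro tendsto_ennrealI tendsto_power tendsto_norm tendsto_diff elim tendsto_const)
      from lim_imp_Liminf[OF _ this] show ?case by simp
    qed
    also have "\<dots> \<le> liminf (\<lambda>k. \<integral>\<^sup>+x. ennreal ((norm (psum c (X k) x - psum c A x))\<^sup>2) \<partial>M)"
      by (rule nn_integral_liminf) (use m F in simp)
    also have "\<dots> \<le> liminf (\<lambda>k. ennreal (infsum ?w UNIV - sum ?w A))"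
    proof (rule Liminf_mono)
      have "\<forall>\<^sub>F B in finite_subsets_at_top UNIV. A \<subseteq> B"
        using A by (auto simp: eventually_finite_subsets_at_top)
      hence "\<forall>\<^sub>F k in sequentially. A \<subseteq> X k" using X(2) by (simp add: filterlim_iff)
      thus "\<forall>\<^sub>F k in sequentially. (\<integral>\<^sup>+x. ennreal ((norm (psum c (X k) x - psum c A x))\<^sup>2) \<partial>M)
          \<le> ennreal (infsum ?w UNIV - sum ?w A)"
      proof eventually_elim
        case (elim k)
        have "psum c (X k) x - psum c A x = psum c (X k - A) x" for x
          unfolding psum_def using elim X(1) by (simp add: sum_diff)
        hence "(\<integral>\<^sup>+x. ennreal ((norm (psum c (X k) x - psum c A x))\<^sup>2) \<partial>M) = ennreal (l2_sq M (psum c (X k - A)))"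
          unfolding l2_sq_def using l2_integrable_sq[OF psum_l2, of c "X k - A"]
          by (simp add: nn_integral_eq_integral)
        also have "l2_sq M (psum c (X k - A)) = sum ?w (X k) - sum ?w A"
          using elim X(1) by (simp add: l2_sq_psum sum_diff)
        also have "sum ?w (X k) \<le> infsum ?w UNIV"
          using X(1) c by (intro finite_sum_le_infsum) auto
        finally show ?case by (simp add: ennreal_leI)
      qed
    qed
    also have "\<dots> = ennreal (infsum ?w UNIV - sum ?w A)" by (simp add: Liminf_const)
    finally show ?thesis .
  qed
  have "(\<integral>\<^sup>+x. ennreal ((norm (F x))\<^sup>2) \<partial>M) \<le> ennreal (infsum ?w UNIV)"
    using bound[of "{}"] by (simp add: psum_def)
  hence "(\<integral>\<^sup>+x. ennreal (norm ((norm (F x))\<^sup>2)) \<partial>M) < \<infinity>"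
    by (simp add: le_less_trans[OF _ ennreal_less_top])
  hence Fl: "F \<in> l2 M" using F by (intro l2I integrableI_bounded) auto
  have "l2_sq M (\<lambda>x. F x - psum c A x) \<le> infsum ?w UNIV - sum ?w A" if "finite A" for A
  proof -
    have "infsum ?w UNIV - sum ?w A \<ge> 0" using that c finite_sum_le_infsum[of ?w UNIV A] by auto
    moreover have "ennreal (l2_sq M (\<lambda>x. F x - psum c A x)) \<le> ennreal (infsum ?w UNIV - sum ?w A)"
      using bound[OF that] l2_integrable_sq[OF l2_diff[OF Fl psum_l2], of c A]
      unfolding l2_sq_def by (simp add: nn_integral_eq_integral)
    ultimately show ?thesis by (simp add: ennreal_le_iff)
  qed
  hence "((\<lambda>A. l2_sq M (\<lambda>x. F x - psum c A x)) \<longlongrightarrow> 0) (finite_subsets_at_top UNIV)"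
    by (intro tendsto_sandwich[OF _ _ tendsto_const tail_tendsto_0[OF c]])
       (auto intro!: eventually_finite_subsets_at_top_weakI)
  thus ?thesis using Fl by (simp add: l2_expansion_def)
qed

end

text \<open>Fatou's lemma and measurability of limits need sequences. Countability of the index type
  lets the net of finite sets be sampled along one.\<close>

lemma filterlim_to_nat_exhaustion:
  "finite {i::'i::countable. to_nat i < k}"
  "filterlim (\<lambda>k. {i::'i. to_nat i < k}) (finite_subsets_at_top UNIV) sequentially"
proof -
  show fin: "finite {i::'i. to_nat i < k}" for k
    by (rule finite_imageD[of to_nat]) (auto intro: finite_subset[of _ "{..<k}"] inj_onI)
  show "filterlim (\<lambda>k. {i::'i. to_nat i < k}) (finite_subsets_at_top UNIV) sequentially"
    unfolding filterlim_finite_subsets_at_top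
  proof safe
    fix Y :: "'i set" assume Y: "finite Y"
    have "\<forall>\<^sub>F k in sequentially. \<forall>i\<in>Y. to_nat i < k"
      using Y by (auto simp: eventually_ball_finite_distrib intro: eventually_gt_at_top)
    thus "\<forall>\<^sub>F k in sequentially. finite {i::'i. to_nat i < k} \<and> Y \<subseteq> {i. to_nat i < k} \<and> {i. to_nat i < k} \<subseteq> UNIV"
      by eventually_elim (use fin in auto)
  qed
qed

context orthonormal_family
begin

lemma psum_measurable [measurable]: "psum c A \<in> borel_measurable M"
  using psum_l2 l2_measurable by blast

text \<open>Bridge from pointwise series to L2. It is used for the Bargmann kernel as a function of
  x, for Bargmann transforms as functions of z, and for power series restricted to a
  polydisc.\<close>

lemma l2_expansion_of_pointwise:
  assumes c: "(\<lambda>i. (norm (c i))\<^sup>2) summable_on UNIV"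
    and F: "\<And>x. ((\<lambda>i. c i * e i x) has_sum F x) UNIV"
  shows "l2_expansion c F"
proof -
  let ?X = "\<lambda>k. {i::'i. to_nat i < k}"
  have lim: "(\<lambda>k. psum c (?X k) x) \<longlonglongrightarrow> F x" for x
    using filterlim_compose[OF F[of x, unfolded has_sum_def] filterlim_to_nat_exhaustion(2)]
    by (simp add: psum_def)
  have "F \<in> borel_measurable M"
    by (rule borel_measurable_LIMSEQ_metric[OF psum_measurable lim])
  thus ?thesis
    using l2_expansion_of_AE_limit[OF c _ filterlim_to_nat_exhaustion] lim by auto
qed

text \<open>A rapidly convergent subsequence of partial sums converges almost everywhere, and
  \<open>l2_expansion_of_AE_limit\<close> upgrades its limit to an expansion.\<close>

lemma Riesz_Fischer:
  assumes c: "(\<lambda>i. (norm (c i))\<^sup>2) summable_on UNIV"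
  obtains F where "l2_expansion c F"
proof -
  let ?w = "\<lambda>i. (norm (c i))\<^sup>2"
  let ?X = "\<lambda>k. {i::'i. to_nat i < k}"
  define tl where "tl A = infsum ?w UNIV - sum ?w A" for A
  have "(\<lambda>k. tl (?X k)) \<longlonglongrightarrow> 0"
    unfolding tl_def using filterlim_compose[OF tail_tendsto_0[OF c] filterlim_to_nat_exhaustion(2)] by simp
  hence "\<exists>n0. \<forall>n\<ge>n0. tl (?X n) < (1/4)^k" for k :: nat
    using order_tendstoD(2)[of "\<lambda>k. tl (?X k)" 0 sequentially "(1/4)^k"] by (simp add: eventually_sequentially)
  then obtain n0 where n0: "\<And>k n. n \<ge> n0 k \<Longrightarrow> tl (?X n) < (1/4)^k" by metis
  \<comment> \<open>The sum makes N monotone and at least \<open>n0 k\<close>; the summand k makes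
    it tend to infinity.\<close>
  define N where "N k = (\<Sum>j\<le>k. n0 j) + k" for k
  have N: "N k \<ge> n0 k" "N k \<ge> k" "N k \<le> N (Suc k)" for k
    unfolding N_def by (auto intro: trans_le_add1 member_le_sum)
  define Y where "Y k = ?X (N k)" for k
  have finY: "finite (Y k)" for k unfolding Y_def by (rule filterlim_to_nat_exhaustion(1))
  have Ymono: "Y k \<subseteq> Y (Suc k)" for k unfolding Y_def using N(3)[of k] by auto
  have "filterlim N sequentially sequentially"
    using N(2) by (intro filterlim_at_top_mono[OF filterlim_ident]) auto
  from filterlim_compose[OF filterlim_to_nat_exhaustion(2) this]
  have Ylim: "filterlim Y (finite_subsets_at_top UNIV) sequentially" by (simp add: Y_def[abs_def])
  define d where "d k = psum c (Y (Suc k) - Y k)" for k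
  have d: "psum c (Y (Suc k)) x - psum c (Y k) x = d k x" for k x
    unfolding d_def psum_def using Ymono finY by (simp add: sum_diff)
  \<comment> \<open>The rate 1/4 leaves room for the weight 2^k: the weighted squares still have a
    finite total integral, hence are summable almost everywhere.\<close>
  have dsq: "l2_sq M (d k) \<le> (1/4)^k" for k
  proof -
    have "l2_sq M (d k) = sum ?w (Y (Suc k)) - sum ?w (Y k)"
      unfolding d_def using Ymono finY by (simp add: l2_sq_psum sum_diff)
    also have "\<dots> \<le> tl (Y k)"
      unfolding tl_def using finite_sum_le_infsum[OF c finY[of "Suc k"]] by auto
    also have "\<dots> \<le> (1/4)^k" unfolding Y_def using n0[OF N(1)[of k]] by simp
    finally show ?thesis .
  qed
  have dm [measurable]: "d k \<in> borel_measurable M" for k unfolding d_def by (rule psum_measurable)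
  have "(\<integral>\<^sup>+x. (\<Sum>k. ennreal (2^k * (norm (d k x))\<^sup>2)) \<partial>M) = (\<Sum>k. \<integral>\<^sup>+x. ennreal (2^k * (norm (d k x))\<^sup>2) \<partial>M)"
    by (rule nn_integral_suminf) measurable
  also have "\<dots> = (\<Sum>k. ennreal (2^k * l2_sq M (d k)))"
  proof (rule suminf_cong)
    fix k
    have "integrable M (\<lambda>x. 2^k * (norm (d k x))\<^sup>2)"
      using l2_integrable_sq[OF psum_l2, of c "Y (Suc k) - Y k"] by (simp add: d_def)
    thus "(\<integral>\<^sup>+x. ennreal (2^k * (norm (d k x))\<^sup>2) \<partial>M) = ennreal (2^k * l2_sq M (d k))"
      by (simp add: nn_integral_eq_integral l2_sq_def)
  qed
  also have "\<dots> \<le> (\<Sum>k. ennreal ((1/2)^k))"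
  proof (intro suminf_le ennreal_leI)
    fix k
    have "2^k * l2_sq M (d k) \<le> 2^k * (1/4)^k" using dsq by (intro mult_left_mono) auto
    thus "2^k * l2_sq M (d k) \<le> (1/2)^k" by (simp flip: power_mult_distrib)
  qed auto
  also have "\<dots> = ennreal (\<Sum>k. (1/2)^k)"
    by (rule suminf_ennreal_eq) (auto simp: summable_geometric summable_sums)
  also have "\<dots> < \<infinity>" by simp
  finally have "AE x in M. (\<Sum>k. ennreal (2^k * (norm (d k x))\<^sup>2)) \<noteq> \<infinity>"
    by (intro nn_integral_noteq_infinite) auto
  hence conv: "AE x in M. convergent (\<lambda>k. psum c (Y k) x)"
  proof eventually_elim
    case (elim x)
    have s: "summable (\<lambda>k. 2^k * (norm (d k x))\<^sup>2)"
      using elim by (intro summable_suminf_not_top) auto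
    have "summable (\<lambda>k. norm (d k x))"
    proof (rule summable_comparison_test')
      show "summable (\<lambda>k. 2^k * (norm (d k x))\<^sup>2 + (1/2)^k)"
        using s by (intro summable_add summable_geometric) auto
      fix k :: nat
      define a where "a = norm (d k x)"
      define b :: real where "b = 2^k"
      have b: "b > 0" "(1/2)^k = 1 / b" by (auto simp: b_def power_one_over)
      \<comment> \<open>Weighted arithmetic-geometric mean inequality, 2 a \<le> b a^2 + 1/b with b
        = 2^k. It turns weighted square summability of the increments into absolute
        convergence.\<close>
      have "0 \<le> (b * a - 1)\<^sup>2" by simp
      also have "\<dots> = b * (b * a\<^sup>2 + 1/b - 2 * a)" using b by (simp add: power2_eq_square field_simps)
      finally have "2 * a \<le> b * a\<^sup>2 + 1/b" using b by (simp add: zero_le_mult_iff)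
      moreover have "a \<ge> 0" by (simp add: a_def)
      ultimately have "a \<le> b * a\<^sup>2 + 1/b" by linarith
      thus "norm (norm (d k x)) \<le> 2^k * (norm (d k x))\<^sup>2 + (1/2)^k"
        unfolding b(2) by (simp add: a_def b_def)
    qed
    hence "summable (\<lambda>k. d k x)" by (rule summable_norm_cancel)
    hence "(\<lambda>n. \<Sum>k<n. d k x) \<longlonglongrightarrow> (\<Sum>k. d k x)" by (rule summable_LIMSEQ)
    hence "(\<lambda>n. psum c (Y 0) x + (\<Sum>k<n. d k x)) \<longlonglongrightarrow> psum c (Y 0) x + (\<Sum>k. d k x)"
      by (intro tendsto_intros)
    moreover have "psum c (Y 0) x + (\<Sum>k<n. d k x) = psum c (Y n) x" for n
      unfolding d[symmetric] sum_lessThan_telescope[of "\<lambda>k. psum c (Y k) x"] by simp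
    ultimately show ?case by (auto simp: convergent_def)
  qed
  define F where "F x = lim (\<lambda>k. psum c (Y k) x)" for x
  have "F \<in> borel_measurable M" unfolding F_def by measurable
  moreover have "AE x in M. (\<lambda>k. psum c (Y k) x) \<longlonglongrightarrow> F x"
    using conv unfolding F_def by eventually_elim (simp add: convergent_LIMSEQ_iff)
  ultimately have "l2_expansion c F"
    by (rule l2_expansion_of_AE_limit[OF c _ finY Ylim])
  thus ?thesis by (rule that)
qed

lemma l2_expansion_cong_AE:
  assumes F: "l2_expansion c F" and G: "G \<in> borel_measurable M" and eq: "AE x in M. F x = G x"
  shows "l2_expansion c G"
proof -
  have Gl: "G \<in> l2 M" using l2_cong_AE[OF l2_expansion_l2[OF F] G eq] .
  have "l2_sq M (\<lambda>x. F x - psum c A x) = l2_sq M (\<lambda>x. G x - psum c A x)" for A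
    unfolding l2_sq_def using eq G l2_expansion_l2[OF F]
    by (intro integral_cong_AE) (auto dest!: l2_measurable)
  thus ?thesis using F Gl by (simp add: l2_expansion_def)
qed

end

text \<open>The dilated Hermite functions are shown to be of this kind. On the Fock side expansions
  are given pointwise, and the monomials are treated as an orthonormal family.\<close>

locale orthonormal_basis = orthonormal_family +
  assumes complete: "g \<in> l2 M \<Longrightarrow> (\<And>i. l2_inner M g (e i) = 0) \<Longrightarrow> AE x in M. g x = 0"
begin

text \<open>The function produced by Riesz-Fischer has the same coefficients as f, so their
  difference is orthogonal to the whole family.\<close>

lemma l2_expansion_self:
  assumes f: "f \<in> l2 M"
  shows "l2_expansion (\<lambda>i. l2_inner M f (e i)) f"
proof -
  obtain F where F: "l2_expansion (\<lambda>i. l2_inner M f (e i)) F"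
    using Riesz_Fischer[OF bessel_summable[OF f]] by blast
  have "AE x in M. F x - f x = 0"
    by (rule complete[OF l2_diff[OF l2_expansion_l2[OF F] f]])
       (simp add: l2_inner_diff_left[OF l2_expansion_l2[OF F] f e_l2] l2_expansion_coeff[OF F])
  thus ?thesis using l2_expansion_cong_AE[OF F l2_measurable[OF f]] by auto
qed

lemma Parseval:
  assumes f: "f \<in> l2 M"
  shows "((\<lambda>i. (norm (l2_inner M f (e i)))\<^sup>2) has_sum l2_sq M f) UNIV"
  using l2_expansion_norm[OF l2_expansion_self[OF f]] .

end


subsection \<open>Products of one-dimensional integrals\<close>

text \<open>Opens the Fubini theorems for finite product measures to vector types. The entries range
  over any Euclidean space, so that real and complex vectors are both covered.\<close>

lemma lborel_vec_eq_distr: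
  "(lborel :: ('a::euclidean_space ^ 'n::finite) measure) = distr (Pi\<^sub>M UNIV (\<lambda>_. lborel)) borel vec_lambda"
proof (rule lborel_eqI)
  interpret product_sigma_finite "\<lambda>_::'n. lborel :: 'a measure" by standard
  have m: "vec_lambda \<in> measurable (Pi\<^sub>M UNIV (\<lambda>_::'n. lborel :: 'a measure)) borel"
    by (subst borel_measurable_euclidean_space) (auto simp: Basis_vec_def inner_axis intro!: borel_measurable_inner)
  fix l u :: "'a ^ 'n" assume le: "\<And>b. b \<in> Basis \<Longrightarrow> l \<bullet> b \<le> u \<bullet> b"
  have le': "l $ j \<bullet> b \<le> u $ j \<bullet> b" if "b \<in> Basis" for j b
    using le[of "axis j b"] that by (auto simp: Basis_vec_def inner_axis)
  have "vec_lambda -` box l u \<inter> space (Pi\<^sub>M UNIV (\<lambda>_::'n. lborel :: 'a measure)) = Pi\<^sub>E UNIV (\<lambda>j. box (l $ j) (u $ j))"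
    by (auto simp: box_def Basis_vec_def inner_axis space_PiM PiE_def Pi_def)
  hence "emeasure (distr (Pi\<^sub>M UNIV (\<lambda>_. lborel)) borel vec_lambda) (box l u) = (\<Prod>j\<in>UNIV. emeasure lborel (box (l $ j) (u $ j)))"
    using m by (simp add: emeasure_distr emeasure_PiM)
  also have "\<dots> = (\<Prod>j\<in>UNIV. ennreal (\<Prod>b\<in>Basis. (u $ j - l $ j) \<bullet> b))"
    using le' by (intro prod.cong) (auto simp: emeasure_lborel_box)
  also have "\<dots> = ennreal (\<Prod>j\<in>UNIV. \<Prod>b\<in>Basis. (u $ j - l $ j) \<bullet> b)"
    by (intro prod_ennreal prod_nonneg) (auto simp: inner_diff_left le')
  also have "(\<Prod>j\<in>UNIV. \<Prod>b\<in>Basis. (u $ j - l $ j) \<bullet> b) = (\<Prod>b\<in>Basis. (u - l) \<bullet> b)"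
  proof -
    have "(\<Prod>b\<in>Basis. (u - l) \<bullet> b) = (\<Prod>b\<in>(\<lambda>(j, b). axis j b) ` (UNIV \<times> (Basis::'a set)). (u - l) \<bullet> (b :: 'a ^ 'n))"
      by (intro prod.cong) (auto simp: Basis_vec_def)
    also have "\<dots> = (\<Prod>(j, b)\<in>UNIV \<times> Basis. (u $ j - l $ j) \<bullet> b)"
      by (subst prod.reindex) (auto simp: inj_on_def axis_eq_axis inner_axis split_beta)
    finally show ?thesis by (simp add: prod.cartesian_product)
  qed
  finally show "emeasure (distr (Pi\<^sub>M UNIV (\<lambda>_. lborel)) borel vec_lambda) (box l u) = ennreal (\<Prod>b\<in>Basis. (u - l) \<bullet> b)" .
qed simp

lemma measurable_vec_lambda_PiM [measurable]:
  "vec_lambda \<in> measurable (Pi\<^sub>M UNIV (\<lambda>_::'n::finite. lborel :: 'a::euclidean_space measure)) borel"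
  by (subst borel_measurable_euclidean_space) (auto simp: Basis_vec_def inner_axis intro!: borel_measurable_inner)

lemma measurable_vec_nth [measurable]: "(\<lambda>x::'a::euclidean_space ^ 'n::finite. x $ j) \<in> borel_measurable borel"
  by (intro borel_measurable_continuous_onI continuous_intros)

lemma
  fixes f :: "'n::finite \<Rightarrow> 'a::euclidean_space \<Rightarrow> 'b::{real_normed_field, banach, second_countable_topology}"
  assumes "\<And>j. integrable lborel (f j)"
  shows integrable_prod_vec: "integrable lborel (\<lambda>x::'a ^ 'n. \<Prod>j\<in>UNIV. f j (x $ j))"
    and integral_prod_vec: "(LINT x|lborel. (\<Prod>j\<in>UNIV. f j (x $ j))) = (\<Prod>j\<in>UNIV. LINT x|lborel. f j x)"
proof -
  interpret product_sigma_finite "\<lambda>_::'n. lborel :: 'a measure" by standard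
  have [measurable]: "f j \<in> borel_measurable borel" for j using assms[of j] by auto
  show "integrable lborel (\<lambda>x::'a ^ 'n. \<Prod>j\<in>UNIV. f j (x $ j))"
    unfolding lborel_vec_eq_distr
    by (subst integrable_distr_eq) (auto intro!: product_integrable_prod assms)
  show "(LINT x|lborel. (\<Prod>j\<in>UNIV. f j (x $ j))) = (\<Prod>j\<in>UNIV. LINT x|lborel. f j x)"
    unfolding lborel_vec_eq_distr
    by (subst integral_distr) (auto intro!: product_integral_prod assms)
qed


subsection \<open>Hermite functions on the line\<close>

text \<open>The field is left general because the orthogonality relations are real while the
  generating function is obtained from complex Taylor series.\<close>

fun hermite_poly :: "nat \<Rightarrow> 'a::real_normed_field \<Rightarrow> 'a" where
  "hermite_poly 0 x = 1"
| "hermite_poly (Suc 0) x = 2 * x"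
| "hermite_poly (Suc (Suc k)) x = 2 * x * hermite_poly (Suc k) x - 2 * of_nat (Suc k) * hermite_poly k x"

text \<open>At k = 0 the truncated index \<open>k - 1\<close> is harmless, its coefficient being
  zero. Later formulas with \<open>k - 1\<close> and \<open>k - 2\<close> rely on the same
  effect.\<close>

lemma hermite_poly_Suc: "hermite_poly (Suc k) x = 2 * x * hermite_poly k x - 2 * of_nat k * hermite_poly (k - 1) x"
  by (cases k) simp_all

lemma hermite_poly_of_real: "hermite_poly k (of_real x :: 'a::real_normed_field) = of_real (hermite_poly k x)"
  by (induction k x rule: hermite_poly.induct) simp_all

lemma has_field_derivative_hermite_poly [derivative_intros]:
  "(hermite_poly k has_field_derivative (2 * of_nat k * hermite_poly (k - 1) x)) (at x)"
proof (induction k x rule: hermite_poly.induct)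
  case (3 k x)
  have "((\<lambda>x. 2 * x * hermite_poly (Suc k) x - 2 * of_nat (Suc k) * hermite_poly k x) has_field_derivative
      (2 * hermite_poly (Suc k) x + (2 * of_nat (Suc k) * hermite_poly (Suc k - 1) x) * (2 * x)
        - (2 * of_nat k * hermite_poly (k - 1) x) * (2 * of_nat (Suc k)))) (at x)"
    by (rule derivative_eq_intros 3 refl | simp)+
  also have "2 * hermite_poly (Suc k) x + (2 * of_nat (Suc k) * hermite_poly (Suc k - 1) x) * (2 * x)
        - (2 * of_nat k * hermite_poly (k - 1) x) * (2 * of_nat (Suc k))
      = 2 * hermite_poly (Suc k) x + 2 * of_nat (Suc k) * (2 * x * hermite_poly k x - 2 * of_nat k * hermite_poly (k - 1) x)"
    by (simp add: algebra_simps)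
  also have "\<dots> = 2 * of_nat (Suc (Suc k)) * hermite_poly (Suc (Suc k) - 1) x"
    unfolding hermite_poly_Suc[symmetric] by (simp add: algebra_simps)
  finally show ?case by (simp only: hermite_poly.simps)
qed (auto intro!: derivative_eq_intros simp: fun_eq_iff[symmetric])

lemma higher_deriv_gaussian:
  "(deriv ^^ k) (\<lambda>y::real. exp (- y\<^sup>2)) = (\<lambda>x. (-1) ^ k * hermite_poly k x * exp (- x\<^sup>2))"
proof (induction k)
  case (Suc k)
  have "((\<lambda>x. (-1) ^ k * hermite_poly k x * exp (- x\<^sup>2)) has_real_derivative
      (-1) ^ Suc k * hermite_poly (Suc k) x * exp (- x\<^sup>2)) (at x)" for x :: real
    unfolding hermite_poly_Suc[of k]
    by (rule derivative_eq_intros refl | simp add: algebra_simps)+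
  thus ?case using Suc by (auto intro!: DERIV_imp_deriv)
qed simp

definition hermite_norm :: "nat \<Rightarrow> real" where
  "hermite_norm k = 1 / sqrt (sqrt pi * 2 ^ k * fact k)"

lemma hermite_norm_pos: "hermite_norm k > 0"
  by (simp add: hermite_norm_def)

lemma hermite_fun1_eq: "hermite_fun1 k x = hermite_norm k * (hermite_poly k x * exp (- x\<^sup>2 / 2))"
proof -
  have "(sqrt pi * 2 ^ k * fact k) powr (- 1 / 2) = hermite_norm k"
    by (simp add: hermite_norm_def powr_minus_divide powr_half_sqrt)
  moreover have "(-1) ^ k * (-1::real) ^ k = 1" by (simp flip: power_mult_distrib)
  moreover have "exp (x\<^sup>2) * exp (- x\<^sup>2) = 1" by (simp flip: exp_add)
  ultimately show ?thesis
    unfolding hermite_fun1_def higher_deriv_gaussian by (simp add: algebra_simps)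
qed

lemma hermite_norm_Suc: "hermite_norm (Suc k) = hermite_norm k / sqrt (2 * real (Suc k))"
proof -
  have "sqrt pi * 2 ^ Suc k * fact (Suc k) = (sqrt pi * 2 ^ k * fact k) * (2 * real (Suc k))" by simp
  thus ?thesis unfolding hermite_norm_def by (simp only: real_sqrt_mult divide_divide_eq_left)
qed

text \<open>A class closed under sums, products, multiplication by x and dilation, inside which
  integrability and vanishing at infinity are automatic. Every integration by parts below takes
  place in it, without boundary terms.\<close>

definition gauss_decay :: "(real \<Rightarrow> real) \<Rightarrow> bool" where
  "gauss_decay u \<longleftrightarrow> continuous_on UNIV u \<and> (\<exists>a>0. \<exists>C. \<forall>x. \<bar>u x\<bar> \<le> C * exp (- a * x\<^sup>2))"

lemma gauss_decayE:
  assumes "gauss_decay u"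
  obtains a C where "a > 0" "C \<ge> 0" "\<And>x. \<bar>u x\<bar> \<le> C * exp (- a * x\<^sup>2)"
proof -
  obtain a C where *: "a > 0" "\<And>x. \<bar>u x\<bar> \<le> C * exp (- a * x\<^sup>2)" using assms by (auto simp: gauss_decay_def)
  moreover have "C \<ge> 0" using *(2)[of 0] by (simp add: order_trans[OF abs_ge_zero])
  ultimately show ?thesis using that by blast
qed

lemma gauss_decay_gaussian: "a > 0 \<Longrightarrow> gauss_decay (\<lambda>x. exp (- a * x\<^sup>2))"
  unfolding gauss_decay_def by (intro conjI exI[of _ a] exI[of _ 1]) (auto intro!: continuous_intros)

lemma gauss_decay_scale:
  assumes u: "gauss_decay u"
  shows "gauss_decay (\<lambda>x. c * u x)"
proof -
  obtain a C where *: "a > 0" "C \<ge> 0" "\<And>x. \<bar>u x\<bar> \<le> C * exp (- a * x\<^sup>2)" using gauss_decayE[OF u] by blast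
  have "\<bar>c * u x\<bar> \<le> (\<bar>c\<bar> * C) * exp (- a * x\<^sup>2)" for x
    using mult_left_mono[OF *(3)[of x], of "\<bar>c\<bar>"] by (simp add: abs_mult mult.assoc)
  thus "gauss_decay (\<lambda>x. c * u x)" using *(1) u unfolding gauss_decay_def
    by (intro conjI exI[of _ a] exI[of _ "\<bar>c\<bar> * C"]) (auto intro!: continuous_intros)
qed

lemma gauss_decay_add:
  assumes "gauss_decay u" "gauss_decay v"
  shows "gauss_decay (\<lambda>x. u x + v x)"
proof -
  obtain a C where 1: "a > 0" "C \<ge> 0" "\<And>x. \<bar>u x\<bar> \<le> C * exp (- a * x\<^sup>2)" using gauss_decayE[OF assms(1)] by blast
  obtain b D where 2: "b > 0" "D \<ge> 0" "\<And>x. \<bar>v x\<bar> \<le> D * exp (- b * x\<^sup>2)" using gauss_decayE[OF assms(2)] by blast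
  define m where "m = min a b"
  have "\<bar>u x + v x\<bar> \<le> (C + D) * exp (- m * x\<^sup>2)" for x
  proof -
    have "exp (- a * x\<^sup>2) \<le> exp (- m * x\<^sup>2)" "exp (- b * x\<^sup>2) \<le> exp (- m * x\<^sup>2)"
      unfolding m_def by (auto intro!: mult_right_mono)
    hence "C * exp (- a * x\<^sup>2) \<le> C * exp (- m * x\<^sup>2)" "D * exp (- b * x\<^sup>2) \<le> D * exp (- m * x\<^sup>2)"
      using 1(2) 2(2) by (auto intro!: mult_left_mono)
    thus ?thesis using 1(3)[of x] 2(3)[of x] abs_triangle_ineq[of "u x" "v x"] unfolding distrib_right by linarith
  qed
  moreover have "m > 0" using 1 2 by (simp add: m_def)
  ultimately show ?thesis using assms unfolding gauss_decay_def
    by (intro conjI exI[of _ m] exI[of _ "C + D"]) (auto intro!: continuous_intros)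
qed

lemma gauss_decay_diff: "gauss_decay u \<Longrightarrow> gauss_decay v \<Longrightarrow> gauss_decay (\<lambda>x. u x - v x)"
  using gauss_decay_add[of u "\<lambda>x. - 1 * v x"] gauss_decay_scale[of v "- 1"] by simp

lemma gauss_decay_mult:
  assumes "gauss_decay u" "gauss_decay v"
  shows "gauss_decay (\<lambda>x. u x * v x)"
proof -
  obtain a C where 1: "a > 0" "C \<ge> 0" "\<And>x. \<bar>u x\<bar> \<le> C * exp (- a * x\<^sup>2)" using gauss_decayE[OF assms(1)] by blast
  obtain b D where 2: "b > 0" "D \<ge> 0" "\<And>x. \<bar>v x\<bar> \<le> D * exp (- b * x\<^sup>2)" using gauss_decayE[OF assms(2)] by blast
  have "\<bar>u x * v x\<bar> \<le> (C * D) * exp (- (a + b) * x\<^sup>2)" for x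
  proof -
    have "\<bar>u x * v x\<bar> \<le> (C * exp (- a * x\<^sup>2)) * (D * exp (- b * x\<^sup>2))"
      unfolding abs_mult using 1 2 by (intro mult_mono) auto
    also have "\<dots> = (C * D) * exp (- (a + b) * x\<^sup>2)" by (simp add: algebra_simps exp_add[symmetric] flip: exp_add)
    finally show ?thesis .
  qed
  moreover have "a + b > 0" using 1 2 by simp
  ultimately show ?thesis using assms unfolding gauss_decay_def by (intro conjI exI[of _ "a + b"] exI[of _ "C * D"]) (auto intro!: continuous_intros)
qed

text \<open>Half of the exponent a is spent on absorbing x, through |x| \<le> 1 + x^2 \<le> (1 +
  2/a) exp(a x^2 / 2).\<close>

lemma gauss_decay_times_id:
  assumes "gauss_decay u"
  shows "gauss_decay (\<lambda>x. x * u x)"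
proof -
  obtain a C where 1: "a > 0" "C \<ge> 0" "\<And>x. \<bar>u x\<bar> \<le> C * exp (- a * x\<^sup>2)" using gauss_decayE[OF assms(1)] by blast
  have x: "\<bar>x\<bar> \<le> (1 + 2 / a) * exp (a / 2 * x\<^sup>2)" for x :: real
  proof -
    have "\<bar>x\<bar> \<le> x\<^sup>2 + (1/2)\<^sup>2" using zero_le_power2[of "\<bar>x\<bar> - 1/2"] unfolding power2_diff power2_abs by simp
    hence "\<bar>x\<bar> \<le> 1 + x\<^sup>2" by (simp add: power2_eq_square)
    also have "1 + x\<^sup>2 \<le> (1 + 2 / a) * (1 + a / 2 * x\<^sup>2)" using 1(1) by (simp add: field_simps add_nonneg_nonneg)
    also have "\<dots> \<le> (1 + 2 / a) * exp (a / 2 * x\<^sup>2)" using 1(1) by (intro mult_left_mono exp_ge_add_one_self) auto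
    finally show ?thesis .
  qed
  have "\<bar>x * u x\<bar> \<le> ((1 + 2 / a) * C) * exp (- (a / 2) * x\<^sup>2)" for x
  proof -
    have "\<bar>x * u x\<bar> \<le> ((1 + 2 / a) * exp (a / 2 * x\<^sup>2)) * (C * exp (- a * x\<^sup>2))"
      unfolding abs_mult using 1 x by (intro mult_mono) auto
    also have "\<dots> = ((1 + 2 / a) * C) * (exp (a / 2 * x\<^sup>2) * exp (- a * x\<^sup>2))" by simp
    also have "exp (a / 2 * x\<^sup>2) * exp (- a * x\<^sup>2) = exp (- (a / 2) * x\<^sup>2)"
      unfolding exp_add[symmetric] by (simp add: algebra_simps)
    finally show ?thesis .
  qed
  thus ?thesis using assms 1(1) unfolding gauss_decay_def
    by (intro conjI exI[of _ "a / 2"] exI[of _ "(1 + 2 / a) * C"]) (auto intro!: continuous_intros)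
qed

lemma gauss_decay_dilate:
  assumes "gauss_decay u" "c > 0"
  shows "gauss_decay (\<lambda>x. u (c * x))"
proof -
  obtain a C where 1: "a > 0" "C \<ge> 0" "\<And>x. \<bar>u x\<bar> \<le> C * exp (- a * x\<^sup>2)" using gauss_decayE[OF assms(1)] by blast
  have "\<bar>u (c * x)\<bar> \<le> C * exp (- (a * c\<^sup>2) * x\<^sup>2)" for x using 1(3)[of "c * x"] by (simp add: power_mult_distrib mult.assoc)
  moreover have "a * c\<^sup>2 > 0" using 1 assms by simp
  moreover have "continuous_on UNIV (\<lambda>x. u (c * x))"
    using assms by (auto simp: gauss_decay_def intro!: continuous_on_compose2[of UNIV u] continuous_intros)
  ultimately show ?thesis unfolding gauss_decay_def by (intro conjI exI[of _ "a * c\<^sup>2"] exI[of _ C]) auto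
qed

lemma integrable_gaussian: "a > 0 \<Longrightarrow> integrable lborel (\<lambda>x::real. exp (- a * x\<^sup>2))"
proof -
  assume a: "a > 0"
  have "integrable lborel (\<lambda>x::real. exp (- x\<^sup>2))"
    using has_bochner_integral_even_function[OF gaussian_moment_0] by (auto simp: has_bochner_integral_iff)
  from lborel_integrable_real_affine[OF this, of "sqrt a" 0] a show ?thesis by (simp add: power_mult_distrib)
qed

lemma gauss_decay_integrable:
  assumes "gauss_decay u"
  shows "integrable lborel u"
proof -
  obtain a C where 1: "a > 0" "C \<ge> 0" "\<And>x. \<bar>u x\<bar> \<le> C * exp (- a * x\<^sup>2)" using gauss_decayE[OF assms(1)] by blast
  have "integrable lborel (\<lambda>x. C * exp (- a * x\<^sup>2))" using integrable_gaussian[OF 1(1)] by simp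
  thus ?thesis
  proof (rule Bochner_Integration.integrable_bound)
    show "u \<in> borel_measurable lborel" using assms by (auto simp: gauss_decay_def intro: borel_measurable_continuous_onI)
    show "AE x in lborel. norm (u x) \<le> norm (C * exp (- a * x\<^sup>2))"
      using 1 by (auto intro: order_trans[OF _ abs_ge_self])
  qed
qed

lemma gauss_decay_tendsto:
  assumes "gauss_decay u"
  shows "(u \<longlongrightarrow> 0) at_top" "(u \<longlongrightarrow> 0) at_bot"
proof -
  obtain a C where 1: "a > 0" "C \<ge> 0" "\<And>x. \<bar>u x\<bar> \<le> C * exp (- a * x\<^sup>2)" using gauss_decayE[OF assms(1)] by blast
  have *: "((\<lambda>x. C * exp (- a * x\<^sup>2)) \<longlongrightarrow> 0) at_top" "((\<lambda>x. C * exp (- a * x\<^sup>2)) \<longlongrightarrow> 0) at_bot"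
    using 1(1) by real_asymp+
  show "(u \<longlongrightarrow> 0) at_top" "(u \<longlongrightarrow> 0) at_bot"
    by (rule Lim_null_comparison[OF _ *(1)], use 1 in simp, rule Lim_null_comparison[OF _ *(2)], use 1 in simp)
qed

text \<open>The fundamental theorem of calculus on the whole line; applied to products and to
  Wronskians it serves as integration by parts.\<close>

lemma gauss_decay_integral_deriv:
  assumes g: "gauss_decay g" and g': "gauss_decay g'"
    and d: "\<And>x. (g has_real_derivative g' x) (at x)"
  shows "(LINT x|lborel. g' x) = 0"
proof -
  have "(LBINT x=-\<infinity>..\<infinity>. g' x) = 0 - 0"
  proof (rule interval_integral_FTC_integrable[of "-\<infinity>" "\<infinity>" g])
    show "((g \<circ> real_of_ereal) \<longlongrightarrow> 0) (at_right (- \<infinity>))" "((g \<circ> real_of_ereal) \<longlongrightarrow> 0) (at_left \<infinity>)"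
      using gauss_decay_tendsto[OF g] by (simp_all add: ereal_tendsto_simps)
    show "set_integrable lborel (einterval (- \<infinity>) \<infinity>) g'"
      using gauss_decay_integrable[OF g'] by (simp add: set_integrable_def)
    show "isCont g' x" for x using g' by (simp add: gauss_decay_def continuous_on_eq_continuous_at)
  qed (use d in \<open>auto simp: has_real_derivative_iff_has_vector_derivative\<close>)
  thus ?thesis by (simp add: interval_lebesgue_integral_def set_lebesgue_integral_def)
qed

lemma gauss_decay_hermite_poly: "a > 0 \<Longrightarrow> gauss_decay (\<lambda>x. hermite_poly k x * exp (- a * x\<^sup>2))"
proof (induction k rule: induct_nat_012)
  case 0
  then show ?case using gauss_decay_gaussian by simp
next
  case 1
  then show ?case using gauss_decay_scale[OF gauss_decay_times_id[OF gauss_decay_gaussian], of a 2] by (simp add: mult.assoc)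
next
  case (ge2 k)
  have "gauss_decay (\<lambda>x. 2 * (x * (hermite_poly (Suc k) x * exp (- a * x\<^sup>2))) - 2 * of_nat (Suc k) * (hermite_poly k x * exp (- a * x\<^sup>2)))"
    by (intro gauss_decay_diff gauss_decay_scale gauss_decay_times_id ge2)
  then show ?case by (simp add: algebra_simps)
qed

lemma gauss_decay_hermite_fun1: "gauss_decay (hermite_fun1 k)"
  using gauss_decay_scale[OF gauss_decay_hermite_poly[of "1/2" k], of "hermite_norm k"]
  by (simp add: hermite_fun1_eq[abs_def])

section \<open>Orthogonality and generating function of the Hermite functions\<close>

lemma integral_exp_neg_square: "(LINT x|lborel. exp (- x\<^sup>2)) = sqrt pi"
  using has_bochner_integral_even_function[OF gaussian_moment_0] by (simp add: has_bochner_integral_iff)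

text \<open>Integrating the derivative of H_j H_k exp(-x^2) gives I(j+1, k) = 2 k I(j, k-1). This
  descends to j = 0, where symmetry of I disposes of every k > 0 and the Gaussian integral
  remains.\<close>

lemma integral_hermite_poly:
  "(LINT x|lborel. hermite_poly j x * hermite_poly k x * exp (- x\<^sup>2)) = (if j = k then sqrt pi * 2 ^ k * fact k else 0)"
proof -
  define I where "I j k = (LINT x::real|lborel. hermite_poly j x * hermite_poly k x * exp (- x\<^sup>2))" for j k
  have gd: "gauss_decay (\<lambda>x. hermite_poly j x * hermite_poly k x * exp (- x\<^sup>2))" for j k
  proof -
    have "exp (- (1/2) * x\<^sup>2) * exp (- (1/2) * x\<^sup>2) = exp (- x\<^sup>2)" for x :: real
      unfolding exp_add[symmetric] by (simp add: field_simps)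
    hence "(\<lambda>x. (hermite_poly j x * exp (- (1/2) * x\<^sup>2)) * (hermite_poly k x * exp (- (1/2) * x\<^sup>2))) =
        (\<lambda>x::real. hermite_poly j x * hermite_poly k x * exp (- x\<^sup>2))"
      by (metis (no_types, opaque_lifting) mult.assoc mult.left_commute)
    thus ?thesis using gauss_decay_mult[OF gauss_decay_hermite_poly[of "1/2" j] gauss_decay_hermite_poly[of "1/2" k]] by simp
  qed
  have rec: "I (Suc j) k = 2 * real k * I j (k - 1)" for j k
  proof -
    let ?g' = "\<lambda>x::real. 2 * of_nat k * (hermite_poly j x * hermite_poly (k - 1) x * exp (- x\<^sup>2)) - hermite_poly (Suc j) x * hermite_poly k x * exp (- x\<^sup>2)"
    have "((\<lambda>x. hermite_poly j x * hermite_poly k x * exp (- x\<^sup>2)) has_real_derivative ?g' x) (at x)" for x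
      unfolding hermite_poly_Suc[of j]
      by (rule derivative_eq_intros refl | simp add: algebra_simps)+
    hence "(LINT x|lborel. ?g' x) = 0"
      by (intro gauss_decay_integral_deriv[OF gd[of j k]] gauss_decay_diff gauss_decay_scale gd)
    thus ?thesis unfolding I_def using gauss_decay_integrable[OF gd] by simp
  qed
  have sym: "I j k = I k j" for j k unfolding I_def by (simp add: mult.commute)
  have "I j k = (if j = k then sqrt pi * 2 ^ k * fact k else 0)"
  proof (induction j arbitrary: k)
    case 0
    show ?case
    proof (cases k)
      case 0
      then show ?thesis by (simp add: I_def integral_exp_neg_square)
    next
      case (Suc k')
      then show ?thesis using rec[of k' 0] sym[of 0 k] by simp
    qed
  next
    case (Suc j)
    show ?case
    proof (cases k)
      case 0
      then show ?thesis using rec[of j 0] by simp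
    next
      case (Suc k')
      then show ?thesis using rec[of j k] Suc.IH[of k'] by simp
    qed
  qed
  thus ?thesis by (simp add: I_def)
qed

text \<open>The factor \<open>sqrt c\<close> preserves orthonormality. The value c = 1 gives the
  original Hermite functions, c = sqrt 2 those adapted to the kernel of the theorem.\<close>

definition dhermite :: "real \<Rightarrow> nat \<Rightarrow> real \<Rightarrow> real" where
  "dhermite c k x = sqrt c * hermite_fun1 k (c * x)"

lemma gauss_decay_dhermite: "c > 0 \<Longrightarrow> gauss_decay (dhermite c k)"
  unfolding dhermite_def[abs_def] by (intro gauss_decay_scale gauss_decay_dilate gauss_decay_hermite_fun1)

lemma dhermite_orthonormal:
  assumes c: "c > 0"
  shows "(LINT x|lborel. dhermite c j x * dhermite c k x) = (if j = k then 1 else 0)"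
proof -
  have "(LINT x|lborel. dhermite c j x * dhermite c k x) = c * (LINT x|lborel. hermite_fun1 j (c * x) * hermite_fun1 k (c * x))"
    using c unfolding dhermite_def by (simp flip: integral_mult_right_zero) (simp add: algebra_simps)
  also have "\<dots> = (LINT x|lborel. hermite_fun1 j x * hermite_fun1 k x)"
    using lborel_integral_real_affine[of c "\<lambda>x. hermite_fun1 j x * hermite_fun1 k x" 0] c by simp
  also have "\<dots> = (LINT x|lborel. (hermite_norm j * hermite_norm k) * (hermite_poly j x * hermite_poly k x * exp (- x\<^sup>2)))"
  proof (rule Bochner_Integration.integral_cong)
    fix x :: real
    have "exp (- x\<^sup>2 / 2) * exp (- x\<^sup>2 / 2) = exp (- x\<^sup>2)" unfolding exp_add[symmetric] by (simp add: field_simps)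
    thus "hermite_fun1 j x * hermite_fun1 k x = (hermite_norm j * hermite_norm k) * (hermite_poly j x * hermite_poly k x * exp (- x\<^sup>2))"
      unfolding hermite_fun1_eq by (metis (no_types, opaque_lifting) mult.assoc mult.left_commute)
  qed simp
  also have "\<dots> = hermite_norm j * hermite_norm k * (if j = k then sqrt pi * 2 ^ k * fact k else 0)"
    unfolding integral_mult_right_zero integral_hermite_poly by simp
  also have "\<dots> = (if j = k then 1 else 0)" by (auto simp: hermite_norm_def field_simps)
  finally show ?thesis .
qed

text \<open>Differentiation in t raises the index while shifting the argument to x - t. At t = 0
  this identifies the Taylor coefficients of the generating function.\<close>

lemma higher_deriv_hermite_gen:
  "(deriv ^^ k) (\<lambda>t::complex. exp (2 * x * t - t\<^sup>2)) = (\<lambda>t. hermite_poly k (x - t) * exp (2 * x * t - t\<^sup>2))"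
proof (induction k)
  case (Suc k)
  have "((\<lambda>t. hermite_poly k (x - t) * exp (2 * x * t - t\<^sup>2)) has_field_derivative
      hermite_poly (Suc k) (x - t) * exp (2 * x * t - t\<^sup>2)) (at t)" for t
    unfolding hermite_poly_Suc[of k]
    by (rule derivative_eq_intros DERIV_chain2[OF has_field_derivative_hermite_poly] refl | simp add: algebra_simps)+
  thus ?case using Suc by (auto intro!: DERIV_imp_deriv)
qed simp

lemma hermite_poly_gen_sums:
  fixes x t :: complex
  shows "(\<lambda>k. hermite_poly k x / fact k * t ^ k) sums exp (2 * x * t - t\<^sup>2)"
proof -
  have "(\<lambda>k. (deriv ^^ k) (\<lambda>t::complex. exp (2 * x * t - t\<^sup>2)) 0 / fact k * (t - 0) ^ k) sums exp (2 * x * t - t\<^sup>2)"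
    by (rule holomorphic_power_series[where r="norm t + 1"]) (auto intro!: holomorphic_intros simp: add_pos_nonneg)
  thus ?thesis by (simp add: higher_deriv_hermite_gen)
qed

text \<open>The substitution t = z / sqrt 2 lets the normalisation of the Hermite functions absorb
  2^k, leaving the normalised Fock monomials. Absolute convergence is recorded as well because
  multiplying such series over the coordinates requires it.\<close>

lemma hermite_gen1:
  fixes x :: real and z :: complex
  shows "(\<lambda>k. norm (z ^ k / complex_of_real (sqrt (fact k)) * complex_of_real (hermite_fun1 k x))) summable_on UNIV" (is ?A)
    and "((\<lambda>k. z ^ k / complex_of_real (sqrt (fact k)) * complex_of_real (hermite_fun1 k x)) has_sum
      complex_of_real (hermite_norm 0) * exp (- (complex_of_real x)\<^sup>2 / 2 + complex_of_real (sqrt 2) * x * z - z\<^sup>2 / 2)) UNIV" (is ?B)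
proof -
  define C where "C = complex_of_real (hermite_norm 0) * exp (- (complex_of_real x)\<^sup>2 / 2)"
  define t where "t = z / complex_of_real (sqrt 2)"
  let ?f = "\<lambda>k t. hermite_poly k (complex_of_real x) / fact k * t ^ k"
  have eq: "z ^ k / complex_of_real (sqrt (fact k)) * complex_of_real (hermite_fun1 k x) = C * ?f k t" for k
  proof -
    have 1: "hermite_norm k = hermite_norm 0 / (sqrt 2 ^ k * sqrt (fact k))"
      by (simp add: hermite_norm_def real_sqrt_mult real_sqrt_power)
    have 2: "Z / s * (P / (S * s) * (H * E)) = P * E * (H / (s * s) * (Z / S))" for P S H E Z s :: complex
      by (simp add: mult_ac)
    have 3: "complex_of_real (sqrt (fact k)) * complex_of_real (sqrt (fact k)) = fact k"
      by (simp flip: of_real_mult)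
    have 4: "complex_of_real (exp (- x\<^sup>2 / 2)) = exp (- (complex_of_real x)\<^sup>2 / 2)"
      by (simp flip: exp_of_real)
    have "z ^ k / complex_of_real (sqrt (fact k)) * complex_of_real (hermite_fun1 k x) =
        z ^ k / complex_of_real (sqrt (fact k)) * (complex_of_real (hermite_norm 0) /
          (complex_of_real (sqrt 2) ^ k * complex_of_real (sqrt (fact k))) *
          (hermite_poly k (complex_of_real x) * exp (- (complex_of_real x)\<^sup>2 / 2)))"
      unfolding hermite_fun1_eq 1 hermite_poly_of_real 4[symmetric] by simp
    also have "\<dots> = C * ?f k t" unfolding 2 3 C_def t_def power_divide ..
    finally show ?thesis .
  qed
  \<comment> \<open>A power series that converges at a point of modulus \<open>norm t + 1\<close>
    converges absolutely at t.\<close>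
  have "summable (\<lambda>k. ?f k (complex_of_real (norm t + 1)))"
    using hermite_poly_gen_sums sums_summable by blast
  hence "summable (\<lambda>k. norm (?f k t))" by (rule powser_insidea) simp
  hence s: "(\<lambda>k. norm (?f k t)) summable_on UNIV"
    using norm_summable_imp_summable_on[of "\<lambda>k. norm (?f k t)"] by simp
  thus ?A unfolding eq norm_mult[of C] by (rule summable_on_cmult_right)
  have "(\<lambda>k. ?f k t) summable_on UNIV" using s by (rule abs_summable_summable)
  hence i: "((\<lambda>k. ?f k t) has_sum infsum (\<lambda>k. ?f k t) UNIV) UNIV" by (rule has_sum_infsum)
  have "infsum (\<lambda>k. ?f k t) UNIV = exp (2 * complex_of_real x * t - t\<^sup>2)"
    by (rule sums_unique2[OF has_sum_imp_sums[OF i] hermite_poly_gen_sums])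
  with i have "((\<lambda>k. ?f k t) has_sum exp (2 * complex_of_real x * t - t\<^sup>2)) UNIV" by simp
  hence h: "((\<lambda>k. C * ?f k t) has_sum C * exp (2 * complex_of_real x * t - t\<^sup>2)) UNIV" by (rule has_sum_cmult_right)
  have s2: "complex_of_real (sqrt 2) * complex_of_real (sqrt 2) = 2" by (simp flip: of_real_mult)
  have "2 * complex_of_real x * t = complex_of_real (sqrt 2) * x * z"
    unfolding t_def using s2 by (simp add: field_simps)
  moreover have "t\<^sup>2 = z\<^sup>2 / 2" unfolding t_def using s2 by (simp add: power_divide power2_eq_square)
  ultimately have e: "2 * complex_of_real x * t - t\<^sup>2 = complex_of_real (sqrt 2) * x * z - z\<^sup>2 / 2" by (simp only:)
  have "C * exp (2 * complex_of_real x * t - t\<^sup>2) = complex_of_real (hermite_norm 0) * exp (- (complex_of_real x)\<^sup>2 / 2 + complex_of_real (sqrt 2) * x * z - z\<^sup>2 / 2)"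
    unfolding C_def e add_diff_eq[symmetric] exp_add by simp
  thus ?B using h unfolding eq by simp
qed

section \<open>The Hermite differential equation and the coefficients between two dilations\<close>

lemma has_real_derivative_hermite_gauss:
  "((\<lambda>x. hermite_poly k x * exp (- x\<^sup>2 / 2)) has_real_derivative (x * hermite_poly k x - hermite_poly (Suc k) x) * exp (- x\<^sup>2 / 2)) (at x)"
  unfolding hermite_poly_Suc[of k]
  by (rule derivative_eq_intros refl | simp add: algebra_simps)+

text \<open>The differentiated function is itself the derivative of u = H_k exp(-x^2/2), so this is
  the eigenvalue equation -u'' + x^2 u = (2k+1) u.\<close>

lemma has_real_derivative_hermite_gauss2:
  "((\<lambda>x. (x * hermite_poly k x - hermite_poly (Suc k) x) * exp (- x\<^sup>2 / 2)) has_real_derivative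
     (x\<^sup>2 - (2 * real k + 1)) * (hermite_poly k x * exp (- x\<^sup>2 / 2))) (at x)"
proof -
  have "((\<lambda>x. (x * hermite_poly k x - hermite_poly (Suc k) x) * exp (- x\<^sup>2 / 2)) has_real_derivative
     (hermite_poly k x + 2 * real k * hermite_poly (k - 1) x * x - 2 * real (Suc k) * hermite_poly k x) * exp (- x\<^sup>2 / 2)
      + - x * exp (- x\<^sup>2 / 2) * (x * hermite_poly k x - hermite_poly (Suc k) x)) (at x)"
    by (rule derivative_eq_intros refl | simp del: hermite_poly.simps)+
  also have "(hermite_poly k x + 2 * real k * hermite_poly (k - 1) x * x - 2 * real (Suc k) * hermite_poly k x) * exp (- x\<^sup>2 / 2)
      + - x * exp (- x\<^sup>2 / 2) * (x * hermite_poly k x - hermite_poly (Suc k) x) = (x\<^sup>2 - (2 * real k + 1)) * (hermite_poly k x * exp (- x\<^sup>2 / 2))"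
    unfolding hermite_poly_Suc[of k] by (simp add: algebra_simps power2_eq_square)
  finally show ?thesis .
qed

text \<open>The derivative of \<open>dhermite c k\<close>, written out so that its Gaussian decay
  can be read off.\<close>

definition dhermite' :: "real \<Rightarrow> nat \<Rightarrow> real \<Rightarrow> real" where
  "dhermite' c k x = sqrt c * hermite_norm k * c * ((c * x * hermite_poly k (c * x) - hermite_poly (Suc k) (c * x)) * exp (- (c * x)\<^sup>2 / 2))"

lemma dhermite_deriv: "(dhermite c k has_real_derivative dhermite' c k x) (at x)"
proof -
  have "((\<lambda>x. hermite_poly k (c * x) * exp (- (c * x)\<^sup>2 / 2)) has_real_derivative
      ((c * x * hermite_poly k (c * x) - hermite_poly (Suc k) (c * x)) * exp (- (c * x)\<^sup>2 / 2)) * c) (at x)"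
    by (rule DERIV_chain2[OF has_real_derivative_hermite_gauss]) (auto intro!: derivative_eq_intros)
  from DERIV_cmult[OF this, of "sqrt c * hermite_norm k"] show ?thesis
    by (simp add: dhermite_def[abs_def] dhermite'_def hermite_fun1_eq mult_ac)
qed

lemma dhermite'_deriv: "(dhermite' c k has_real_derivative (c\<^sup>2 * (c\<^sup>2 * x\<^sup>2 - (2 * real k + 1))) * dhermite c k x) (at x)"
proof -
  have "((\<lambda>x. (c * x * hermite_poly k (c * x) - hermite_poly (Suc k) (c * x)) * exp (- (c * x)\<^sup>2 / 2)) has_real_derivative
      (((c * x)\<^sup>2 - (2 * real k + 1)) * (hermite_poly k (c * x) * exp (- (c * x)\<^sup>2 / 2))) * c) (at x)"
    by (rule DERIV_chain2[OF has_real_derivative_hermite_gauss2]) (auto intro!: derivative_eq_intros)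
  from DERIV_cmult[OF this, of "sqrt c * hermite_norm k * c"] show ?thesis
    by (simp add: dhermite_def[abs_def] dhermite'_def[abs_def] hermite_fun1_eq power_mult_distrib power2_eq_square mult_ac)
qed

lemma gauss_decay_dhermite': "c > 0 \<Longrightarrow> gauss_decay (dhermite' c k)"
proof -
  assume c: "c > 0"
  let ?E = "\<lambda>x::real. exp (- (1/2) * x\<^sup>2)"
  have "gauss_decay (\<lambda>x. x * (hermite_poly k x * ?E x) - hermite_poly (Suc k) x * ?E x)"
    by (intro gauss_decay_diff gauss_decay_times_id gauss_decay_hermite_poly) auto
  hence "gauss_decay (\<lambda>x. (x * hermite_poly k x - hermite_poly (Suc k) x) * exp (- x\<^sup>2 / 2))"
    by (simp add: algebra_simps del: hermite_poly.simps)
  from gauss_decay_scale[OF gauss_decay_dilate[OF this c]] show ?thesis unfolding dhermite'_def[abs_def] .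
qed

lemma hermite_fun1_times_id:
  "x * hermite_fun1 k x = sqrt (real (k + 1) / 2) * hermite_fun1 (k + 1) x + sqrt (real k / 2) * hermite_fun1 (k - 1) x"
proof -
  have 1: "sqrt (real (k + 1) / 2) * hermite_norm (k + 1) = hermite_norm k / 2"
  proof -
    have "sqrt (real (Suc k) / 2) / sqrt (2 * real (Suc k)) = sqrt ((real (Suc k) / 2) / (2 * real (Suc k)))"
      by (rule real_sqrt_divide[symmetric])
    also have "(real (Suc k) / 2) / (2 * real (Suc k)) = (1/2)\<^sup>2" by (simp add: power2_eq_square)
    finally have "sqrt (real (Suc k) / 2) / sqrt (2 * real (Suc k)) = 1 / 2" by simp
    thus ?thesis using hermite_norm_Suc[of k] by (simp add: field_simps)
  qed
  have 2: "sqrt (real k / 2) * hermite_norm (k - 1) = real k * hermite_norm k"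
  proof (cases k)
    case (Suc l)
    have "sqrt (real k / 2) * sqrt (2 * real k) = real k"
      unfolding real_sqrt_mult[symmetric] by (simp add: power2_eq_square[symmetric])
    moreover have "hermite_norm l = hermite_norm k * sqrt (2 * real k)"
      using hermite_norm_Suc[of l] Suc by simp
    ultimately show ?thesis using Suc by (simp add: mult.assoc mult.left_commute)
  qed simp
  have "sqrt (real (k + 1) / 2) * hermite_fun1 (k + 1) x + sqrt (real k / 2) * hermite_fun1 (k - 1) x
     = (hermite_norm k / 2) * (hermite_poly (Suc k) x * exp (- x\<^sup>2 / 2)) + real k * hermite_norm k * (hermite_poly (k - 1) x * exp (- x\<^sup>2 / 2))"
    unfolding hermite_fun1_eq mult.assoc[symmetric] 1 2 by simp
  also have "\<dots> = x * hermite_fun1 k x" unfolding hermite_poly_Suc hermite_fun1_eq by (simp add: field_simps)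
  finally show ?thesis by simp
qed

text \<open>Two applications of the three-term recurrence; only shifts by an even number survive.
  The square root in front of the truncated index \<open>k - 2\<close> vanishes for k = 0 and k =
  1.\<close>

lemma hermite_fun1_times_square:
  "2 * x\<^sup>2 * hermite_fun1 k x = sqrt (real (k + 1) * real (k + 2)) * hermite_fun1 (k + 2) x
     + (2 * real k + 1) * hermite_fun1 k x + sqrt (real k * real (k - 1)) * hermite_fun1 (k - 2) x"
proof -
  have "x\<^sup>2 * hermite_fun1 k x = sqrt (real (k + 1) / 2) * (x * hermite_fun1 (k + 1) x) + sqrt (real k / 2) * (x * hermite_fun1 (k - 1) x)"
    using arg_cong[OF hermite_fun1_times_id[of x k], of "(*) x"] by (simp add: power2_eq_square algebra_simps)
  also have "x * hermite_fun1 (k + 1) x = sqrt (real (k + 2) / 2) * hermite_fun1 (k + 2) x + sqrt (real (k + 1) / 2) * hermite_fun1 k x"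
    using hermite_fun1_times_id[of x "k + 1"] by simp
  also have "sqrt (real k / 2) * (x * hermite_fun1 (k - 1) x) =
      sqrt (real k / 2) * (sqrt (real k / 2) * hermite_fun1 k x + sqrt (real (k - 1) / 2) * hermite_fun1 (k - 2) x)"
    using hermite_fun1_times_id[of x "k - 1"] by (cases k) simp_all
  finally have "x\<^sup>2 * hermite_fun1 k x = (sqrt (real (k + 1) / 2) * sqrt (real (k + 2) / 2)) * hermite_fun1 (k + 2) x
      + (sqrt (real (k + 1) / 2) * sqrt (real (k + 1) / 2)) * hermite_fun1 k x
      + (sqrt (real k / 2) * sqrt (real k / 2)) * hermite_fun1 k x
      + (sqrt (real k / 2) * sqrt (real (k - 1) / 2)) * hermite_fun1 (k - 2) x"
    by (simp add: algebra_simps)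
  moreover have "sqrt (real (k + 1) / 2) * sqrt (real (k + 2) / 2) = sqrt (real (k + 1) * real (k + 2)) / 2"
    "sqrt (real k / 2) * sqrt (real (k - 1) / 2) = sqrt (real k * real (k - 1)) / 2"
    by (simp_all add: real_sqrt_mult real_sqrt_divide)
  moreover have "sqrt (real (k + 1) / 2) * sqrt (real (k + 1) / 2) = real (k + 1) / 2" "sqrt (real k / 2) * sqrt (real k / 2) = real k / 2"
    by simp_all
  ultimately have "x\<^sup>2 * hermite_fun1 k x = (sqrt (real (k + 1) * real (k + 2)) / 2) * hermite_fun1 (k + 2) x
      + (real (k + 1) / 2) * hermite_fun1 k x + (real k / 2) * hermite_fun1 k x
      + (sqrt (real k * real (k - 1)) / 2) * hermite_fun1 (k - 2) x"
    by (simp only:)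
  from arg_cong[OF this, of "(*) 2"] show ?thesis unfolding distrib_left by (simp add: algebra_simps)
qed

lemma dhermite_times_square:
  "2 * (c\<^sup>2 * x\<^sup>2) * dhermite c k x = sqrt (real (k + 1) * real (k + 2)) * dhermite c (k + 2) x
     + (2 * real k + 1) * dhermite c k x + sqrt (real k * real (k - 1)) * dhermite c (k - 2) x"
proof -
  have "2 * (c\<^sup>2 * x\<^sup>2) * dhermite c k x = sqrt c * (2 * (c * x)\<^sup>2 * hermite_fun1 k (c * x))"
    by (simp add: dhermite_def power_mult_distrib mult_ac)
  also have "\<dots> = sqrt (real (k + 1) * real (k + 2)) * dhermite c (k + 2) x
     + (2 * real k + 1) * dhermite c k x + sqrt (real k * real (k - 1)) * dhermite c (k - 2) x"
    unfolding hermite_fun1_times_square by (simp add: dhermite_def algebra_simps)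
  finally show ?thesis .
qed

definition dilation_coeff :: "real \<Rightarrow> real \<Rightarrow> nat \<Rightarrow> nat \<Rightarrow> real" where
  "dilation_coeff c d k l = (LINT x|lborel. dhermite c k x * dhermite d l x)"

text \<open>The integral of the derivative of a Wronskian vanishes, which expresses (2l+1) times the
  coefficient through (2k+1) times it and the integral of x^2 u v. Replacing x^2 u by neighbours of
  index k and k +- 2 gives a relation in k alone. Its point: multiplication by the eigenvalue in the
  basis of d becomes an operator of three terms in the basis of c.\<close>

lemma dilation_coeff_rec:
  assumes c: "c > 0" and d: "d > 0"
  defines "b \<equiv> (d^4 - c^4) / (2 * c\<^sup>2 * d\<^sup>2)"
  shows "(2 * real l + 1) * dilation_coeff c d k l = (c\<^sup>2 / d\<^sup>2 + b) * (2 * real k + 1) * dilation_coeff c d k l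
    + b * (sqrt (real (k + 1) * real (k + 2)) * dilation_coeff c d (k + 2) l + sqrt (real k * real (k - 1)) * dilation_coeff c d (k - 2) l)"
proof -
  let ?u = "dhermite c k" and ?v = "dhermite d l"
  let ?t = "dilation_coeff c d"
  have gd: "gauss_decay (\<lambda>x. dhermite c k x * ?v x)" for k
    by (intro gauss_decay_mult gauss_decay_dhermite c d)
  have i: "integrable lborel (\<lambda>x. dhermite c k x * ?v x)" for k by (rule gauss_decay_integrable[OF gd])
  \<comment> \<open>In the Wronskian the products of first derivatives cancel, and both second
    derivatives are eliminated by the eigenvalue equations.\<close>
  let ?W = "\<lambda>x. dhermite' c k x * ?v x - ?u x * dhermite' d l x"
  let ?W' = "\<lambda>x. (c^4 - d^4) * (x * (x * (?u x * ?v x))) + (d\<^sup>2 * (2 * real l + 1) - c\<^sup>2 * (2 * real k + 1)) * (?u x * ?v x)"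
  have "(?W has_real_derivative ?W' x) (at x)" for x
  proof -
    have "(?W has_real_derivative (((c\<^sup>2 * (c\<^sup>2 * x\<^sup>2 - (2 * real k + 1))) * ?u x) * ?v x + dhermite' d l x * dhermite' c k x)
        - (dhermite' c k x * dhermite' d l x + ((d\<^sup>2 * (d\<^sup>2 * x\<^sup>2 - (2 * real l + 1))) * ?v x) * ?u x)) (at x)"
      by (intro DERIV_diff DERIV_mult dhermite_deriv dhermite'_deriv)
    thus ?thesis by (simp add: algebra_simps power2_eq_square eval_nat_numeral)
  qed
  hence "(LINT x|lborel. ?W' x) = 0"
    by (rule gauss_decay_integral_deriv[rotated 2])
      (intro gauss_decay_diff gauss_decay_mult gauss_decay_dhermite gauss_decay_dhermite' gauss_decay_add gauss_decay_scale gauss_decay_times_id c d)+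
  moreover have i2: "integrable lborel (\<lambda>x. x * (x * (?u x * ?v x)))"
    by (intro gauss_decay_integrable gauss_decay_times_id gd)
  ultimately have 1: "(c^4 - d^4) * (LINT x|lborel. x * (x * (?u x * ?v x))) + (d\<^sup>2 * (2 * real l + 1) - c\<^sup>2 * (2 * real k + 1)) * ?t k l = 0"
    using i[of k] by (simp add: dilation_coeff_def)
  have "2 * c\<^sup>2 * (LINT x|lborel. x * (x * (?u x * ?v x))) = (LINT x|lborel. 2 * (c\<^sup>2 * x\<^sup>2) * ?u x * ?v x)"
    by (simp flip: integral_mult_right_zero add: power2_eq_square mult_ac)
  also have "\<dots> = (LINT x|lborel. sqrt (real (k + 1) * real (k + 2)) * (dhermite c (k + 2) x * ?v x)
     + (2 * real k + 1) * (dhermite c k x * ?v x) + sqrt (real k * real (k - 1)) * (dhermite c (k - 2) x * ?v x))"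
    unfolding dhermite_times_square by (simp add: algebra_simps)
  also have "\<dots> = sqrt (real (k + 1) * real (k + 2)) * ?t (k + 2) l + (2 * real k + 1) * ?t k l + sqrt (real k * real (k - 1)) * ?t (k - 2) l"
    unfolding dilation_coeff_def using i by (simp del: of_nat_add of_nat_Suc add: Bochner_Integration.integral_add)
  finally have 2: "(LINT x|lborel. x * (x * (?u x * ?v x))) = (sqrt (real (k + 1) * real (k + 2)) * ?t (k + 2) l
      + (2 * real k + 1) * ?t k l + sqrt (real k * real (k - 1)) * ?t (k - 2) l) / (2 * c\<^sup>2)"
    using c by (simp add: field_simps)
  define S where "S = sqrt (real (k + 1) * real (k + 2)) * ?t (k + 2) l + sqrt (real k * real (k - 1)) * ?t (k - 2) l"
  have "d\<^sup>2 * ((2 * real l + 1) * ?t k l) = d\<^sup>2 * ((c\<^sup>2 / d\<^sup>2 + b) * (2 * real k + 1) * ?t k l + b * S)"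
  proof -
    have "d\<^sup>2 * ((2 * real l + 1) * ?t k l) = c\<^sup>2 * (2 * real k + 1) * ?t k l + (d^4 - c^4) * (LINT x|lborel. x * (x * (?u x * ?v x)))"
      using 1 by (simp add: algebra_simps del: of_nat_add of_nat_Suc)
    also have "(LINT x|lborel. x * (x * (?u x * ?v x))) = ((2 * real k + 1) * ?t k l + S) / (2 * c\<^sup>2)"
      unfolding 2 S_def by (simp add: algebra_simps del: of_nat_add of_nat_Suc)
    finally have "d\<^sup>2 * ((2 * real l + 1) * ?t k l) = c\<^sup>2 * (2 * real k + 1) * ?t k l + (d^4 - c^4) / (2 * c\<^sup>2) * ((2 * real k + 1) * ?t k l + S)"
      by simp
    moreover have "d\<^sup>2 * b = (d^4 - c^4) / (2 * c\<^sup>2)" unfolding b_def using d by simp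
    hence "d\<^sup>2 * ((c\<^sup>2 / d\<^sup>2 + b) * (2 * real k + 1) * ?t k l + b * S) = c\<^sup>2 * (2 * real k + 1) * ?t k l + (d^4 - c^4) / (2 * c\<^sup>2) * ((2 * real k + 1) * ?t k l + S)"
      using d by (simp add: distrib_left distrib_right mult.assoc[symmetric])
    ultimately show ?thesis by simp
  qed
  thus ?thesis using d unfolding S_def by (simp del: of_nat_add of_nat_Suc)
qed


subsection \<open>Dilated Hermite functions and the Bargmann kernel\<close>

text \<open>Distributive law for series: a product of absolutely convergent series, one for each
  coordinate, is a series over multi-indices. It lifts the one-dimensional generating function to n
  dimensions.\<close>

lemma
  fixes f :: "'n::finite \<Rightarrow> nat \<Rightarrow> 'b::{real_normed_field, banach, second_countable_topology}"
  assumes abs: "\<And>j. (\<lambda>k. norm (f j k)) summable_on UNIV" and sum: "\<And>j. (f j has_sum s j) UNIV"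
  shows abs_summable_prod_fun: "(\<lambda>\<alpha>. norm (\<Prod>j\<in>UNIV. f j (\<alpha> j))) summable_on UNIV"
    and has_sum_prod_fun: "((\<lambda>\<alpha>. \<Prod>j\<in>UNIV. f j (\<alpha> j)) has_sum (\<Prod>j\<in>UNIV. s j)) UNIV"
proof -
  have P: "Pi\<^sub>E UNIV (\<lambda>_. UNIV) = (UNIV :: ('n \<Rightarrow> nat) set)" by (simp add: PiE_UNIV_domain)
  have "Infinite_Set_Sum.abs_summable_on (\<lambda>\<alpha>. \<Prod>j\<in>UNIV. f j (\<alpha> j)) (Pi\<^sub>E UNIV (\<lambda>_. UNIV))"
    by (rule abs_summable_on_prod_PiE) (use abs in \<open>simp_all add: abs_summable_equivalent[symmetric]\<close>)
  thus a: "(\<lambda>\<alpha>. norm (\<Prod>j\<in>UNIV. f j (\<alpha> j))) summable_on UNIV"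
    unfolding P by (simp add: abs_summable_equivalent[symmetric])
  have "infsum (\<lambda>\<alpha>. \<Prod>j\<in>UNIV. f j (\<alpha> j)) (Pi\<^sub>E UNIV (\<lambda>_. UNIV)) = (\<Prod>j\<in>UNIV. infsum (f j) UNIV)"
    by (rule infsum_prod_PiE_abs) (use abs in auto)
  hence "infsum (\<lambda>\<alpha>. \<Prod>j\<in>UNIV. f j (\<alpha> j)) UNIV = (\<Prod>j\<in>UNIV. s j)"
    unfolding P by (simp add: infsumI[OF sum])
  thus "((\<lambda>\<alpha>. \<Prod>j\<in>UNIV. f j (\<alpha> j)) has_sum (\<Prod>j\<in>UNIV. s j)) UNIV"
    using has_sum_infsum[OF abs_summable_summable[OF a]] by simp
qed

definition hermite_dil :: "real \<Rightarrow> ('n::finite \<Rightarrow> nat) \<Rightarrow> real ^ 'n \<Rightarrow> complex" where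
  "hermite_dil c \<alpha> x = complex_of_real (\<Prod>j\<in>UNIV. dhermite c (\<alpha> j) (x $ j))"

abbreviation hermite_coeff :: "real \<Rightarrow> (real ^ 'n \<Rightarrow> complex) \<Rightarrow> ('n::finite \<Rightarrow> nat) \<Rightarrow> complex" where
  "hermite_coeff c f \<alpha> \<equiv> l2_inner lborel f (hermite_dil c \<alpha>)"

lemma hermite_dil_one: "hermite_dil 1 \<alpha> x = complex_of_real (hermite_fun \<alpha> x)"
  by (simp add: hermite_dil_def hermite_fun_def dhermite_def)

lemma cnj_hermite_dil [simp]: "cnj (hermite_dil c \<alpha> x) = hermite_dil c \<alpha> x"
  by (simp add: hermite_dil_def)

lemma
  fixes \<alpha> \<beta> :: "'n::finite \<Rightarrow> nat"
  assumes c: "c > 0" and d: "d > 0"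
  shows integrable_hermite_dil_mult: "integrable lborel (\<lambda>x. hermite_dil c \<alpha> x * hermite_dil d \<beta> x)"
    and integral_hermite_dil_mult: "(LINT x|lborel. hermite_dil c \<alpha> x * hermite_dil d \<beta> x)
      = complex_of_real (\<Prod>j\<in>UNIV. dilation_coeff c d (\<alpha> j) (\<beta> j))"
proof -
  have eq: "hermite_dil c \<alpha> x * hermite_dil d \<beta> x
      = complex_of_real (\<Prod>j\<in>UNIV. dhermite c (\<alpha> j) (x $ j) * dhermite d (\<beta> j) (x $ j))" for x
    by (simp add: hermite_dil_def prod.distrib)
  have i: "integrable lborel (\<lambda>x. dhermite c (\<alpha> j) x * dhermite d (\<beta> j) x)" for j
    by (intro gauss_decay_integrable gauss_decay_mult gauss_decay_dhermite c d)
  show "integrable lborel (\<lambda>x. hermite_dil c \<alpha> x * hermite_dil d \<beta> x)"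
    unfolding eq by (intro integrable_of_real integrable_prod_vec i)
  show "(LINT x|lborel. hermite_dil c \<alpha> x * hermite_dil d \<beta> x)
      = complex_of_real (\<Prod>j\<in>UNIV. dilation_coeff c d (\<alpha> j) (\<beta> j))"
    unfolding eq integral_complex_of_real by (subst integral_prod_vec[OF i]) (simp add: dilation_coeff_def)
qed

lemma measurable_hermite_dil [measurable]: "c > 0 \<Longrightarrow> hermite_dil c \<alpha> \<in> borel_measurable borel"
proof -
  assume "c > 0"
  hence [measurable]: "dhermite c k \<in> borel_measurable borel" for k
    using gauss_decay_dhermite[of c k] by (auto simp: gauss_decay_def intro: borel_measurable_continuous_onI)
  show ?thesis unfolding hermite_dil_def[abs_def] by measurable
qed

lemma orthonormal_family_hermite_dil:
  assumes c: "c > 0"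
  shows "orthonormal_family lborel (hermite_dil c :: ('n::finite \<Rightarrow> nat) \<Rightarrow> _)"
proof
  fix \<alpha> \<beta> :: "'n \<Rightarrow> nat"
  show "hermite_dil c \<alpha> \<in> l2 lborel"
  proof (rule l2I)
    show "hermite_dil c \<alpha> \<in> borel_measurable lborel" using measurable_hermite_dil[OF c] by simp
    have "(norm (hermite_dil c \<alpha> x))\<^sup>2 = Re (hermite_dil c \<alpha> x * hermite_dil c \<alpha> x)" for x
      unfolding hermite_dil_def norm_of_real of_real_mult[symmetric] Re_complex_of_real by (simp add: power2_eq_square)
    thus "integrable lborel (\<lambda>x. (norm (hermite_dil c \<alpha> x))\<^sup>2)"
      using integrable_Re[OF integrable_hermite_dil_mult[OF c c, of \<alpha> \<alpha>]] by simp
  qed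
  have "(\<Prod>j\<in>UNIV. dilation_coeff c c (\<alpha> j) (\<beta> j)) = (if \<alpha> = \<beta> then 1 else 0)"
  proof (cases "\<alpha> = \<beta>")
    case False
    then obtain j where "\<alpha> j \<noteq> \<beta> j" by auto
    thus ?thesis using False c by (auto simp: dilation_coeff_def dhermite_orthonormal intro!: prod_zero)
  qed (simp add: dilation_coeff_def dhermite_orthonormal[OF c])
  thus "l2_inner lborel (hermite_dil c \<alpha>) (hermite_dil c \<beta>) = (if \<alpha> = \<beta> then 1 else 0)"
    by (simp add: l2_inner_def integral_hermite_dil_mult[OF c c])
qed

section \<open>Fock monomials and the Bargmann kernel\<close>

definition fock_ibasis :: "('n::finite \<Rightarrow> nat) \<Rightarrow> complex ^ 'n \<Rightarrow> complex" where
  "fock_ibasis \<alpha> z = fock_basis \<alpha> (\<i> *s z)"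

text \<open>Replacing z by i z turns the real exponential of the generating function into an
  oscillating one. On coefficients it is only a phase of modulus one, so it leaves every weighted
  norm unchanged.\<close>

lemma fock_ibasis_eq: "fock_ibasis \<alpha> z = \<i> ^ multi_deg \<alpha> * fock_basis \<alpha> z"
  by (simp add: fock_ibasis_def fock_basis_def multi_deg_def power_mult_distrib prod.distrib power_sum)

lemma sqrt_prod: "sqrt (prod f A) = (\<Prod>x\<in>A. sqrt (f x))"
  by (induction A rule: infinite_finite_induct) (simp_all add: real_sqrt_mult)

lemma fock_basis_prod: "fock_basis \<alpha> z = (\<Prod>j\<in>UNIV. (z $ j) ^ \<alpha> j / complex_of_real (sqrt (fact (\<alpha> j))))"
  by (simp add: fock_basis_def prod_dividef sqrt_prod)

lemma norm_fock_ibasis: "norm (fock_ibasis \<alpha> z) = norm (fock_basis \<alpha> z)"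
  by (simp add: fock_ibasis_eq norm_mult norm_power)

lemma norm_fock_basis_sq: "(norm (fock_basis \<alpha> z))\<^sup>2 = (\<Prod>j\<in>UNIV. ((norm (z $ j))\<^sup>2) ^ \<alpha> j / fact (\<alpha> j))"
  by (simp add: fock_basis_prod prod_norm[symmetric] norm_divide norm_power power_divide prod_power_distrib flip: power_mult)
     (simp add: mult.commute)

lemma hermite_eigenvalue_ge_1: "hermite_eigenvalue (\<alpha> :: 'n::finite \<Rightarrow> nat) \<ge> 1"
proof -
  have "CARD('n) > 0" by simp
  hence "real CARD('n) \<ge> 1" by linarith
  thus ?thesis by (simp add: hermite_eigenvalue_def add_increasing)
qed

lemma powr_le_fact_mult_exp:
  assumes "x \<ge> (1::real)" "s \<le> real N"
  shows "x powr s \<le> fact N * exp x"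
proof -
  have "x powr s \<le> x powr real N" using assms by (intro powr_mono) auto
  also have "\<dots> = x ^ N" using assms by (simp add: powr_realpow)
  also have "\<dots> = fact N * (x ^ N /\<^sub>R fact N)" by simp
  also have "x ^ N /\<^sub>R fact N \<le> (\<Sum>n. x ^ n /\<^sub>R fact n)"
    using sum_le_suminf[OF sums_summable[OF exp_converges[of x]], of "{N}"] assms by simp
  also have "(\<Sum>n. x ^ n /\<^sub>R fact n) = exp x" by (simp add: exp_def)
  finally show ?thesis by (simp add: mult_left_mono)
qed

text \<open>A power of the eigenvalue is dominated by its exponential, which factors over the
  coordinates as e^n times the product of the numbers (e^2)^(\<alpha> j). What is left is a product
  of exponential series. Consequently the Bargmann kernel has finite Sobolev norm of every
  order.\<close>

lemma fock_basis_weighted_summable: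
  fixes z :: "complex ^ 'n"
  shows "(\<lambda>\<alpha>. hermite_eigenvalue \<alpha> powr s * (norm (fock_basis \<alpha> z))\<^sup>2) summable_on UNIV"
proof -
  obtain N :: nat where N: "s \<le> real N" using real_arch_simple by blast
  let ?f = "\<lambda>j k. (exp 2 * (norm (z $ j))\<^sup>2) ^ k / fact k"
  have ab: "(\<lambda>k. norm (x ^ k / fact k)) summable_on UNIV" for x :: real
    using summable_norm_exp[of x] norm_summable_imp_summable_on[of "\<lambda>k. norm (x ^ k / fact k)"]
    by (simp add: divide_inverse mult.commute)
  have "(\<lambda>\<alpha>. norm (\<Prod>j\<in>UNIV. ?f j (\<alpha> j))) summable_on UNIV"
    by (rule abs_summable_prod_fun[OF ab]) (rule has_sum_infsum[OF abs_summable_summable[OF ab]])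
  hence "(\<lambda>\<alpha>. (fact N * exp (real CARD('n))) * (\<Prod>j\<in>UNIV. ?f j (\<alpha> j))) summable_on UNIV"
    by (intro summable_on_cmult_right) (simp add: abs_prod abs_mult)
  thus ?thesis
  proof (rule summable_on_comparison_test)
    fix \<alpha> :: "'n \<Rightarrow> nat"
    have "exp (hermite_eigenvalue \<alpha>) = exp (real CARD('n)) * (\<Prod>j\<in>UNIV. exp 2 ^ \<alpha> j)"
      by (simp add: hermite_eigenvalue_def multi_deg_def exp_add exp_of_nat_mult[symmetric] sum_distrib_left exp_sum mult.commute)
    hence eq: "(fact N * exp (real CARD('n))) * (\<Prod>j\<in>UNIV. ?f j (\<alpha> j)) = (fact N * exp (hermite_eigenvalue \<alpha>)) * (norm (fock_basis \<alpha> z))\<^sup>2"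
      unfolding norm_fock_basis_sq by (simp add: power_mult_distrib prod.distrib prod_dividef)
    have "hermite_eigenvalue \<alpha> powr s \<le> fact N * exp (hermite_eigenvalue \<alpha>)"
      by (rule powr_le_fact_mult_exp[OF hermite_eigenvalue_ge_1 N])
    thus "hermite_eigenvalue \<alpha> powr s * (norm (fock_basis \<alpha> z))\<^sup>2 \<le> (fact N * exp (real CARD('n))) * (\<Prod>j\<in>UNIV. ?f j (\<alpha> j))"
      unfolding eq by (rule mult_right_mono) simp
  qed auto
qed

lemma fock_basis_summable: "(\<lambda>\<alpha>. (norm (fock_basis \<alpha> z))\<^sup>2) summable_on UNIV"
proof -
  have "hermite_eigenvalue \<alpha> powr 0 = 1" for \<alpha> :: "'a \<Rightarrow> nat"
    using hermite_eigenvalue_ge_1[of \<alpha>] by simp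
  thus ?thesis using fock_basis_weighted_summable[of 0 z] by simp
qed

lemma fock_ibasis_summable: "(\<lambda>\<alpha>. (norm (fock_ibasis \<alpha> z))\<^sup>2) summable_on UNIV"
  unfolding norm_fock_ibasis by (rule fock_basis_summable)

text \<open>For c = sqrt 2 this is the function K_z of the overview. A general c is kept because
  completeness is needed for both families, c = 1 and c = sqrt 2; the product form is the one
  delivered by \<open>has_sum_prod_fun\<close>.\<close>

definition bargmann_kernel :: "real \<Rightarrow> complex ^ 'n \<Rightarrow> real ^ 'n \<Rightarrow> complex" where
  "bargmann_kernel c z x = (\<Prod>j\<in>UNIV. complex_of_real (sqrt c * hermite_norm 0) *
     exp (- (complex_of_real (c * x $ j))\<^sup>2 / 2 + complex_of_real (sqrt 2) * complex_of_real (c * x $ j) * (\<i> * z $ j) - (\<i> * z $ j)\<^sup>2 / 2))"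

abbreviation bargmann :: "real \<Rightarrow> (real ^ 'n \<Rightarrow> complex) \<Rightarrow> complex ^ 'n \<Rightarrow> complex" where
  "bargmann c f z \<equiv> LINT x|lborel. f x * bargmann_kernel c z x"

lemma bargmann_kernel_has_sum:
  "((\<lambda>\<alpha>. fock_ibasis \<alpha> z * hermite_dil c \<alpha> x) has_sum bargmann_kernel c z x) UNIV"
proof -
  let ?f = "\<lambda>j k. (\<i> * z $ j) ^ k / complex_of_real (sqrt (fact k)) * complex_of_real (dhermite c k (x $ j))"
  have eq: "fock_ibasis \<alpha> z * hermite_dil c \<alpha> x = (\<Prod>j\<in>UNIV. ?f j (\<alpha> j))" for \<alpha>
    by (simp add: fock_ibasis_def fock_basis_prod hermite_dil_def prod.distrib prod_dividef)
  have f: "?f j k = complex_of_real (sqrt c) * ((\<i> * z $ j) ^ k / complex_of_real (sqrt (fact k)) * complex_of_real (hermite_fun1 k (c * x $ j)))" for j k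
    by (simp add: dhermite_def)
  show ?thesis unfolding eq bargmann_kernel_def
  proof (rule has_sum_prod_fun)
    fix j
    show "(\<lambda>k. norm (?f j k)) summable_on UNIV"
      unfolding f norm_mult[of "complex_of_real (sqrt c)"] by (intro summable_on_cmult_right hermite_gen1(1))
    show "(?f j has_sum complex_of_real (sqrt c * hermite_norm 0) *
     exp (- (complex_of_real (c * x $ j))\<^sup>2 / 2 + complex_of_real (sqrt 2) * complex_of_real (c * x $ j) * (\<i> * z $ j) - (\<i> * z $ j)\<^sup>2 / 2)) UNIV"
      unfolding f of_real_mult[of "sqrt c"] mult.assoc[of "complex_of_real (sqrt c)"] by (intro has_sum_cmult_right hermite_gen1(2))
  qed
qed

lemma bargmann_kernel_expansion:
  assumes c: "c > 0"
  shows "orthonormal_family.l2_expansion lborel (hermite_dil c) (\<lambda>\<alpha>. fock_ibasis \<alpha> z) (bargmann_kernel c z)"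
  by (rule orthonormal_family.l2_expansion_of_pointwise[OF orthonormal_family_hermite_dil[OF c] fock_ibasis_summable bargmann_kernel_has_sum])

lemma bargmann_kernel_l2: "c > 0 \<Longrightarrow> bargmann_kernel c z \<in> l2 lborel"
  by (rule orthonormal_family.l2_expansion_l2[OF orthonormal_family_hermite_dil bargmann_kernel_expansion])

text \<open>Pairing the expansion of the kernel in x with the conjugate of f shows that the Hermite
  coefficients of f are the Fock coefficients of its transform, for every z and not just almost
  everywhere.\<close>

lemma bargmann_transform_has_sum:
  assumes c: "c > 0" and f: "f \<in> l2 lborel"
  shows "((\<lambda>\<alpha>. hermite_coeff c f \<alpha> * fock_ibasis \<alpha> z) has_sum bargmann c f z) UNIV"
proof -
  have "((\<lambda>\<alpha>. fock_ibasis \<alpha> z * l2_inner lborel (hermite_dil c \<alpha>) (\<lambda>x. cnj (f x))) has_sum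
      l2_inner lborel (bargmann_kernel c z) (\<lambda>x. cnj (f x))) UNIV"
    by (rule orthonormal_family.l2_expansion_inner[OF orthonormal_family_hermite_dil[OF c] bargmann_kernel_expansion[OF c] l2_cnj[OF f]])
  thus ?thesis by (simp add: l2_inner_def mult.commute)
qed


subsection \<open>Uniqueness for the Fourier transform\<close>

lemma integral_lborel_affine:
  fixes f :: "'a::euclidean_space \<Rightarrow> 'b::{banach, second_countable_topology}"
  assumes c: "c \<noteq> 0" and f: "f \<in> borel_measurable borel"
  shows "(LINT x|lborel. f x) = \<bar>c\<bar> ^ DIM('a) *\<^sub>R (LINT x|lborel. f (t + c *\<^sub>R x))"
proof -
  have "(LINT x|lborel. f x) = integral\<^sup>L (density (distr lborel borel (\<lambda>x. t + c *\<^sub>R x)) (\<lambda>_. \<bar>c\<bar> ^ DIM('a))) f"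
    by (subst lborel_affine[OF c, of t]) simp
  also have "\<dots> = (LINT x|distr lborel borel (\<lambda>x. t + c *\<^sub>R x). (\<bar>c\<bar> ^ DIM('a)) *\<^sub>R f x)"
    using f by (subst integral_density) auto
  also have "\<dots> = (LINT x|lborel. (\<bar>c\<bar> ^ DIM('a)) *\<^sub>R f (t + c *\<^sub>R x))"
    using f by (subst integral_distr) auto
  finally show ?thesis by simp
qed

definition gauss_density :: "real ^ 'n \<Rightarrow> real" where
  "gauss_density \<xi> = (\<Prod>j\<in>UNIV. std_normal_density (\<xi> $ j))"

lemma gauss_density_measurable [measurable]: "gauss_density \<in> borel_measurable borel"
  unfolding gauss_density_def[abs_def] by measurable

lemma gauss_density_nonneg: "gauss_density \<xi> \<ge> 0"
  unfolding gauss_density_def by (intro prod_nonneg) auto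

lemma integrable_std_normal_density: "integrable lborel std_normal_density"
  by (rule integrable_normal_density) simp

lemma integrable_gauss_density: "integrable lborel gauss_density"
  unfolding gauss_density_def[abs_def] by (intro integrable_prod_vec integrable_std_normal_density)

lemma integral_gauss_density: "(LINT \<xi>|lborel. gauss_density \<xi>) = 1"
  unfolding gauss_density_def by (subst integral_prod_vec[OF integrable_std_normal_density]) simp

text \<open>Fourier inversion for the Gaussian alone, read off from the characteristic function of
  the standard normal law. It is the only inversion formula that the uniqueness proof uses.\<close>

lemma gauss_density_Fourier:
  fixes y :: "real ^ 'n"
  shows "complex_of_real (gauss_density y) = complex_of_real ((1 / sqrt (2 * pi)) ^ CARD('n)) *
     (LINT \<xi>|lborel. exp (\<i> * complex_of_real (\<xi> \<bullet> y)) * complex_of_real (gauss_density \<xi>))"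
proof -
  let ?f = "\<lambda>j \<xi>. exp (\<i> * complex_of_real (\<xi> * y $ j)) * complex_of_real (std_normal_density \<xi>)"
  have i: "integrable lborel (?f j)" for j
    by (rule Bochner_Integration.integrable_bound[OF integrable_std_normal_density])
       (auto simp: norm_mult)
  have v: "(LINT \<xi>|lborel. ?f j \<xi>) = complex_of_real (exp (- (y $ j)\<^sup>2 / 2))" for j
  proof -
    have "char std_normal_distribution (y $ j) = (LINT \<xi>|lborel. std_normal_density \<xi> *\<^sub>R iexp (y $ j * \<xi>))"
      unfolding char_def by (rule integral_density) auto
    thus ?thesis by (simp add: char_std_normal_distribution scaleR_conv_of_real mult.commute)
  qed
  have eq: "exp (\<i> * complex_of_real (\<xi> \<bullet> y)) * complex_of_real (gauss_density \<xi>) = (\<Prod>j\<in>UNIV. ?f j (\<xi> $ j))" for \<xi>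
    by (simp add: inner_vec_def gauss_density_def prod.distrib exp_sum sum_distrib_left)
  hence "(LINT \<xi>|lborel. exp (\<i> * complex_of_real (\<xi> \<bullet> y)) * complex_of_real (gauss_density \<xi>)) =
      (\<Prod>j\<in>UNIV. complex_of_real (exp (- (y $ j)\<^sup>2 / 2)))"
    by (simp only: eq integral_prod_vec[OF i] v)
  moreover have "gauss_density y = (1 / sqrt (2 * pi)) ^ CARD('n) * (\<Prod>j\<in>UNIV. exp (- (y $ j)\<^sup>2 / 2))"
    unfolding gauss_density_def normal_density_def by (simp add: prod.distrib prod_dividef power_divide)
  ultimately show ?thesis by simp
qed

text \<open>The positive and negative parts of g are densities of two measures that agree on boxes,
  an intersection-stable generator, hence everywhere. Both parts are then equal almost everywhere,
  which forces them to vanish.\<close>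

lemma AE_eq_0_of_box_integrals_real:
  fixes g :: "'a::euclidean_space \<Rightarrow> real"
  assumes g: "integrable lborel g" and z: "\<And>l u. (LINT x|lborel. indicator (box l u) x * g x) = 0"
  shows "AE x in lborel. g x = 0"
proof -
  have [measurable]: "g \<in> borel_measurable borel" using g by auto
  have ip: "integrable lborel (\<lambda>x. indicator A x * max 0 (g x))" "integrable lborel (\<lambda>x. indicator A x * max 0 (- g x))"
    if "A \<in> sets borel" for A
    using integrable_real_mult_indicator[of A lborel "\<lambda>x. max 0 (g x)"]
      integrable_real_mult_indicator[of A lborel "\<lambda>x. max 0 (- g x)"] that g by (auto simp: mult.commute)
  let ?P = "density lborel (\<lambda>x. ennreal (max 0 (g x)))" and ?N = "density lborel (\<lambda>x. ennreal (max 0 (- g x)))"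
  have em: "emeasure (density lborel (\<lambda>x. ennreal (h x))) A = ennreal (LINT x|lborel. indicator A x * h x)"
    if "A \<in> sets borel" "integrable lborel (\<lambda>x. indicator A x * h x)" "\<And>x. h x \<ge> 0" "h \<in> borel_measurable borel" for A and h :: "'a \<Rightarrow> real"
  proof -
    have "emeasure (density lborel (\<lambda>x. ennreal (h x))) A = (\<integral>\<^sup>+x. ennreal (indicator A x * h x) \<partial>lborel)"
      using that by (subst emeasure_density) (auto simp: indicator_def intro!: nn_integral_cong)
    also have "\<dots> = ennreal (LINT x|lborel. indicator A x * h x)"
      using that by (intro nn_integral_eq_integral) auto
    finally show ?thesis .
  qed
  let ?E = "range (\<lambda>(a, b). box a b::'a set)"
  have "?P = ?N"
  proof (rule measure_eqI_generator_eq)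
    show "Int_stable ?E" by (auto simp: Int_stable_def box_Int_box)
    show "?E \<subseteq> Pow UNIV" "sets ?P = sigma_sets UNIV ?E" "sets ?N = sigma_sets UNIV ?E"
      by (simp_all add: borel_eq_box)
    let ?A = "\<lambda>n::nat. box (- (real n *\<^sub>R One)) (real n *\<^sub>R One) :: 'a set"
    show "range ?A \<subseteq> ?E" "(\<Union>i. ?A i) = UNIV"
      unfolding UN_box_eq_UNIV by auto
    show "emeasure ?P (?A i) \<noteq> \<infinity>" for i by (subst em) (auto intro!: ip)
    fix X assume "X \<in> ?E"
    then obtain l u where X: "X = box l u" by auto
    have "(LINT x|lborel. indicator X x * max 0 (g x)) - (LINT x|lborel. indicator X x * max 0 (- g x)) = (LINT x|lborel. indicator X x * g x)"
    proof -
      have "(LINT x|lborel. indicator X x * max 0 (g x)) - (LINT x|lborel. indicator X x * max 0 (- g x))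
        = (LINT x|lborel. indicator X x * max 0 (g x) - indicator X x * max 0 (- g x))"
        by (rule Bochner_Integration.integral_diff[symmetric]) (auto simp: X intro!: ip)
      thus ?thesis by (simp add: right_diff_distrib[symmetric] max_def cong: if_cong) (smt (verit) Bochner_Integration.integral_cong)
    qed
    thus "emeasure ?P X = emeasure ?N X" using z[of l u] by (subst (1 2) em) (auto simp: X intro!: ip)
  qed
  hence "AE x in lborel. ennreal (max 0 (g x)) = ennreal (max 0 (- g x))"
    by (intro sigma_finite_measure.density_unique[OF sigma_finite_lborel]) auto
  thus ?thesis by eventually_elim (auto simp: max_def split: if_splits)
qed

lemma AE_eq_0_of_box_integrals:
  fixes g :: "'a::euclidean_space \<Rightarrow> complex"
  assumes g: "integrable lborel g" and z: "\<And>l u. (LINT x|lborel. indicator (box l u) x * g x) = 0"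
  shows "AE x in lborel. g x = 0"
proof -
  have i: "integrable lborel (\<lambda>x. indicator (box l u) x * g x)" for l u
  proof -
    have "indicator (box l u) x * g x = indicator (box l u) x *\<^sub>R g x" for x by (simp add: indicator_def)
    thus ?thesis using integrable_mult_indicator[of "box l u" lborel g] g by simp
  qed
  have ri: "Re (indicator (box l u) x * g x) = indicator (box l u) x * Re (g x)"
    "Im (indicator (box l u) x * g x) = indicator (box l u) x * Im (g x)" for l u x by (simp_all add: indicator_def)
  have "(LINT x|lborel. indicator (box l u) x * Re (g x)) = 0" for l u
    using integral_Re[OF i[of l u]] z[of l u] unfolding ri by simp
  moreover have "(LINT x|lborel. indicator (box l u) x * Im (g x)) = 0" for l u
    using integral_Im[OF i[of l u]] z[of l u] unfolding ri by simp
  ultimately have "AE x in lborel. Re (g x) = 0" "AE x in lborel. Im (g x) = 0"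
    using g by (auto intro!: AE_eq_0_of_box_integrals_real)
  thus ?thesis by eventually_elim (simp add: complex_eq_iff)
qed

text \<open>Writing the Gaussian as a Fourier integral and exchanging the integrals leaves the
  transform of G at the frequencies -b \<xi>.\<close>

lemma integral_gauss_convolution_eq_0:
  fixes G :: "real ^ 'n \<Rightarrow> complex"
  assumes G: "integrable lborel G"
    and F: "\<And>y. (LINT x|lborel. G x * exp (\<i> * complex_of_real (y \<bullet> x))) = 0"
  shows "(LINT x|lborel. G x * complex_of_real (gauss_density (b *\<^sub>R (a - x)))) = 0"
proof -
  have [measurable]: "G \<in> borel_measurable borel" using G by auto
  define H where "H x \<xi> = G x * (exp (\<i> * complex_of_real (\<xi> \<bullet> (b *\<^sub>R (a - x)))) * complex_of_real (gauss_density \<xi>))" for x \<xi> :: "real ^ 'n"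
  have Hm [measurable]: "(\<lambda>(x, \<xi>). H x \<xi>) \<in> borel_measurable (borel \<Otimes>\<^sub>M borel)"
    unfolding H_def by measurable
  have nH: "norm (H x \<xi>) = norm (G x) * gauss_density \<xi>" for x \<xi>
    by (simp add: H_def norm_mult gauss_density_nonneg)
  have iH: "integrable (lborel \<Otimes>\<^sub>M lborel) (\<lambda>(x, \<xi>). H x \<xi>)"
  proof (rule lborel_pair.Fubini_integrable)
    show "integrable lborel (\<lambda>x. LINT \<xi>|lborel. norm (case (x, \<xi>) of (x, \<xi>) \<Rightarrow> H x \<xi>))"
      using G by (simp add: nH integral_gauss_density)
    have "integrable lborel (\<lambda>\<xi>. H x \<xi>)" for x
      by (rule Bochner_Integration.integrable_bound[OF integrable_mult_right[OF integrable_gauss_density, of "norm (G x)"]])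
         (auto simp: nH gauss_density_nonneg)
    thus "AE x in lborel. integrable lborel (\<lambda>\<xi>. case (x, \<xi>) of (x, \<xi>) \<Rightarrow> H x \<xi>)" by simp
  qed simp
  let ?k = "complex_of_real ((1 / sqrt (2 * pi)) ^ CARD('n))"
  have "G x * complex_of_real (gauss_density (b *\<^sub>R (a - x))) = ?k * (LINT \<xi>|lborel. H x \<xi>)" for x
    unfolding H_def integral_mult_right_zero gauss_density_Fourier[of "b *\<^sub>R (a - x)"] by (simp only: mult_ac)
  hence "(LINT x|lborel. G x * complex_of_real (gauss_density (b *\<^sub>R (a - x)))) = (LINT x|lborel. ?k * (LINT \<xi>|lborel. H x \<xi>))"
    by simp
  also have "\<dots> = ?k * (LINT x|lborel. LINT \<xi>|lborel. H x \<xi>)" by simp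
  also have "(LINT x|lborel. LINT \<xi>|lborel. H x \<xi>) = (LINT \<xi>|lborel. LINT x|lborel. H x \<xi>)"
    by (rule lborel_pair.Fubini_integral[symmetric]) (use iH in simp)
  also have "\<dots> = (LINT \<xi>::real^'n|lborel. 0)"
  proof (rule Bochner_Integration.integral_cong)
    fix \<xi> :: "real ^ 'n"
    have "H x \<xi> = (exp (\<i> * complex_of_real (b * (\<xi> \<bullet> a))) * complex_of_real (gauss_density \<xi>)) * (G x * exp (\<i> * complex_of_real ((- b *\<^sub>R \<xi>) \<bullet> x)))" for x
    proof -
      have "\<xi> \<bullet> (b *\<^sub>R (a - x)) = b * (\<xi> \<bullet> a) + (- b *\<^sub>R \<xi>) \<bullet> x" by (simp add: inner_diff_right algebra_simps)
      thus ?thesis unfolding H_def by (simp only: of_real_add distrib_left exp_add mult_ac)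
    qed
    thus "(LINT x|lborel. H x \<xi>) = 0" using F[of "- b *\<^sub>R \<xi>"] by simp
  qed simp
  finally show ?thesis by simp
qed

text \<open>Off the boundary the indicator is locally constant, so the integrand is eventually
  constant for each \<xi> and the Gaussian dominates.\<close>

lemma gauss_smoothing_box_tendsto:
  fixes x :: "real ^ 'n"
  assumes x: "x \<notin> cbox l u - box l u" and \<epsilon>: "\<epsilon> \<longlonglongrightarrow> 0"
  shows "(\<lambda>k. LINT \<xi>|lborel. indicator (box l u) (x + \<epsilon> k *\<^sub>R \<xi>) * gauss_density \<xi>) \<longlonglongrightarrow> indicator (box l u) x"
proof -
  have "(\<lambda>k. LINT \<xi>|lborel. indicator (box l u) (x + \<epsilon> k *\<^sub>R \<xi>) * gauss_density \<xi>) \<longlonglongrightarrow> (LINT \<xi>::real^'n|lborel. indicator (box l u) x * gauss_density \<xi>)"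
  proof (rule integral_dominated_convergence[where w="gauss_density :: real ^ 'n \<Rightarrow> real"])
    have "(\<lambda>k. indicator (box l u) (x + \<epsilon> k *\<^sub>R \<xi>) * gauss_density \<xi>) \<longlonglongrightarrow> indicator (box l u) x * gauss_density \<xi>" for \<xi>
    proof (rule tendsto_mult_right, rule tendsto_eventually)
      have lim: "(\<lambda>k. x + \<epsilon> k *\<^sub>R \<xi>) \<longlonglongrightarrow> x" by (rule tendsto_eq_intros \<epsilon> | simp)+
      show "\<forall>\<^sub>F k in sequentially. (indicator (box l u) (x + \<epsilon> k *\<^sub>R \<xi>) :: real) = indicator (box l u) x"
      proof (cases "x \<in> box l u")
        case True
        from topological_tendstoD[OF lim open_box True] show ?thesis by eventually_elim (use True in simp)
      next
        case False
        hence "x \<in> - cbox l u" using x by auto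
        from topological_tendstoD[OF lim _ this] have "\<forall>\<^sub>F k in sequentially. x + \<epsilon> k *\<^sub>R \<xi> \<in> - cbox l u"
          by (simp add: closed_cbox open_Compl)
        thus ?thesis by eventually_elim (use False box_subset_cbox in \<open>auto simp: indicator_def\<close>)
      qed
    qed
    thus "AE \<xi> in lborel. (\<lambda>k. indicator (box l u) (x + \<epsilon> k *\<^sub>R \<xi>) * gauss_density \<xi>) \<longlonglongrightarrow> indicator (box l u) x * gauss_density \<xi>"
      by simp
  qed (auto intro: integrable_gauss_density simp: indicator_def gauss_density_nonneg)
  thus ?thesis by (simp add: integral_gauss_density)
qed

lemma AE_notin_box_boundary: "AE x in lborel. x \<notin> cbox l u - box l (u :: 'a::euclidean_space)"
proof -
  have "emeasure lborel (cbox l u - box l u) = emeasure lborel (cbox l u) - emeasure lborel (box l u)"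
    by (rule emeasure_Diff) (auto simp: emeasure_lborel_box_eq box_subset_cbox)
  also have "\<dots> = 0" by (simp add: emeasure_lborel_box_eq emeasure_lborel_cbox_eq)
  finally show ?thesis by (intro AE_not_in) (auto simp: null_sets_def)
qed

text \<open>The indicator of a box is the limit of its Gaussian averages, and against each average G
  integrates to zero. Since the averages lie between 0 and 1, |G| dominates the passage to the
  limit.\<close>

lemma Fourier_transform_eq_0_imp_AE_eq_0:
  fixes G :: "real ^ 'n \<Rightarrow> complex"
  assumes G: "integrable lborel G"
    and F: "\<And>y. (LINT x|lborel. G x * exp (\<i> * complex_of_real (y \<bullet> x))) = 0"
  shows "AE x in lborel. G x = 0"
proof (rule AE_eq_0_of_box_integrals[OF G])
  fix l u :: "real ^ 'n"
  have [measurable]: "G \<in> borel_measurable borel" using G by auto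
  define \<epsilon> where "\<epsilon> k = 1 / real (Suc k)" for k
  have \<epsilon>: "\<epsilon> \<longlonglongrightarrow> 0" "\<And>k. \<epsilon> k > 0" unfolding \<epsilon>_def using LIMSEQ_Suc[OF lim_1_over_n] by (auto simp del: of_nat_Suc)
  let ?I = "indicator (box l u) :: real ^ 'n \<Rightarrow> real"
  let ?T = "\<lambda>k x. LINT \<xi>|lborel. ?I (x + \<epsilon> k *\<^sub>R \<xi>) * gauss_density \<xi>"
  have T01: "0 \<le> ?T k x" "?T k x \<le> 1" for k x
  proof -
    show "0 \<le> ?T k x" by (intro integral_nonneg_AE) (auto simp: gauss_density_nonneg)
    have "?T k x \<le> (LINT \<xi>|lborel. gauss_density (\<xi> :: real ^ 'n))"
      by (rule integral_mono_AE) (auto intro!: integrable_gauss_density Bochner_Integration.integrable_bound[OF integrable_gauss_density] simp: gauss_density_nonneg indicator_def)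
    thus "?T k x \<le> 1" by (simp add: integral_gauss_density)
  qed
  have zero: "(LINT x|lborel. complex_of_real (?T k x) * G x) = 0" for k
  proof -
    define b where "b = 1 / \<epsilon> k"
    have b: "b > 0" "b * \<epsilon> k = 1" using \<epsilon>(2)[of k] by (auto simp: b_def)
    \<comment> \<open>The substitution a = x + \<epsilon> k \<xi> turns the average into a
      convolution with a Gaussian of scale b = 1 / \<epsilon> k, the form treated by
      \<open>integral_gauss_convolution_eq_0\<close>.\<close>
    have T: "?T k x = b ^ CARD('n) * (LINT a|lborel. ?I a * gauss_density (b *\<^sub>R (a - x)))" for x
      by (subst integral_lborel_affine[of "\<epsilon> k" _ x]) (use b \<epsilon>(2)[of k] in \<open>auto simp: mult.assoc[symmetric] power_mult_distrib[symmetric]\<close>)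
    define H where "H x a = G x * complex_of_real (?I a * gauss_density (b *\<^sub>R (a - x)))" for x a :: "real ^ 'n"
    have [measurable]: "(\<lambda>(x, a). H x a) \<in> borel_measurable (borel \<Otimes>\<^sub>M borel)"
      unfolding H_def by measurable
    have ia: "integrable lborel (\<lambda>a. ?I a * gauss_density (b *\<^sub>R (a - x)))" for x
    proof -
      have "gauss_density \<xi> \<le> 1" for \<xi> :: "real ^ 'n"
        unfolding gauss_density_def
      proof (intro prod_le_1 conjI)
        fix j
        have "sqrt (2 * pi) \<ge> 1" using pi_ge_two by simp
        hence "1 / sqrt (2 * pi) * exp (- (\<xi> $ j)\<^sup>2 / 2) \<le> 1 * 1" by (intro mult_mono) auto
        thus "std_normal_density (\<xi> $ j) \<le> 1" by (simp add: normal_density_def)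
      qed auto
      moreover have "integrable lborel ?I" by (simp add: emeasure_lborel_box_eq)
      ultimately show ?thesis
        by (intro Bochner_Integration.integrable_bound[OF \<open>integrable lborel ?I\<close>]) (auto simp: indicator_def gauss_density_nonneg)
    qed
    have iH: "integrable (lborel \<Otimes>\<^sub>M lborel) (\<lambda>(x, a). H x a)"
    proof (rule lborel_pair.Fubini_integrable)
      have n: "norm (H x a) = norm (G x) * (?I a * gauss_density (b *\<^sub>R (a - x)))" for x a
        by (simp add: H_def norm_mult gauss_density_nonneg)
      have "(LINT a|lborel. norm (H x a)) = (1 / b) ^ CARD('n) * (norm (G x) * ?T k x)" for x
        unfolding n T using b(1) by (simp add: power_divide)
      moreover have "integrable lborel (\<lambda>x. norm (G x) * ?T k x)"
        using G by (intro Bochner_Integration.integrable_bound[OF integrable_norm[OF G]])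
          (auto simp: abs_mult T01 intro!: mult_left_le)
      ultimately show "integrable lborel (\<lambda>x. LINT a|lborel. norm (case (x, a) of (x, a) \<Rightarrow> H x a))" by simp
      have "integrable lborel (\<lambda>a. H x a)" for x
        unfolding H_def by (intro integrable_mult_right integrable_of_real ia)
      thus "AE x in lborel. integrable lborel (\<lambda>a. case (x, a) of (x, a) \<Rightarrow> H x a)" by simp
    qed simp
    have "complex_of_real (?T k x) * G x = complex_of_real (b ^ CARD('n)) * (LINT a|lborel. H x a)" for x
      unfolding T H_def integral_mult_right_zero integral_complex_of_real by (simp add: mult_ac)
    hence "(LINT x|lborel. complex_of_real (?T k x) * G x) = (LINT x|lborel. complex_of_real (b ^ CARD('n)) * (LINT a|lborel. H x a))"
      by simp
    also have "\<dots> = complex_of_real (b ^ CARD('n)) * (LINT x|lborel. LINT a|lborel. H x a)" by simp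
    also have "(LINT x|lborel. LINT a|lborel. H x a) = (LINT a|lborel. LINT x|lborel. H x a)"
      by (rule lborel_pair.Fubini_integral[symmetric]) (use iH in simp)
    also have "\<dots> = (LINT a|lborel. complex_of_real (?I a) * (LINT x|lborel. G x * complex_of_real (gauss_density (b *\<^sub>R (a - x)))))"
      unfolding H_def integral_mult_right_zero[symmetric] by (simp add: mult_ac)
    also have "\<dots> = 0" by (simp add: integral_gauss_convolution_eq_0[OF G F])
    finally show ?thesis by simp
  qed
  have "(\<lambda>k. LINT x|lborel. complex_of_real (?T k x) * G x) \<longlonglongrightarrow> (LINT x|lborel. complex_of_real (?I x) * G x)"
  proof (rule integral_dominated_convergence[where w="\<lambda>x. norm (G x)"])
    show "AE x in lborel. (\<lambda>k. complex_of_real (?T k x) * G x) \<longlonglongrightarrow> complex_of_real (?I x) * G x"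
      using AE_notin_box_boundary[of l u]
      by eventually_elim (intro tendsto_mult_right tendsto_of_real gauss_smoothing_box_tendsto \<epsilon>(1))
    show "AE x in lborel. norm (complex_of_real (?T k x) * G x) \<le> norm (G x)" for k
      by (auto simp: norm_mult T01 intro!: mult_left_le_one_le)
  qed (use G in auto)
  hence "(LINT x|lborel. complex_of_real (?I x) * G x) = 0"
    unfolding zero by (simp add: LIMSEQ_const_iff)
  moreover have "complex_of_real (?I x) = indicator (box l u) x" for x by (simp add: indicator_def)
  ultimately show "(LINT x|lborel. indicator (box l u) x * G x) = 0" by simp
qed


subsection \<open>Rotations and the Gaussian measure\<close>

lemma measurable_Complex_pair [measurable]: "(\<lambda>p. Complex (fst p) (snd p)) \<in> borel_measurable borel"
  by (intro borel_measurable_continuous_onI) (auto simp: Complex_eq intro!: continuous_intros)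

text \<open>Transports facts about plane maps, which are proved by Fubini on pairs, to the complex
  numbers.\<close>

lemma lborel_complex_eq_distr:
  "(lborel :: complex measure) = distr lborel borel (\<lambda>p. Complex (fst p) (snd p))"
proof (rule lborel_eqI)
  fix l u :: complex assume le: "\<And>b. b \<in> Basis \<Longrightarrow> l \<bullet> b \<le> u \<bullet> b"
  have [measurable]: "(\<lambda>p::real \<times> real. Complex (fst p) (snd p)) \<in> borel_measurable borel"
    by (rule measurable_Complex_pair)
  have le': "Re l \<le> Re u" "Im l \<le> Im u" using le[of 1] le[of \<i>] by (auto simp: Basis_complex_def)
  have "(\<lambda>p. Complex (fst p) (snd p)) -` box l u = box (Re l, Im l) (Re u, Im u)"
    by (auto simp: box_def Basis_complex_def Basis_prod_def)
  moreover have "(\<Prod>b\<in>Basis. ((Re u, Im u) - (Re l, Im l)) \<bullet> b) = (\<Prod>b\<in>Basis. (u - l) \<bullet> b)"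
  proof -
    have B: "(Basis :: (real \<times> real) set) = {(1, 0), (0, 1)}" by (auto simp: Basis_prod_def)
    show ?thesis unfolding B by (simp add: Basis_complex_def)
  qed
  moreover have "\<forall>b\<in>Basis. (Re l, Im l) \<bullet> b \<le> (Re u, Im u) \<bullet> b" using le' by (auto simp: Basis_prod_def)
  ultimately show "emeasure (distr lborel borel (\<lambda>p. Complex (fst p) (snd p))) (box l u) = (\<Prod>b\<in>Basis. (u - l) \<bullet> b)"
    by (simp add: emeasure_distr emeasure_lborel_box_eq)
qed simp

text \<open>For a fixed second coordinate the shear is a translation of the first, so Tonelli
  reduces the claim to translation invariance on the line.\<close>

lemma lborel_shear_fst:
  "distr lborel borel (\<lambda>p. (fst p + t * snd p, snd p)) = (lborel :: (real \<times> real) measure)"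
proof (rule measure_eqI)
  have [measurable]: "(\<lambda>p::real \<times> real. (fst p + t * snd p, snd p)) \<in> borel_measurable borel"
    by (intro borel_measurable_continuous_onI continuous_intros)
  fix A :: "(real \<times> real) set" assume "A \<in> sets (distr lborel borel (\<lambda>p. (fst p + t * snd p, snd p)))"
  hence A [measurable]: "A \<in> sets borel" by simp
  have Ap [measurable]: "A \<in> sets (borel \<Otimes>\<^sub>M borel)" unfolding borel_prod by (rule A)
  have ind: "(\<lambda>x. indicator A x :: ennreal) \<in> borel_measurable (lborel \<Otimes>\<^sub>M lborel)" by measurable
  have "emeasure (distr lborel borel (\<lambda>p. (fst p + t * snd p, snd p))) A = (\<integral>\<^sup>+p. indicator A (fst p + t * snd p, snd p) \<partial>lborel)"
    by (simp add: emeasure_distr) (subst nn_integral_indicator[symmetric], auto simp: indicator_def intro!: nn_integral_cong measurable_sets[of _ borel borel, simplified])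
  also have "\<dots> = (\<integral>\<^sup>+p. indicator A (fst p + t * snd p, snd p) \<partial>(lborel \<Otimes>\<^sub>M lborel))"
    by (simp add: lborel_prod)
  also have "\<dots> = (\<integral>\<^sup>+y. \<integral>\<^sup>+x. indicator A (x + t * y, y) \<partial>lborel \<partial>lborel)"
    by (subst lborel_pair.nn_integral_snd[symmetric]) (auto simp: lborel_prod)
  also have "\<dots> = (\<integral>\<^sup>+y. \<integral>\<^sup>+x. indicator A (x, y) \<partial>lborel \<partial>lborel)"
  proof (rule nn_integral_cong)
    fix y :: real
    show "(\<integral>\<^sup>+x. indicator A (x + t * y, y) \<partial>lborel) = (\<integral>\<^sup>+x. indicator A (x, y) \<partial>lborel)"
      using nn_integral_real_affine[of "\<lambda>x. indicator A (x, y)" 1 "t * y"] by (simp add: add.commute)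
  qed
  also have "\<dots> = (\<integral>\<^sup>+p. indicator A p \<partial>(lborel \<Otimes>\<^sub>M lborel))"
    by (rule lborel_pair.nn_integral_snd[OF ind])
  also have "\<dots> = emeasure lborel A" by (simp add: lborel_prod)
  finally show "emeasure (distr lborel borel (\<lambda>p. (fst p + t * snd p, snd p))) A = emeasure lborel A" .
qed simp

lemma lborel_swap: "distr lborel borel (\<lambda>p. (snd p, fst p)) = (lborel :: (real \<times> real) measure)"
proof -
  have "(lborel :: (real \<times> real) measure) = distr (lborel \<Otimes>\<^sub>M lborel) (lborel \<Otimes>\<^sub>M lborel) (\<lambda>(x, y). (y, x))"
    using lborel_pair.distr_pair_swap by (simp add: lborel_prod)
  also have "\<dots> = distr lborel borel (\<lambda>p. (snd p, fst p))"
    unfolding lborel_prod by (rule distr_cong) (simp_all add: split_beta)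
  finally show ?thesis by simp
qed

lemma distr_lborel_comp:
  assumes f: "f \<in> borel_measurable borel" "distr lborel borel f = lborel" and g: "g \<in> borel_measurable borel" "distr lborel borel g = lborel"
  shows "distr lborel borel (\<lambda>x. f (g x)) = (lborel :: 'a::euclidean_space measure)"
proof -
  have "distr lborel borel (\<lambda>x. f (g x)) = distr (distr lborel borel g) borel f"
    using f g by (subst distr_distr) (auto simp: comp_def)
  thus ?thesis using f g by simp
qed

lemma lborel_shear_snd:
  "distr lborel borel (\<lambda>p. (fst p, snd p + t * fst p)) = (lborel :: (real \<times> real) measure)"
proof -
  have m: "(\<lambda>p::real \<times> real. (fst p + t * snd p, snd p)) \<in> borel_measurable borel" "(\<lambda>p::real \<times> real. (snd p, fst p)) \<in> borel_measurable borel"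
    by (intro borel_measurable_continuous_onI continuous_intros)+
  have "(\<lambda>p::real \<times> real. (fst p + t * snd p, snd p)) \<circ> (\<lambda>p. (snd p, fst p)) \<in> borel_measurable borel"
    using m by (rule measurable_comp[rotated])
  hence m3: "(\<lambda>p::real \<times> real. (snd p + t * fst p, fst p)) \<in> borel_measurable borel" by (simp add: comp_def)
  have "distr lborel borel (\<lambda>p. (snd p + t * fst p, fst p)) = (lborel :: (real \<times> real) measure)"
    using distr_lborel_comp[OF m(1) lborel_shear_fst m(2) lborel_swap] by simp
  from distr_lborel_comp[OF m(2) lborel_swap m3 this] show ?thesis by simp
qed

text \<open>A plane rotation other than the half turn is a product of three shears.\<close>

lemma lborel_rotation_pair:
  fixes c s :: real
  assumes cs: "c\<^sup>2 + s\<^sup>2 = 1" and c: "c \<noteq> -1"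
  shows "distr lborel borel (\<lambda>p. (c * fst p - s * snd p, s * fst p + c * snd p)) = (lborel :: (real \<times> real) measure)"
proof -
  \<comment> \<open>The three shears have parameters t, s, t with t = -tan(\<theta>/2) for the
    rotation angle \<theta>. The half turn c = -1 is the pole of this expression.\<close>
  define t where "t = - s / (1 + c)"
  have c1: "1 + c \<noteq> 0" using c by linarith
  have "s * s = (1 - c) * (1 + c)" using cs by (simp add: power2_eq_square algebra_simps)
  hence 1: "1 + s * t = c" unfolding t_def using c1 by (simp add: field_simps)
  have 2: "t * (1 + c) = - s" unfolding t_def using c1 by simp
  let ?X = "\<lambda>p::real \<times> real. (fst p + t * snd p, snd p)" and ?Y = "\<lambda>p::real \<times> real. (fst p, snd p + s * fst p)"
  have m: "?X \<in> borel_measurable borel" "?Y \<in> borel_measurable borel" "(\<lambda>p. ?X (?Y p)) \<in> borel_measurable borel"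
    by (intro borel_measurable_continuous_onI continuous_intros)+
  have "distr lborel borel (\<lambda>p. ?X (?Y p)) = lborel"
    by (rule distr_lborel_comp[OF m(1) lborel_shear_fst m(2) lborel_shear_snd])
  from distr_lborel_comp[OF m(3) this m(1) lborel_shear_fst]
  have "distr lborel borel (\<lambda>p. ?X (?Y (?X p))) = lborel" .
  moreover have "?X (?Y (?X p)) = (c * fst p - s * snd p, s * fst p + c * snd p)" for p
  proof (cases p)
    case (Pair x y)
    have "y + s * (x + t * y) = s * x + (1 + s * t) * y" by (simp add: algebra_simps)
    hence a: "y + s * (x + t * y) = s * x + c * y" unfolding 1 .
    have "x + t * y + t * (s * x + c * y) = (1 + s * t) * x + (t * (1 + c)) * y" by (simp add: algebra_simps)
    hence "x + t * y + t * (s * x + c * y) = c * x - s * y" unfolding 1 2 by simp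
    with a show ?thesis by (simp add: Pair)
  qed
  ultimately show ?thesis by (simp only:)
qed

lemma lborel_complex_rotation:
  fixes u :: complex
  assumes u: "norm u = 1"
  shows "distr lborel borel (\<lambda>w. u * w) = (lborel :: complex measure)"
proof -
  have m: "(\<lambda>w::complex. v * w) \<in> borel_measurable borel" for v by measurable
  have main: "distr lborel borel (\<lambda>w. v * w) = (lborel :: complex measure)" if v: "norm v = 1" "v \<noteq> -1" for v
  proof -
    have c: "Re v \<noteq> -1"
    proof
      assume r: "Re v = -1"
      hence "Im v = 0" using v(1) by (simp add: cmod_def power2_eq_square)
      thus False using v(2) r by (simp add: complex_eq_iff)
    qed
    have cs: "(Re v)\<^sup>2 + (Im v)\<^sup>2 = 1" using v(1) by (simp add: cmod_def)
    have mr: "(\<lambda>p::real \<times> real. (Re v * fst p - Im v * snd p, Im v * fst p + Re v * snd p)) \<in> borel_measurable borel"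
      by (intro borel_measurable_continuous_onI continuous_intros)
    have "distr lborel borel (\<lambda>w. v * w) = distr lborel borel (\<lambda>p. v * Complex (fst p) (snd p))"
      by (subst lborel_complex_eq_distr, subst distr_distr) (auto simp: comp_def measurable_Complex_pair)
    also have "(\<lambda>p. v * Complex (fst p) (snd p)) = (\<lambda>p. Complex (fst p) (snd p)) \<circ> (\<lambda>p. (Re v * fst p - Im v * snd p, Im v * fst p + Re v * snd p))"
      by (auto simp: fun_eq_iff complex_eq_iff)
    also have "distr lborel borel \<dots> = distr (distr lborel borel (\<lambda>p. (Re v * fst p - Im v * snd p, Im v * fst p + Re v * snd p))) borel (\<lambda>p. Complex (fst p) (snd p))"
      using mr by (subst distr_distr) (auto simp: measurable_Complex_pair)
    also have "\<dots> = lborel"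
      unfolding lborel_rotation_pair[OF cs c] by (rule lborel_complex_eq_distr[symmetric])
    finally show ?thesis .
  qed
  show ?thesis
  proof (cases "u = -1")
    case True
    \<comment> \<open>The half turn, excluded from the shear factorisation, is the square of a
      quarter turn.\<close>
    have "distr lborel borel (\<lambda>w. \<i> * w) = (lborel :: complex measure)" by (rule main) (auto simp: complex_eq_iff)
    from distr_lborel_comp[OF m this m this] show ?thesis using True by (simp flip: mult.assoc)
  qed (use main u in auto)
qed

lemma emeasure_lborel_vec_PiE:
  fixes A :: "'n::finite \<Rightarrow> 'a::euclidean_space set"
  assumes "\<And>j. A j \<in> sets borel"
  shows "emeasure lborel {x :: 'a ^ 'n. \<forall>j. x $ j \<in> A j} = (\<Prod>j\<in>UNIV. emeasure lborel (A j))"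
proof -
  interpret product_sigma_finite "\<lambda>_::'n. lborel :: 'a measure" by standard
  have S: "{x :: 'a ^ 'n. \<forall>j. x $ j \<in> A j} \<in> sets borel"
    using assms by measurable
  have "vec_lambda -` {x :: 'a ^ 'n. \<forall>j. x $ j \<in> A j} \<inter> space (Pi\<^sub>M UNIV (\<lambda>_::'n. lborel :: 'a measure)) = Pi\<^sub>E UNIV A"
    by (auto simp: space_PiM PiE_def Pi_def)
  hence "emeasure (distr (Pi\<^sub>M UNIV (\<lambda>_::'n. lborel :: 'a measure)) borel vec_lambda) {x :: 'a ^ 'n. \<forall>j. x $ j \<in> A j} = (\<Prod>j\<in>UNIV. emeasure lborel (A j))"
    using S assms by (simp add: emeasure_distr emeasure_PiM)
  thus ?thesis unfolding lborel_vec_eq_distr[symmetric] .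
qed

lemma distr_lborel_vec:
  fixes T :: "'a::euclidean_space \<Rightarrow> 'a"
  assumes T [measurable]: "T \<in> borel_measurable borel" and d: "distr lborel borel T = lborel"
  shows "distr lborel borel (\<lambda>x. \<chi> j. T (x $ j)) = (lborel :: ('a ^ 'n::finite) measure)"
proof (rule sym, rule lborel_eqI)
  have m: "(\<lambda>x. \<chi> j. T (x $ j)) \<in> measurable borel (borel :: ('a ^ 'n) measure)"
    by (subst borel_measurable_euclidean_space) (auto simp: Basis_vec_def inner_axis intro!: borel_measurable_inner)
  fix l u :: "'a ^ 'n" assume le: "\<And>b. b \<in> Basis \<Longrightarrow> l \<bullet> b \<le> u \<bullet> b"
  have box: "box l u = {x. \<forall>j. x $ j \<in> box (l $ j) (u $ j)}"
    by (auto simp: box_def Basis_vec_def inner_axis)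
  have TA: "T -` box a b \<in> sets borel" for a b :: 'a
    using measurable_sets[OF T, of "box a b"] by simp
  have eq: "(\<lambda>x. \<chi> j. T (x $ j)) -` box l u = {x. \<forall>j. x $ j \<in> T -` box (l $ j) (u $ j)}"
    unfolding box by simp
  have "emeasure (distr lborel borel (\<lambda>x. \<chi> j. T (x $ j))) (box l u) = emeasure lborel {x. \<forall>j. x $ j \<in> T -` box (l $ j) (u $ j)}"
    unfolding eq[symmetric] using emeasure_distr[of "\<lambda>x. \<chi> j. T (x $ j)" lborel borel "box l u"] m by simp
  also have "\<dots> = (\<Prod>j\<in>UNIV. emeasure lborel (T -` box (l $ j) (u $ j)))"
    by (rule emeasure_lborel_vec_PiE) (rule TA)
  also have "\<dots> = (\<Prod>j\<in>UNIV. emeasure (distr lborel borel T) (box (l $ j) (u $ j)))"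
    by (simp add: emeasure_distr)
  also have "\<dots> = emeasure lborel (box l u)" unfolding d box by (rule emeasure_lborel_vec_PiE[symmetric]) simp
  also have "\<dots> = (\<Prod>b\<in>Basis. (u - l) \<bullet> b)" using le by (simp add: emeasure_lborel_box)
  finally show "emeasure (distr lborel borel (\<lambda>x. \<chi> j. T (x $ j))) (box l u) = ennreal (\<Prod>b\<in>Basis. (u - l) \<bullet> b)" .
qed simp

text \<open>Substitute for polar coordinates: the annulus a < |w|^2 < b has area pi (b - a).
  Gaussian moments on the complex plane thereby become factorial integrals on the half-line.\<close>

lemma distr_lborel_norm_square:
  "distr lborel borel (\<lambda>w::complex. (norm w)\<^sup>2) = density lborel (\<lambda>t. ennreal pi * indicator {0..} t)" (is "?D = ?E")
proof (rule measure_eqI_generator_eq)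
  let ?G = "range (\<lambda>(a, b). box a b::real set)"
  \<comment> \<open>Truncating both endpoints at 0 lets one formula cover the intervals that meet
    the negative axis.\<close>
  have Dbox: "emeasure ?D (box a b) = ennreal (pi * (max 0 b - max 0 a))" if ab: "a \<le> b" for a b :: real
  proof -
    have "emeasure ?D (box a b) = emeasure lborel {w::complex. a < (norm w)\<^sup>2 \<and> (norm w)\<^sup>2 < b}"
      by (subst emeasure_distr) (auto simp: vimage_def)
    also have "\<dots> = ennreal (pi * (max 0 b - max 0 a))"
    proof (cases "b \<le> 0")
      case True
      have "\<not> (norm w)\<^sup>2 < b" for w :: complex using True zero_le_power2[of "norm w"] by linarith
      hence e: "{w::complex. a < (norm w)\<^sup>2 \<and> (norm w)\<^sup>2 < b} = {}" by blast
      have "max 0 b = 0" "max 0 a = 0" using True ab by linarith+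
      thus ?thesis unfolding e by (simp only: emeasure_empty diff_self mult_zero_right ennreal_0)
    next
      case False
      have lt: "(norm w)\<^sup>2 < b \<longleftrightarrow> norm w < sqrt b" for w :: complex
        using False real_less_rsqrt real_sqrt_less_iff[of "(norm w)\<^sup>2" b] by auto
      have gt: "a < (norm w)\<^sup>2 \<longleftrightarrow> sqrt a < norm w" if "a \<ge> 0" for w :: complex
        using that real_sqrt_less_iff[of a "(norm w)\<^sup>2"] by auto
      show ?thesis
      proof (cases "a \<ge> 0")
        case True
        have eq: "{w::complex. a < (norm w)\<^sup>2 \<and> (norm w)\<^sup>2 < b} = ball 0 (sqrt b) - cball 0 (sqrt a)"
          unfolding lt gt[OF True] by auto
        show ?thesis
        proof (cases "a = b")
          case True
          hence e: "{w::complex. a < (norm w)\<^sup>2 \<and> (norm w)\<^sup>2 < b} = {}" by auto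
          show ?thesis unfolding e by (simp add: True)
        next
          case False
          hence sub: "cball 0 (sqrt a) \<subseteq> ball (0::complex) (sqrt b)" using ab by (auto intro!: le_less_trans[OF _ real_sqrt_less_mono[of a b]])
          have "emeasure lborel (ball (0::complex) (sqrt b) - cball 0 (sqrt a)) = emeasure lborel (ball (0::complex) (sqrt b)) - emeasure lborel (cball (0::complex) (sqrt a))"
            by (rule emeasure_Diff) (use sub in \<open>auto simp: emeasure_cball True\<close>)
          also have "\<dots> = ennreal (pi * b) - ennreal (pi * a)"
            using True \<open>\<not> b \<le> 0\<close> by (simp add: emeasure_cball emeasure_ball unit_ball_vol_2)
          finally show ?thesis unfolding eq using True ab by (simp add: ennreal_minus right_diff_distrib)
        qed
      next
        case False
        have "{w::complex. a < (norm w)\<^sup>2 \<and> (norm w)\<^sup>2 < b} = ball 0 (sqrt b)"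
          unfolding lt using False by (auto simp: not_le intro: less_le_trans)
        thus ?thesis using False \<open>\<not> b \<le> 0\<close> by (simp add: emeasure_ball unit_ball_vol_2)
      qed
    qed
    finally show ?thesis .
  qed
  have Ebox: "emeasure ?E (box a b) = ennreal (pi * (max 0 b - max 0 a))" if ab: "a \<le> b" for a b :: real
  proof -
    have "emeasure ?E (box a b) = (\<integral>\<^sup>+t. ennreal pi * indicator ({0..} \<inter> box a b) t \<partial>lborel)"
      by (subst emeasure_density) (auto intro!: nn_integral_cong simp: indicator_def)
    also have "\<dots> = ennreal pi * emeasure lborel ({0..} \<inter> box a b)"
      by (subst nn_integral_cmult) auto
    also have "emeasure lborel ({0..} \<inter> box a b) = ennreal (max 0 b - max 0 a)"
    proof (cases "a \<ge> 0")
      case True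
      hence "{0..} \<inter> box a b = {a<..<b}" by auto
      thus ?thesis using True ab by simp
    next
      case False
      hence "{0..} \<inter> box a b = {0..<b}" by auto
      thus ?thesis using False by (cases "b \<ge> 0") auto
    qed
    finally show ?thesis by (simp add: ennreal_mult')
  qed
  show "Int_stable ?G" by (auto simp: Int_stable_def box_Int_box)
  show "?G \<subseteq> Pow UNIV" "sets ?D = sigma_sets UNIV ?G" "sets ?E = sigma_sets UNIV ?G"
    by (simp_all add: borel_eq_box)
  let ?A = "\<lambda>n::nat. box (- (real n *\<^sub>R One)) (real n *\<^sub>R One) :: real set"
  show "range ?A \<subseteq> ?G" "(\<Union>i. ?A i) = UNIV"
    unfolding UN_box_eq_UNIV by auto
  show "emeasure ?D (?A i) \<noteq> \<infinity>" for i by (subst Dbox) auto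
  fix X assume "X \<in> ?G"
  then obtain a b where X: "X = box a b" by auto
  show "emeasure ?D X = emeasure ?E X"
  proof (cases "a \<le> b")
    case True
    show ?thesis unfolding X Dbox[OF True] Ebox[OF True] ..
  next
    case False
    hence "X = {}" using X by auto
    thus ?thesis by simp
  qed
qed

lemma nn_integral_complex_gauss_moment:
  "(\<integral>\<^sup>+w. ennreal ((norm (w::complex))\<^sup>2 ^ k * exp (- (norm w)\<^sup>2) / pi) \<partial>lborel) = ennreal (fact k)"
proof -
  have "(\<integral>\<^sup>+w. ennreal ((norm (w::complex))\<^sup>2 ^ k * exp (- (norm w)\<^sup>2) / pi) \<partial>lborel) =
      (\<integral>\<^sup>+t. ennreal (t ^ k * exp (- t) / pi) \<partial>distr lborel borel (\<lambda>w::complex. (norm w)\<^sup>2))"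
    by (subst nn_integral_distr) auto
  also have "\<dots> = (\<integral>\<^sup>+t. (ennreal pi * indicator {0..} t) * ennreal (t ^ k * exp (- t) / pi) \<partial>lborel)"
    unfolding distr_lborel_norm_square by (subst nn_integral_density) auto
  also have "\<dots> = (\<integral>\<^sup>+t. ennreal (t ^ k * exp (- t)) * indicator {0..} t \<partial>lborel)"
    by (intro nn_integral_cong) (auto simp: indicator_def ennreal_mult'[symmetric])
  also have "\<dots> = ennreal (fact k)"
    unfolding nn_intergal_power_times_exp_Ici by simp
  finally show ?thesis .
qed


subsection \<open>The monomial basis of the Fock space\<close>

definition gauss_weight :: "complex \<Rightarrow> real" where
  "gauss_weight w = exp (- (norm w)\<^sup>2) / pi"

lemma gauss_weight_nonneg: "gauss_weight w \<ge> 0"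
  by (simp add: gauss_weight_def)

lemma gauss_weight_measurable [measurable]: "gauss_weight \<in> borel_measurable borel"
  unfolding gauss_weight_def[abs_def] by measurable

lemma has_integral_gauss_weight_moment:
  "has_bochner_integral lborel (\<lambda>w::complex. (norm w)\<^sup>2 ^ k * gauss_weight w) (fact k)"
  by (rule has_bochner_integral_nn_integral)
     (use nn_integral_complex_gauss_moment[of k] in \<open>auto simp: gauss_weight_def\<close>)

lemma norm_vec_sq: "(norm (w :: complex ^ 'n))\<^sup>2 = (\<Sum>j\<in>UNIV. (norm (w $ j))\<^sup>2)"
  by (simp add: norm_vec_def L2_set_def sum_nonneg)

lemma gauss_measure_density:
  "(gauss_measure :: (complex ^ 'n) measure) = density lborel (\<lambda>w. ennreal (\<Prod>j\<in>UNIV. gauss_weight (w $ j)))"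
proof -
  have "exp (- (norm w)\<^sup>2) / pi ^ CARD('n) = (\<Prod>j\<in>UNIV. gauss_weight (w $ j))" for w :: "complex ^ 'n"
    by (simp add: gauss_weight_def prod_dividef norm_vec_sq sum_negf[symmetric] exp_sum)
  thus ?thesis unfolding gauss_measure_def by simp
qed

lemma gauss_measure_sets [simp, measurable_cong]: "sets gauss_measure = sets borel"
  by (simp add: gauss_measure_def)

lemma
  fixes f :: "'n::finite \<Rightarrow> complex \<Rightarrow> complex"
  assumes m: "\<And>j. f j \<in> borel_measurable borel" and i: "\<And>j. integrable lborel (\<lambda>w. gauss_weight w *\<^sub>R f j w)"
  shows integrable_gauss_measure_prod: "integrable gauss_measure (\<lambda>w. \<Prod>j\<in>UNIV. f j (w $ j))"
    and integral_gauss_measure_prod: "(LINT w|gauss_measure. (\<Prod>j\<in>UNIV. f j (w $ j))) = (\<Prod>j\<in>UNIV. LINT w|lborel. gauss_weight w *\<^sub>R f j w)"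
proof -
  note m [measurable]
  have eq: "(\<Prod>j\<in>UNIV. gauss_weight (w $ j)) *\<^sub>R (\<Prod>j\<in>UNIV. f j (w $ j)) = (\<Prod>j\<in>UNIV. gauss_weight (w $ j) *\<^sub>R f j (w $ j))" for w :: "complex ^ 'n"
    by (simp add: scaleR_conv_of_real prod.distrib)
  show "integrable gauss_measure (\<lambda>w. \<Prod>j\<in>UNIV. f j (w $ j))"
    unfolding gauss_measure_density
    by (subst integrable_density) (auto simp: eq prod_nonneg gauss_weight_nonneg intro!: integrable_prod_vec i)
  show "(LINT w|gauss_measure. (\<Prod>j\<in>UNIV. f j (w $ j))) = (\<Prod>j\<in>UNIV. LINT w|lborel. gauss_weight w *\<^sub>R f j w)"
    unfolding gauss_measure_density
    by (subst integral_density) (auto simp: eq prod_nonneg gauss_weight_nonneg integral_prod_vec[OF i])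
qed

lemma gauss_measure_total: "integrable (gauss_measure :: (complex ^ 'n) measure) (\<lambda>w. 1::real)" "(LINT w|(gauss_measure :: (complex ^ 'n) measure). (1::complex)) = 1"
proof -
  have h: "has_bochner_integral lborel gauss_weight 1" using has_integral_gauss_weight_moment[of 0] by simp
  have i: "integrable lborel (\<lambda>w. gauss_weight w *\<^sub>R (1::complex))"
    using h by (intro integrable_scaleR_left) (auto simp: has_bochner_integral_iff)
  have v: "(LINT w|lborel. gauss_weight w *\<^sub>R (1::complex)) = 1"
    using h by (simp add: has_bochner_integral_iff)
  have "integrable gauss_measure (\<lambda>w::complex ^ 'n. (1::complex))"
    using integrable_gauss_measure_prod[of "\<lambda>_ _. 1", OF _ i] by simp
  thus "integrable gauss_measure (\<lambda>w::complex ^ 'n. (1::real))"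
    using integrable_Re by fastforce
  show "(LINT w|(gauss_measure :: (complex ^ 'n) measure). (1::complex)) = 1"
    using integral_gauss_measure_prod[of "\<lambda>_ _. 1", OF _ i] v by simp
qed

lemma integral_lborel_complex_rotation:
  fixes f :: "complex \<Rightarrow> complex"
  assumes u: "norm u = 1" and f: "f \<in> borel_measurable borel"
  shows "(LINT w|lborel. f (u * w)) = (LINT w|lborel. f w)"
proof -
  have "(LINT w|lborel. f w) = integral\<^sup>L (distr lborel borel (\<lambda>w. u * w)) f"
    by (simp add: lborel_complex_rotation[OF u])
  also have "\<dots> = (LINT w|lborel. f (u * w))" using f by (subst integral_distr) auto
  finally show ?thesis by simp
qed

text \<open>The factor \<rho> serves two purposes. The constant 1 gives the inner products of the
  Fock space; the indicator of the unit disc gives local ones, used for uniqueness of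
  coefficients.\<close>

definition radial_moment :: "(real \<Rightarrow> real) \<Rightarrow> nat \<Rightarrow> nat \<Rightarrow> complex" where
  "radial_moment \<rho> j k = (LINT w|lborel. gauss_weight w *\<^sub>R (w ^ j * cnj (w ^ k) * complex_of_real (\<rho> (norm w))))"

text \<open>The bound r \<le> 1 + r^2 for r = |w|^(j+k) dominates every mixed moment by two even
  Gaussian moments.\<close>

lemma radial_moment_integrable:
  assumes [measurable]: "\<rho> \<in> borel_measurable borel" and \<rho>: "\<And>r. \<bar>\<rho> r\<bar> \<le> 1"
  shows "integrable lborel (\<lambda>w. gauss_weight w *\<^sub>R (w ^ j * cnj (w ^ k) * complex_of_real (\<rho> (norm w))))"
proof (rule Bochner_Integration.integrable_bound)
  show "integrable lborel (\<lambda>w::complex. (norm w)\<^sup>2 ^ 0 * gauss_weight w + (norm w)\<^sup>2 ^ (j + k) * gauss_weight w)"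
    using has_integral_gauss_weight_moment by (intro Bochner_Integration.integrable_add) (auto simp: has_bochner_integral_iff simp del: power_0)
  show "(\<lambda>w. gauss_weight w *\<^sub>R (w ^ j * cnj (w ^ k) * complex_of_real (\<rho> (norm w)))) \<in> borel_measurable lborel"
    by measurable
  have "norm (gauss_weight w *\<^sub>R (w ^ j * cnj (w ^ k) * complex_of_real (\<rho> (norm w)))) \<le> norm ((norm w)\<^sup>2 ^ 0 * gauss_weight w + (norm w)\<^sup>2 ^ (j + k) * gauss_weight w)" for w
  proof -
    have "(norm w) ^ (j + k) \<le> 1 + ((norm w) ^ (j + k))\<^sup>2"
      using zero_le_power2[of "norm w ^ (j + k) - 1/2"] by (simp add: power2_diff power2_eq_square[of "1/2"])
    hence "(norm w) ^ (j + k) * \<bar>\<rho> (norm w)\<bar> \<le> (1 + ((norm w) ^ (j + k))\<^sup>2) * 1"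
      using \<rho> by (intro mult_mono) auto
    hence "gauss_weight w * ((norm w) ^ (j + k) * \<bar>\<rho> (norm w)\<bar>) \<le> gauss_weight w * (1 + ((norm w) ^ (j + k))\<^sup>2)"
      using gauss_weight_nonneg by (intro mult_left_mono) auto
    moreover have "norm (gauss_weight w *\<^sub>R (w ^ j * cnj (w ^ k) * complex_of_real (\<rho> (norm w)))) = gauss_weight w * ((norm w) ^ (j + k) * \<bar>\<rho> (norm w)\<bar>)"
      by (simp add: norm_mult norm_power power_add gauss_weight_nonneg)
    moreover have "norm ((norm w)\<^sup>2 ^ 0 * gauss_weight w + (norm w)\<^sup>2 ^ (j + k) * gauss_weight w) = gauss_weight w * (1 + ((norm w) ^ (j + k))\<^sup>2)"
      by (simp add: gauss_weight_nonneg add_nonneg_nonneg algebra_simps flip: power_mult)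
    ultimately show ?thesis by simp
  qed
  thus "AE w in lborel. norm (gauss_weight w *\<^sub>R (w ^ j * cnj (w ^ k) * complex_of_real (\<rho> (norm w)))) \<le> norm ((norm w)\<^sup>2 ^ 0 * gauss_weight w + (norm w)\<^sup>2 ^ (j + k) * gauss_weight w)"
    by simp
qed

text \<open>The weight and \<rho> are invariant under rotations, so a rotation that multiplies w^j
  cnj(w^k) by -1 shows that the integral equals its own negative.\<close>

lemma radial_moment_orthogonal:
  assumes \<rho> [measurable]: "\<rho> \<in> borel_measurable borel" and jk: "j \<noteq> k"
  shows "radial_moment \<rho> j k = 0"
proof -
  define d where "d = real j - real k"
  \<comment> \<open>The angle pi / (j - k), of either sign, gives u^j cnj(u^k) = -1.\<close>
  define u where "u = cis (pi / d)"
  have d: "d \<noteq> 0" using jk by (simp add: d_def)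
  have "u ^ j * cnj (u ^ k) = cis (real j * (pi / d)) * cis (- (real k * (pi / d)))"
    unfolding u_def by (simp add: Complex.DeMoivre cis_cnj)
  also have "\<dots> = cis (d * (pi / d))" unfolding cis_mult d_def by (simp add: algebra_simps diff_divide_distrib)
  also have "\<dots> = -1" using d by (simp add: cis_pi)
  finally have u: "u ^ j * cnj (u ^ k) = -1" .
  have nu: "norm u = 1" by (simp add: u_def)
  let ?f = "\<lambda>w. gauss_weight w *\<^sub>R (w ^ j * cnj (w ^ k) * complex_of_real (\<rho> (norm w)))"
  have "?f (u * w) = (u ^ j * cnj (u ^ k)) * ?f w" for w
    using nu by (simp add: gauss_weight_def norm_mult power_mult_distrib scaleR_conv_of_real mult_ac)
  hence "?f (u * w) = - ?f w" for w unfolding u by simp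
  hence "(LINT w|lborel. ?f (u * w)) = - (LINT w|lborel. ?f w)" by simp
  moreover have "(LINT w|lborel. ?f (u * w)) = (LINT w|lborel. ?f w)"
    by (rule integral_lborel_complex_rotation[OF nu]) measurable
  ultimately show ?thesis by (simp add: radial_moment_def)
qed

lemma radial_moment_one: "radial_moment (\<lambda>_. 1) k k = fact k"
proof -
  have "gauss_weight w *\<^sub>R (w ^ k * cnj (w ^ k) * complex_of_real 1) = complex_of_real ((norm w)\<^sup>2 ^ k * gauss_weight w)" for w
  proof -
    have "w ^ k * cnj (w ^ k) = complex_of_real ((norm (w ^ k))\<^sup>2)" by (rule complex_norm_square[symmetric])
    thus ?thesis by (simp add: norm_power scaleR_conv_of_real power_mult[symmetric] mult.commute)
  qed
  hence "radial_moment (\<lambda>_. 1) k k = (LINT w|lborel. complex_of_real ((norm w)\<^sup>2 ^ k * gauss_weight w))"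
    unfolding radial_moment_def by (simp only:)
  also have "\<dots> = complex_of_real (fact k)"
    using has_integral_gauss_weight_moment[of k] unfolding integral_complex_of_real by (simp only: has_bochner_integral_iff)
  finally show ?thesis by simp
qed

text \<open>The integrand is nonnegative and positive on the punctured disc, a set of positive
  measure. The origin is removed because w^k may vanish there.\<close>

lemma radial_moment_disc_pos: "\<exists>r>0. radial_moment (indicator {..1}) k k = complex_of_real r"
proof -
  let ?g = "\<lambda>w::complex. gauss_weight w * ((norm w) ^ (2 * k) * indicator {..1} (norm w))"
  have eq: "gauss_weight w *\<^sub>R (w ^ k * cnj (w ^ k) * complex_of_real (indicator {..1} (norm w))) = complex_of_real (?g w)" for w
  proof -
    have "w ^ k * cnj (w ^ k) = complex_of_real ((norm (w ^ k))\<^sup>2)" by (rule complex_norm_square[symmetric])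
    thus ?thesis by (simp add: norm_power scaleR_conv_of_real power_mult[symmetric] mult.commute)
  qed
  have m: "(indicator {..1} :: real \<Rightarrow> real) \<in> borel_measurable borel" by measurable
  have "integrable lborel (\<lambda>w. complex_of_real (?g w))"
    using radial_moment_integrable[OF m, of k k] unfolding eq by (simp add: indicator_def)
  hence i: "integrable lborel ?g" using integrable_Re by fastforce
  have "(LINT w|lborel. ?g w) \<noteq> 0"
  proof
    assume "(LINT w|lborel. ?g w) = 0"
    hence ae: "AE w in lborel. ?g w = 0"
      using integral_nonneg_eq_0_iff_AE[OF i] gauss_weight_nonneg by simp
    have "AE w in lborel. w \<notin> ball (0::complex) 1 - {0}"
      using ae by eventually_elim (auto simp: gauss_weight_def)
    hence "ball (0::complex) 1 - {0} \<in> null_sets lborel"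
      by (subst (asm) AE_iff_null_sets[symmetric]) auto
    hence "emeasure lborel (ball (0::complex) 1 - {0}) = 0" by auto
    moreover have "emeasure lborel (ball (0::complex) 1 - {0}) = emeasure lborel (ball (0::complex) 1)"
      by (rule emeasure_Diff_null_set) auto
    ultimately show False by (simp add: emeasure_ball unit_ball_vol_2)
  qed
  moreover have "(LINT w|lborel. ?g w) \<ge> 0" using gauss_weight_nonneg by simp
  ultimately have "(LINT w|lborel. ?g w) > 0" by linarith
  moreover have "radial_moment (indicator {..1}) k k = complex_of_real (LINT w|lborel. ?g w)"
    unfolding radial_moment_def eq by (rule integral_complex_of_real)
  ultimately show ?thesis by blast
qed

lemma
  fixes \<alpha> \<beta> :: "'n::finite \<Rightarrow> nat"
  assumes m: "\<rho> \<in> borel_measurable borel" and b: "\<And>r. \<bar>\<rho> r\<bar> \<le> 1"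
  shows integrable_fock_basis_mult: "integrable gauss_measure (\<lambda>w. fock_basis \<alpha> w * cnj (fock_basis \<beta> w) * complex_of_real (\<Prod>j\<in>UNIV. \<rho> (norm (w $ j))))"
    and integral_fock_basis_mult: "(LINT w|gauss_measure. fock_basis \<alpha> w * cnj (fock_basis \<beta> w) * complex_of_real (\<Prod>j\<in>UNIV. \<rho> (norm (w $ j)))) =
      (\<Prod>j\<in>UNIV. radial_moment \<rho> (\<alpha> j) (\<beta> j) / complex_of_real (sqrt (fact (\<alpha> j)) * sqrt (fact (\<beta> j))))"
proof -
  note m [measurable]
  let ?f = "\<lambda>j w. (1 / complex_of_real (sqrt (fact (\<alpha> j)) * sqrt (fact (\<beta> j)))) * (w ^ \<alpha> j * cnj (w ^ \<beta> j) * complex_of_real (\<rho> (norm w)))"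
  have eq: "fock_basis \<alpha> w * cnj (fock_basis \<beta> w) * complex_of_real (\<Prod>j\<in>UNIV. \<rho> (norm (w $ j))) = (\<Prod>j\<in>UNIV. ?f j (w $ j))" for w
    by (simp add: fock_basis_prod prod.distrib prod_dividef)
  have mf: "?f j \<in> borel_measurable borel" for j by measurable
  have sc: "gauss_weight w *\<^sub>R ?f j w = (1 / complex_of_real (sqrt (fact (\<alpha> j)) * sqrt (fact (\<beta> j)))) * (gauss_weight w *\<^sub>R (w ^ \<alpha> j * cnj (w ^ \<beta> j) * complex_of_real (\<rho> (norm w))))" for j w
    by (simp add: scaleR_conv_of_real mult_ac)
  have i: "integrable lborel (\<lambda>w. gauss_weight w *\<^sub>R ?f j w)" for j
    unfolding sc by (intro integrable_mult_right radial_moment_integrable m b)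
  show "integrable gauss_measure (\<lambda>w. fock_basis \<alpha> w * cnj (fock_basis \<beta> w) * complex_of_real (\<Prod>j\<in>UNIV. \<rho> (norm (w $ j))))"
    unfolding eq by (rule integrable_gauss_measure_prod[OF mf i])
  have "(LINT w|gauss_measure. (\<Prod>j\<in>UNIV. ?f j (w $ j))) = (\<Prod>j\<in>UNIV. LINT w|lborel. gauss_weight w *\<^sub>R ?f j w)"
    by (rule integral_gauss_measure_prod[OF mf i])
  also have "\<dots> = (\<Prod>j\<in>UNIV. radial_moment \<rho> (\<alpha> j) (\<beta> j) / complex_of_real (sqrt (fact (\<alpha> j)) * sqrt (fact (\<beta> j))))"
    unfolding sc integral_mult_right_zero radial_moment_def by simp
  finally show "(LINT w|gauss_measure. fock_basis \<alpha> w * cnj (fock_basis \<beta> w) * complex_of_real (\<Prod>j\<in>UNIV. \<rho> (norm (w $ j)))) =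
      (\<Prod>j\<in>UNIV. radial_moment \<rho> (\<alpha> j) (\<beta> j) / complex_of_real (sqrt (fact (\<alpha> j)) * sqrt (fact (\<beta> j))))"
    unfolding eq .
qed

lemma measurable_fock_basis [measurable]: "fock_basis \<alpha> \<in> borel_measurable borel"
  unfolding fock_basis_prod[abs_def] by measurable

lemma orthonormal_family_fock_basis: "orthonormal_family gauss_measure (fock_basis :: ('n::finite \<Rightarrow> nat) \<Rightarrow> _)"
proof
  have m: "(\<lambda>_. 1 :: real) \<in> borel_measurable borel" by simp
  fix \<alpha> \<beta> :: "'n \<Rightarrow> nat"
  have "integrable gauss_measure (\<lambda>w. fock_basis \<alpha> w * cnj (fock_basis \<alpha> w))"
    using integrable_fock_basis_mult[OF m, of \<alpha> \<alpha>] by simp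
  hence "integrable gauss_measure (\<lambda>w. complex_of_real ((norm (fock_basis \<alpha> w))\<^sup>2))"
    by (simp add: complex_norm_square del: of_real_power)
  hence "integrable gauss_measure (\<lambda>w. (norm (fock_basis \<alpha> w))\<^sup>2)"
    using integrable_Re by fastforce
  thus "fock_basis \<alpha> \<in> l2 gauss_measure" by (intro l2I) (auto simp: measurable_cong_sets[OF gauss_measure_sets refl])
  have "l2_inner gauss_measure (fock_basis \<alpha>) (fock_basis \<beta>) =
      (\<Prod>j\<in>UNIV. radial_moment (\<lambda>_. 1) (\<alpha> j) (\<beta> j) / complex_of_real (sqrt (fact (\<alpha> j)) * sqrt (fact (\<beta> j))))"
    using integral_fock_basis_mult[OF m, of \<alpha> \<beta>] by (simp add: l2_inner_def)
  also have "\<dots> = (if \<alpha> = \<beta> then 1 else 0)"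
  proof (cases "\<alpha> = \<beta>")
    case False
    then obtain j where "\<alpha> j \<noteq> \<beta> j" by auto
    thus ?thesis using False radial_moment_orthogonal[OF m] by (auto intro!: prod_zero)
  qed (simp add: radial_moment_one)
  finally show "l2_inner gauss_measure (fock_basis \<alpha>) (fock_basis \<beta>) = (if \<alpha> = \<beta> then 1 else 0)" .
qed

text \<open>Uniqueness of the coefficients: on the unit polydisc an everywhere convergent power series is
  an \<open>L\<^sup>2\<close> expansion in orthogonal functions, whatever the growth of its coefficients.\<close>

lemma fock_expansion_zero:
  fixes c :: "('n::finite \<Rightarrow> nat) \<Rightarrow> complex"
  assumes c: "fock_expansion c (\<lambda>_. 0)"
  shows "c \<alpha> = 0"
proof -
  define \<rho> :: "real \<Rightarrow> real" where "\<rho> = indicator {..1}"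
  have m [measurable]: "\<rho> \<in> borel_measurable borel" unfolding \<rho>_def by measurable
  have b: "\<bar>\<rho> r\<bar> \<le> 1" for r by (simp add: \<rho>_def indicator_def)
  define D :: "complex ^ 'n \<Rightarrow> real" where "D w = (\<Prod>j\<in>UNIV. \<rho> (norm (w $ j)))" for w
  have D01: "D w = 0 \<or> (D w = 1 \<and> (\<forall>j. norm (w $ j) \<le> 1))" for w
    unfolding D_def \<rho>_def by (cases "\<forall>j. norm (w $ j) \<le> 1") (auto intro!: prod_zero bexI simp: indicator_def)
  have Dm [measurable]: "D \<in> borel_measurable borel" unfolding D_def[abs_def] by measurable
  have "\<exists>r>0. radial_moment \<rho> k k = complex_of_real r" for k unfolding \<rho>_def by (rule radial_moment_disc_pos)
  then obtain r where r: "\<And>k. r k > 0" "\<And>k. radial_moment \<rho> k k = complex_of_real (r k)" by metis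
  define a where "a \<alpha> = sqrt (\<Prod>j\<in>UNIV. r (\<alpha> j) / fact (\<alpha> j))" for \<alpha> :: "'n \<Rightarrow> nat"
  have apos: "a \<alpha> > 0" for \<alpha> unfolding a_def using r by (auto intro!: prod_pos)
  have asq: "complex_of_real (a \<alpha>) * complex_of_real (a \<alpha>) = (\<Prod>j\<in>UNIV. complex_of_real (r (\<alpha> j)) / fact (\<alpha> j))" for \<alpha>
  proof -
    have "a \<alpha> * a \<alpha> = (\<Prod>j\<in>UNIV. r (\<alpha> j) / fact (\<alpha> j))"
      unfolding a_def using r(1) by (intro real_sqrt_mult_self[THEN trans] abs_of_nonneg prod_nonneg) (auto intro: order_less_imp_le)
    thus ?thesis by (simp flip: of_real_mult)
  qed
  \<comment> \<open>The monomials, cut off to the unit polydisc and normalised. They remain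
    orthogonal because the cutoff is radial in each coordinate.\<close>
  define E where "E \<alpha> w = fock_basis \<alpha> w * complex_of_real (D w / a \<alpha>)" for \<alpha> w
  have DD: "D w * D w = D w" for w using D01[of w] by auto
  have Emult: "E \<alpha> w * cnj (E \<beta> w) = (1 / (complex_of_real (a \<alpha>) * complex_of_real (a \<beta>))) * (fock_basis \<alpha> w * cnj (fock_basis \<beta> w) * complex_of_real (D w))" for \<alpha> \<beta> w
  proof -
    have "E \<alpha> w * cnj (E \<beta> w) = (1 / (complex_of_real (a \<alpha>) * complex_of_real (a \<beta>))) * (fock_basis \<alpha> w * cnj (fock_basis \<beta> w) * complex_of_real (D w * D w))"
      by (simp add: E_def)
    thus ?thesis unfolding DD .
  qed
  have Eint: "integrable gauss_measure (\<lambda>w. E \<alpha> w * cnj (E \<beta> w))" for \<alpha> \<beta>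
    unfolding Emult using integrable_fock_basis_mult[OF m b] by (intro integrable_mult_right) (simp add: D_def)
  have Em: "E \<alpha> \<in> borel_measurable borel" for \<alpha> unfolding E_def[abs_def] by measurable
  have Eip: "l2_inner gauss_measure (E \<alpha>) (E \<beta>) = (if \<alpha> = \<beta> then 1 else 0)" for \<alpha> \<beta>
  proof -
    have "l2_inner gauss_measure (E \<alpha>) (E \<beta>) = (1 / (complex_of_real (a \<alpha>) * complex_of_real (a \<beta>))) *
        (\<Prod>j\<in>UNIV. radial_moment \<rho> (\<alpha> j) (\<beta> j) / complex_of_real (sqrt (fact (\<alpha> j)) * sqrt (fact (\<beta> j))))"
      unfolding l2_inner_def Emult integral_mult_right_zero integral_fock_basis_mult[OF m b, symmetric] D_def ..
    also have "\<dots> = (if \<alpha> = \<beta> then 1 else 0)"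
    proof (cases "\<alpha> = \<beta>")
      case False
      then obtain j where "\<alpha> j \<noteq> \<beta> j" by auto
      thus ?thesis using False radial_moment_orthogonal[OF m] by (auto intro!: prod_zero)
    next
      case True
      have "(\<Prod>j\<in>UNIV. radial_moment \<rho> (\<beta> j) (\<beta> j) / complex_of_real (sqrt (fact (\<beta> j)) * sqrt (fact (\<beta> j)))) = complex_of_real (a \<beta>) * complex_of_real (a \<beta>)"
        unfolding asq by (simp add: r(2))
      thus ?thesis using True apos[of \<beta>] by simp
    qed
    finally show ?thesis .
  qed
  have El2: "E \<alpha> \<in> l2 gauss_measure" for \<alpha>
  proof (rule l2I)
    show "E \<alpha> \<in> borel_measurable gauss_measure" using Em by (simp add: measurable_cong_sets[OF gauss_measure_sets refl])
    have "integrable gauss_measure (\<lambda>w. complex_of_real ((norm (E \<alpha> w))\<^sup>2))"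
      using Eint[of \<alpha> \<alpha>] by (simp add: complex_norm_square del: of_real_power)
    thus "integrable gauss_measure (\<lambda>w. (norm (E \<alpha> w))\<^sup>2)" using integrable_Re by fastforce
  qed
  interpret E: orthonormal_family gauss_measure E by standard (rule El2 Eip)+
  \<comment> \<open>E \<alpha> has norm one for a probability measure, so its supremum is at least
    one, and on the polydisc a monomial is bounded by its value at (1, ..., 1). This ties the
    normalisation a \<alpha> to a point at which the series converges absolutely.\<close>
  have a_le: "a \<alpha> \<le> norm (fock_basis \<alpha> (\<chi> j. 1) :: complex)" for \<alpha>
  proof -
    have "norm (fock_basis \<alpha> w) * D w \<le> norm (fock_basis \<alpha> (\<chi> j. 1))" for w
    proof (cases "D w = 0")
      case False
      hence w: "D w = 1" "\<And>j. norm (w $ j) \<le> 1" using D01[of w] by auto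
      have "norm (fock_basis \<alpha> w) \<le> norm (fock_basis \<alpha> (\<chi> j. 1))"
        unfolding fock_basis_prod prod_norm[symmetric]
        by (intro prod_mono) (auto simp: norm_divide norm_power w(2) power_le_one intro!: divide_right_mono)
      thus ?thesis using w by simp
    qed simp
    moreover have "norm (E \<alpha> w) = norm (fock_basis \<alpha> w) * D w / a \<alpha>" for w
      using apos[of \<alpha>] D01[of w] by (auto simp: E_def norm_mult norm_divide)
    ultimately have "norm (E \<alpha> w) \<le> norm (fock_basis \<alpha> (\<chi> j. 1)) / a \<alpha>" for w
      using apos[of \<alpha>] by (simp add: divide_right_mono)
    hence "(norm (E \<alpha> w))\<^sup>2 \<le> (norm (fock_basis \<alpha> (\<chi> j. 1)) / a \<alpha>)\<^sup>2 * 1" for w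
      by (simp add: power_mono)
    hence "l2_sq gauss_measure (E \<alpha>) \<le> (LINT w|(gauss_measure :: (complex ^ 'n) measure). (norm (fock_basis \<alpha> (\<chi> j. 1)) / a \<alpha>)\<^sup>2 * 1)"
      unfolding l2_sq_def by (intro integral_mono l2_integrable_sq El2 integrable_mult_right gauss_measure_total(1))
    also have "\<dots> = (norm (fock_basis \<alpha> (\<chi> j. 1)) / a \<alpha>)\<^sup>2 * (LINT w|(gauss_measure :: (complex ^ 'n) measure). 1)"
      by (rule integral_mult_right_zero)
    also have "(LINT w|(gauss_measure :: (complex ^ 'n) measure). (1::real)) = 1"
    proof -
      have "complex_of_real (LINT w|(gauss_measure :: (complex ^ 'n) measure). (1::real)) = (LINT w|(gauss_measure :: (complex ^ 'n) measure). complex_of_real 1)"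
        by (rule integral_complex_of_real[symmetric])
      thus ?thesis unfolding of_real_1 gauss_measure_total(2) of_real_eq_1_iff .
    qed
    also have "l2_sq gauss_measure (E \<alpha>) = 1"
      using l2_inner_self[of gauss_measure "E \<alpha>"] Eip[of \<alpha> \<alpha>] by (metis of_real_eq_1_iff)
    finally have "1\<^sup>2 \<le> (norm (fock_basis \<alpha> (\<chi> j. 1)) / a \<alpha>)\<^sup>2" by simp
    hence "1 \<le> norm (fock_basis \<alpha> (\<chi> j. 1)) / a \<alpha>"
      by (rule power2_le_imp_le) (use apos[of \<alpha>] in \<open>simp add: divide_nonneg_pos\<close>)
    thus ?thesis using apos[of \<alpha>] by (simp add: field_simps)
  qed
  have abs1: "(\<lambda>\<alpha>. norm (c \<alpha> * fock_basis \<alpha> (\<chi> j. 1))) summable_on UNIV"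
  proof -
    have "(\<lambda>\<alpha>. c \<alpha> * fock_basis \<alpha> (\<chi> j. 1)) summable_on UNIV"
      using c unfolding fock_expansion_def by (blast intro: has_sum_imp_summable)
    thus ?thesis by (simp add: summable_on_iff_abs_summable_on_complex)
  qed
  \<comment> \<open>Absolute summability implies square summability: one of the two factors is
    bounded by the total sum ?B.\<close>
  have s: "(\<lambda>\<alpha>. (norm (c \<alpha> * complex_of_real (a \<alpha>)))\<^sup>2) summable_on UNIV"
  proof -
    let ?g = "\<lambda>\<alpha>. norm (c \<alpha> * fock_basis \<alpha> (\<chi> j. 1))"
    let ?B = "infsum ?g UNIV"
    have le: "norm (c \<alpha> * complex_of_real (a \<alpha>)) \<le> ?g \<alpha>" for \<alpha>
      using apos[of \<alpha>] a_le[of \<alpha>] by (simp add: norm_mult mult_left_mono)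
    have B: "?g \<alpha> \<le> ?B" for \<alpha>
      using finite_sum_le_infsum[OF abs1, of "{\<alpha>}"] by simp
    have "(\<lambda>\<alpha>. ?B * ?g \<alpha>) summable_on UNIV" by (intro summable_on_cmult_right abs1)
    thus ?thesis
    proof (rule summable_on_comparison_test)
      fix \<alpha>
      show "(norm (c \<alpha> * complex_of_real (a \<alpha>)))\<^sup>2 \<le> ?B * ?g \<alpha>"
        unfolding power2_eq_square using le[of \<alpha>] B[of \<alpha>] by (intro mult_mono) (auto intro: order_trans infsum_nonneg)
    qed simp
  qed
  have "((\<lambda>\<alpha>. (c \<alpha> * complex_of_real (a \<alpha>)) * E \<alpha> w) has_sum 0) UNIV" for w
  proof -
    have "(c \<alpha> * complex_of_real (a \<alpha>)) * E \<alpha> w = complex_of_real (D w) * (c \<alpha> * fock_basis \<alpha> w)" for \<alpha>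
      using apos[of \<alpha>] by (simp add: E_def)
    moreover have "((\<lambda>\<alpha>. complex_of_real (D w) * (c \<alpha> * fock_basis \<alpha> w)) has_sum complex_of_real (D w) * 0) UNIV"
      using c by (intro has_sum_cmult_right) (simp add: fock_expansion_def)
    ultimately show ?thesis by (simp only: mult_zero_right)
  qed
  from E.l2_expansion_of_pointwise[OF s this] have "l2_inner gauss_measure (\<lambda>_. 0) (E \<alpha>) = c \<alpha> * complex_of_real (a \<alpha>)"
    by (rule E.l2_expansion_coeff)
  thus ?thesis using apos[of \<alpha>] by (simp add: l2_inner_def)
qed

lemma fock_expansion_unique:
  assumes "fock_expansion c f" "fock_expansion d f"
  shows "c = d"
proof -
  have "((\<lambda>\<alpha>. (c \<alpha> - d \<alpha>) * fock_basis \<alpha> z) has_sum 0) UNIV" for z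
  proof -
    have "((\<lambda>\<alpha>. c \<alpha> * fock_basis \<alpha> z + - 1 * (d \<alpha> * fock_basis \<alpha> z)) has_sum (f z + - 1 * f z)) UNIV"
      using assms by (intro has_sum_add has_sum_cmult_right) (auto simp: fock_expansion_def)
    thus ?thesis by (simp add: left_diff_distrib)
  qed
  hence "fock_expansion (\<lambda>\<alpha>. c \<alpha> - d \<alpha>) (\<lambda>_. 0)" by (simp add: fock_expansion_def)
  from fock_expansion_zero[OF this] show ?thesis by (auto simp: fun_eq_iff)
qed

lemma fock_coeff_eq: "fock_expansion c f \<Longrightarrow> fock_coeff f = c"
  unfolding fock_coeff_def using fock_expansion_unique by blast

section \<open>The mean value property for the Gaussian measure\<close>

lemma circle_mean_value:
  assumes g: "g holomorphic_on UNIV"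
  shows "(LINT t|lborel. indicator {0..1} t *\<^sub>R g (cis (2 * pi * t))) = g 0"
proof -
  have e: "circlepath 0 1 t = cis (2 * pi * t)" for t
    by (simp add: circlepath cis_conv_exp mult_ac)
  have "((\<lambda>u. g u / (u - 0)) has_contour_integral (2 * of_real pi * \<i> * g 0)) (circlepath 0 1)"
    by (rule Cauchy_integral_circlepath_simple) (auto intro: holomorphic_on_subset[OF g])
  hence "((\<lambda>t. g (circlepath 0 1 t) / (circlepath 0 1 t - 0) * vector_derivative (circlepath 0 1) (at t within {0..1})) has_integral (2 * of_real pi * \<i> * g 0)) {0..1}"
    by (simp only: has_contour_integral_def)
  hence "((\<lambda>t. (2 * of_real pi * \<i>) * g (cis (2 * pi * t))) has_integral ((2 * of_real pi * \<i>) * g 0)) {0..1}"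
  proof (rule has_integral_eq[rotated])
    fix t :: real assume t: "t \<in> {0..1}"
    have "vector_derivative (circlepath 0 1) (at t within {0..1}) = (2 * of_real pi * \<i>) * cis (2 * pi * t)"
      using t by (simp add: vector_derivative_circlepath01 cis_conv_exp mult_ac)
    thus "g (circlepath 0 1 t) / (circlepath 0 1 t - 0) * vector_derivative (circlepath 0 1) (at t within {0..1}) = (2 * of_real pi * \<i>) * g (cis (2 * pi * t))"
      unfolding e by simp
  qed
  from has_integral_mult_right[OF this, of "1 / (2 * of_real pi * \<i>)"]
  have 1: "((\<lambda>t. g (cis (2 * pi * t))) has_integral g 0) {0..1}" by simp
  have "continuous_on {0..1} (\<lambda>t. g (cis (2 * pi * t)))"
    by (rule continuous_on_compose2[OF holomorphic_on_imp_continuous_on[OF g]])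
       (auto simp: cis_conv_exp intro!: continuous_intros)
  hence "set_integrable lborel {0..1} (\<lambda>t. g (cis (2 * pi * t)))"
    by (rule borel_integrable_atLeastAtMost')
  from set_borel_integral_eq_integral(2)[OF this] show ?thesis
    using integral_unique[OF 1] by (simp add: set_lebesgue_integral_def)
qed

text \<open>The Gaussian measure is invariant under a common rotation of all coordinates. Averaging
  over the rotations and exchanging the integrals leaves, for each w, the circle mean of G on the
  complex line through w and 0, which is G 0.\<close>

lemma gauss_measure_mean_value:
  fixes G :: "complex ^ 'n \<Rightarrow> complex"
  assumes cont: "continuous_on UNIV G"
    and hol: "\<And>w. (\<lambda>t. G (t *s w)) holomorphic_on UNIV"
    and int: "integrable gauss_measure G"
  shows "(LINT w|gauss_measure. G w) = G 0"
proof -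
  define wt :: "complex ^ 'n \<Rightarrow> real" where "wt w = (\<Prod>j\<in>UNIV. gauss_weight (w $ j))" for w
  have wt0: "wt w \<ge> 0" for w unfolding wt_def by (intro prod_nonneg) (auto simp: gauss_weight_nonneg)
  have wtm [measurable]: "wt \<in> borel_measurable borel" unfolding wt_def[abs_def] by measurable
  have Gm [measurable]: "G \<in> borel_measurable borel" by (rule borel_measurable_continuous_onI[OF cont])
  have dens: "(gauss_measure :: (complex ^ 'n) measure) = density lborel (\<lambda>w. ennreal (wt w))"
    unfolding gauss_measure_density wt_def ..
  define P where "P w = wt w *\<^sub>R G w" for w
  have Pi: "integrable lborel P" unfolding P_def using int unfolding dens by (subst (asm) integrable_density) (auto simp: wt0)
  have Pm [measurable]: "P \<in> borel_measurable borel" unfolding P_def by measurable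
  define R where "R t w = cis (2 * pi * t) *s (w :: complex ^ 'n)" for t w
  have Req: "R t = (\<lambda>w. \<chi> j. cis (2 * pi * t) * w $ j)" for t by (auto simp: R_def vector_scalar_mult_def)
  have Rd: "distr lborel borel (R t) = lborel" for t
    unfolding Req by (rule distr_lborel_vec) (auto intro: lborel_complex_rotation)
  have Rcont: "continuous_on UNIV (\<lambda>p. R (fst p) (snd p))"
    unfolding R_def vector_scalar_mult_def by (auto simp: cis_conv_exp intro!: continuous_intros)
  have Rm2: "(\<lambda>p. R (fst p) (snd p)) \<in> borel_measurable (borel \<Otimes>\<^sub>M borel)"
    unfolding borel_prod by (rule borel_measurable_continuous_onI[OF Rcont])
  have Rm [measurable]: "R t \<in> borel_measurable borel" for t
    by (intro borel_measurable_continuous_onI continuous_on_compose2[OF Rcont, of UNIV "\<lambda>w. (t, w)", simplified]) (auto intro!: continuous_intros)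
  have wtR: "wt (R t w) = wt w" for t w by (simp add: wt_def R_def gauss_weight_def norm_mult)
  have PR: "P (R t w) = wt w *\<^sub>R G (R t w)" for t w by (simp add: P_def wtR)
  have PRi: "integrable lborel (\<lambda>w. P (R t w))" for t
    using Pi Rd[of t] integrable_distr_eq[of "R t" lborel borel P] by simp
  have PRn: "(LINT w|lborel. norm (P (R t w))) = (LINT w|lborel. norm (P w))" for t
    using integral_distr[of "R t" lborel borel "\<lambda>w. norm (P w)"] Rd[of t] by simp
  have PRv: "(LINT w|lborel. P (R t w)) = (LINT w|lborel. P w)" for t
    using integral_distr[of "R t" lborel borel P] Rd[of t] by simp
  define H where "H t w = indicator {0..1::real} t *\<^sub>R P (R t w)" for t w
  have PRm: "(\<lambda>p. P (R (fst p) (snd p))) \<in> borel_measurable (borel \<Otimes>\<^sub>M borel)"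
    by (rule measurable_compose[OF Rm2 Pm])
  have Hm: "(\<lambda>(t, w). H t w) \<in> borel_measurable (lborel \<Otimes>\<^sub>M lborel)"
    unfolding H_def split_beta using PRm by measurable
  have ind: "integrable lborel (\<lambda>t. indicator {0..1::real} t * c :: real)" for c
    by (intro integrable_mult_left) simp
  have Hi: "integrable (lborel \<Otimes>\<^sub>M lborel) (\<lambda>(t, w). H t w)"
  proof (rule lborel_pair.Fubini_integrable[OF Hm])
    show "integrable lborel (\<lambda>t. LINT w|lborel. norm (case (t, w) of (t, w) \<Rightarrow> H t w))"
      using ind by (simp add: H_def PRn)
    show "AE t in lborel. integrable lborel (\<lambda>w. case (t, w) of (t, w) \<Rightarrow> H t w)"
      by (simp add: H_def PRi)
  qed
  have inner: "(LINT t|lborel. H t w) = wt w *\<^sub>R G 0" for w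
  proof -
    have "(LINT t|lborel. indicator {0..1} t *\<^sub>R G (cis (2 * pi * t) *s w)) = G (0 *s w)"
      by (rule circle_mean_value[OF hol])
    hence "(LINT t|lborel. wt w *\<^sub>R (indicator {0..1} t *\<^sub>R G (R t w))) = wt w *\<^sub>R G 0"
      unfolding R_def by (simp del: scaleR_scaleR)
    thus ?thesis unfolding H_def PR by (simp add: mult.commute)
  qed
  have one: "(LINT w|lborel. wt w *\<^sub>R G 0) = G 0"
  proof -
    have "(LINT w|lborel. wt w *\<^sub>R (1::complex)) = (LINT w|(gauss_measure :: (complex ^ 'n) measure). 1)"
      unfolding dens by (subst integral_density) (auto simp: wt0)
    hence w1: "(LINT w|lborel. wt w *\<^sub>R (1::complex)) = 1" using gauss_measure_total(2) by simp
    have "(LINT w|lborel. wt w *\<^sub>R G 0) = (LINT w|lborel. (wt w *\<^sub>R 1) * G 0)" by simp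
    also have "\<dots> = (LINT w|lborel. wt w *\<^sub>R (1::complex)) * G 0" by (rule integral_mult_left_zero)
    finally show ?thesis by (simp add: w1)
  qed
  have "(LINT w|gauss_measure. G w) = (LINT w|lborel. P w)"
    unfolding dens P_def by (subst integral_density) (auto simp: wt0)
  also have "\<dots> = (LINT t|lborel. indicator {0..1::real} t *\<^sub>R (LINT w|lborel. P w))" by simp
  also have "\<dots> = (LINT t|lborel. LINT w|lborel. H t w)" by (simp add: H_def PRv)
  also have "\<dots> = (LINT w|lborel. LINT t|lborel. H t w)"
    by (rule lborel_pair.Fubini_integral[symmetric]) (use Hi in simp)
  also have "\<dots> = G 0" unfolding inner by (rule one)
  finally show ?thesis .
qed

lemma orthonormal_family_fock_ibasis: "orthonormal_family gauss_measure (fock_ibasis :: ('n::finite \<Rightarrow> nat) \<Rightarrow> _)"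
proof -
  interpret orthonormal_family gauss_measure "fock_basis :: ('n \<Rightarrow> nat) \<Rightarrow> _" by (rule orthonormal_family_fock_basis)
  have eq: "fock_ibasis \<alpha> = (\<lambda>z. \<i> ^ multi_deg \<alpha> * fock_basis \<alpha> z)" for \<alpha> :: "'n \<Rightarrow> nat" by (auto simp: fock_ibasis_eq)
  have i: "\<i> ^ k * cnj (\<i> ^ k) = 1" for k by (simp flip: power_mult_distrib)
  show ?thesis
  proof
    fix \<alpha> \<beta> :: "'n \<Rightarrow> nat"
    show "fock_ibasis \<alpha> \<in> l2 gauss_measure" unfolding eq by (rule l2_scale[OF e_l2])
    have "l2_inner gauss_measure (fock_ibasis \<alpha>) (fock_ibasis \<beta>) = \<i> ^ multi_deg \<alpha> * cnj (\<i> ^ multi_deg \<beta> * cnj (l2_inner gauss_measure (fock_basis \<alpha>) (fock_basis \<beta>)))"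
      unfolding eq l2_inner_scale_left
      by (subst l2_inner_commute, subst l2_inner_scale_left, subst (2) l2_inner_commute) simp
    thus "l2_inner gauss_measure (fock_ibasis \<alpha>) (fock_ibasis \<beta>) = (if \<alpha> = \<beta> then 1 else 0)"
      by (simp add: e_ortho i flip: complex_cnj_power)
  qed
qed


subsection \<open>Dilation invariance of the Hermite-Sobolev norms\<close>

text \<open>Separates the dependence on z: at real z the exponential is a character in x times a
  constant. This makes Bargmann transforms accessible to Fourier uniqueness.\<close>

lemma bargmann_kernel_factor:
  "bargmann_kernel c z x = bargmann_kernel c 0 x *
     exp (\<i> * complex_of_real (sqrt 2 * c) * (\<Sum>j\<in>UNIV. complex_of_real (x $ j) * z $ j) + (\<Sum>j\<in>UNIV. (z $ j)\<^sup>2) / 2)"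
proof -
  have "bargmann_kernel c z x = (\<Prod>j\<in>UNIV. (complex_of_real (sqrt c * hermite_norm 0) *
     exp (- (complex_of_real (c * x $ j))\<^sup>2 / 2)) * exp (\<i> * complex_of_real (sqrt 2 * c) * (complex_of_real (x $ j) * z $ j) + (z $ j)\<^sup>2 / 2))"
    unfolding bargmann_kernel_def
  proof (rule prod.cong[OF refl])
    fix j
    have "- (complex_of_real (c * x $ j))\<^sup>2 / 2 + complex_of_real (sqrt 2) * complex_of_real (c * x $ j) * (\<i> * z $ j) - (\<i> * z $ j)\<^sup>2 / 2
      = - (complex_of_real (c * x $ j))\<^sup>2 / 2 + (\<i> * complex_of_real (sqrt 2 * c) * (complex_of_real (x $ j) * z $ j) + (z $ j)\<^sup>2 / 2)"
      by (simp add: power_mult_distrib algebra_simps)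
    thus "complex_of_real (sqrt c * hermite_norm 0) *
         exp (- (complex_of_real (c * x $ j))\<^sup>2 / 2 + complex_of_real (sqrt 2) * complex_of_real (c * x $ j) * (\<i> * z $ j) - (\<i> * z $ j)\<^sup>2 / 2)
      = complex_of_real (sqrt c * hermite_norm 0) * exp (- (complex_of_real (c * x $ j))\<^sup>2 / 2) *
         exp (\<i> * complex_of_real (sqrt 2 * c) * (complex_of_real (x $ j) * z $ j) + (z $ j)\<^sup>2 / 2)"
      by (simp only: exp_add mult.assoc)
  qed
  also have "\<dots> = bargmann_kernel c 0 x * exp (\<Sum>j\<in>UNIV. \<i> * complex_of_real (sqrt 2 * c) * (complex_of_real (x $ j) * z $ j) + (z $ j)\<^sup>2 / 2)"
    unfolding bargmann_kernel_def prod.distrib by (simp add: exp_sum)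
  finally show ?thesis by (simp add: sum.distrib sum_distrib_left sum_divide_distrib)
qed

lemma bargmann_kernel_nonzero: "c > 0 \<Longrightarrow> bargmann_kernel c z x \<noteq> 0"
  using hermite_norm_pos[of 0] by (simp add: bargmann_kernel_def)

text \<open>If all coefficients of g vanish, so does its Bargmann transform. At real points this
  says that g times the Gaussian \<open>bargmann_kernel c 0\<close> has zero Fourier transform, and
  that Gaussian has no zeros.\<close>

lemma orthonormal_basis_hermite_dil:
  assumes c: "c > 0"
  shows "orthonormal_basis lborel (hermite_dil c :: ('n::finite \<Rightarrow> nat) \<Rightarrow> _)"
proof (rule orthonormal_basis.intro[OF orthonormal_family_hermite_dil[OF c]], unfold_locales)
  fix g :: "real ^ 'n \<Rightarrow> complex" assume g: "g \<in> l2 lborel" and z: "\<And>\<alpha>. hermite_coeff c g \<alpha> = 0"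
  have B0: "bargmann c g z = 0" for z
    using has_sum_unique[OF bargmann_transform_has_sum[OF c g, of z] has_sum_0[of UNIV]] z by simp
  let ?G = "\<lambda>x. g x * bargmann_kernel c 0 x"
  have "AE x in lborel. ?G x = 0"
  proof (rule Fourier_transform_eq_0_imp_AE_eq_0)
    show "integrable lborel ?G" by (rule l2_mult_integrable[OF g bargmann_kernel_l2[OF c]])
    fix y :: "real ^ 'n"
    \<comment> \<open>The divisor cancels the factor sqrt 2 * c in the exponent, so that y becomes
      the frequency.\<close>
    define z :: "complex ^ 'n" where "z = (\<chi> j. complex_of_real (y $ j / (sqrt 2 * c)))"
    have e: "\<i> * complex_of_real (sqrt 2 * c) * (\<Sum>j\<in>UNIV. complex_of_real (x $ j) * z $ j) = \<i> * complex_of_real (y \<bullet> x)" for x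
      using c by (simp add: z_def inner_vec_def sum_distrib_left mult_ac)
    have "g x * bargmann_kernel c z x = (?G x * exp (\<i> * complex_of_real (y \<bullet> x))) * exp ((\<Sum>j\<in>UNIV. (z $ j)\<^sup>2) / 2)" for x
      unfolding bargmann_kernel_factor[of c z x] e exp_add by simp
    hence "bargmann c g z = (LINT x|lborel. ?G x * exp (\<i> * complex_of_real (y \<bullet> x))) * exp ((\<Sum>j\<in>UNIV. (z $ j)\<^sup>2) / 2)"
      by (simp only: integral_mult_left_zero)
    hence "(LINT x|lborel. ?G x * exp (\<i> * complex_of_real (y \<bullet> x))) * exp ((\<Sum>j\<in>UNIV. (z $ j)\<^sup>2) / 2) = 0"
      by (simp only: B0)
    thus "(LINT x|lborel. ?G x * exp (\<i> * complex_of_real (y \<bullet> x))) = 0" by simp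
  qed
  thus "AE x in lborel. g x = 0" by eventually_elim (simp add: bargmann_kernel_nonzero[OF c])
qed

text \<open>Values in the extended half-line let norm inequalities be stated and composed before
  summability is known; an infinite value on the right is allowed.\<close>

definition wsum :: "('i \<Rightarrow> real) \<Rightarrow> ('i \<Rightarrow> complex) \<Rightarrow> ennreal" where
  "wsum w a = (\<integral>\<^sup>+i. ennreal (w i * (norm (a i))\<^sup>2) \<partial>count_space UNIV)"

lemma wsum_mono: "(\<And>i. w i * (norm (a i))\<^sup>2 \<le> v i * (norm (b i))\<^sup>2) \<Longrightarrow> wsum w a \<le> wsum v b"
  unfolding wsum_def by (intro nn_integral_mono ennreal_leI)

lemma wsum_finite_iff:
  fixes a :: "'i::countable \<Rightarrow> complex"
  assumes "\<And>i. w i \<ge> 0"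
  shows "wsum w a < \<infinity> \<longleftrightarrow> (\<lambda>i. w i * (norm (a i))\<^sup>2) summable_on UNIV"
proof -
  have "wsum w a < \<infinity> \<longleftrightarrow> Infinite_Set_Sum.abs_summable_on (\<lambda>i. w i * (norm (a i))\<^sup>2) UNIV"
    using assms by (simp add: wsum_def abs_summable_on_def integrable_iff_bounded)
  thus ?thesis using assms by (simp add: abs_summable_equivalent[symmetric])
qed

lemma wsum_eq_infsum:
  fixes a :: "'i::countable \<Rightarrow> complex"
  assumes w: "\<And>i. w i \<ge> 0" and s: "(\<lambda>i. w i * (norm (a i))\<^sup>2) summable_on UNIV"
  shows "wsum w a = ennreal (infsum (\<lambda>i. w i * (norm (a i))\<^sup>2) UNIV)"
proof -
  have "Infinite_Set_Sum.abs_summable_on (\<lambda>i. w i * (norm (a i))\<^sup>2) UNIV"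
    using s w by (simp add: abs_summable_equivalent[symmetric])
  thus ?thesis using w by (simp add: wsum_def nn_integral_conv_infsetsum infsetsum_infsum)
qed

section \<open>Two-step shifts and the recurrence for the change of basis\<close>

definition shift2 :: "'n \<Rightarrow> ('n \<Rightarrow> nat) \<Rightarrow> 'n \<Rightarrow> nat" where
  "shift2 j \<alpha> = \<alpha>(j := \<alpha> j + 2)"

lemma inj_shift2: "inj (shift2 j)"
proof (rule injI, rule ext)
  fix \<alpha> \<beta> :: "'a \<Rightarrow> nat" and i assume "shift2 j \<alpha> = shift2 j \<beta>"
  from fun_cong[OF this, of i] show "\<alpha> i = \<beta> i" by (cases "i = j") (auto simp: shift2_def)
qed

lemma range_shift2: "\<alpha> j \<ge> 2 \<Longrightarrow> \<alpha> \<in> range (shift2 j)"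
  by (intro image_eqI[of _ _ "\<alpha>(j := \<alpha> j - 2)"]) (auto simp: shift2_def fun_eq_iff)

lemma has_sum_shift2:
  assumes "\<And>\<alpha>. \<alpha> j < 2 \<Longrightarrow> F \<alpha> = 0"
  shows "((\<lambda>\<alpha>. F (shift2 j \<alpha>)) has_sum s) UNIV \<longleftrightarrow> (F has_sum s) UNIV"
proof -
  have "F \<alpha> = 0" if "\<alpha> \<notin> range (shift2 j)" for \<alpha>
    using assms[of \<alpha>] range_shift2[of \<alpha> j] that by linarith
  hence "(F has_sum s) UNIV \<longleftrightarrow> (F has_sum s) (range (shift2 j))"
    by (intro has_sum_cong_neutral) auto
  also have "\<dots> \<longleftrightarrow> ((F \<circ> shift2 j) has_sum s) UNIV"
    by (rule has_sum_reindex[OF inj_shift2])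
  finally show ?thesis by (simp add: comp_def)
qed

lemma nn_integral_shift2:
  assumes "\<And>\<alpha>. \<alpha> j < 2 \<Longrightarrow> F \<alpha> = 0"
  shows "(\<integral>\<^sup>+\<alpha>. F \<alpha> \<partial>count_space UNIV) = (\<integral>\<^sup>+\<alpha>. F (shift2 j \<alpha>) \<partial>count_space UNIV)"
proof -
  have "F \<alpha> = 0" if "\<alpha> \<notin> range (shift2 j)" for \<alpha>
    using assms[of \<alpha>] range_shift2[of \<alpha> j] that by linarith
  hence "(\<integral>\<^sup>+\<alpha>. F \<alpha> \<partial>count_space UNIV) = (\<integral>\<^sup>+\<alpha>. F \<alpha> \<partial>count_space (range (shift2 j)))"
    by (intro nn_integral_count_space_eq) auto
  also have "\<dots> = (\<integral>\<^sup>+\<alpha>. F (shift2 j \<alpha>) \<partial>count_space UNIV)"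
    by (rule nn_integral_bij_count_space[symmetric]) (simp add: inj_on_imp_bij_betw inj_shift2)
  finally show ?thesis .
qed

text \<open>Eigenvalue of the Hermite operator in the single direction j. The estimates are made for
  one direction at a time because the recurrence changes one index only.\<close>

definition weight1 :: "'n \<Rightarrow> ('n \<Rightarrow> nat) \<Rightarrow> real" where
  "weight1 j \<alpha> = 2 * real (\<alpha> j) + 1"

lemma weight1_ge_1: "weight1 j \<alpha> \<ge> 1"
  by (simp add: weight1_def)

lemma weight1_shift2: "weight1 j (shift2 j \<alpha>) = weight1 j \<alpha> + 4"
  by (simp add: weight1_def shift2_def)

text \<open>The two off-diagonal parts of multiplication by 2 c^2 x_j^2, acting on coefficient
  families. The square root here is zero for \<alpha> j < 2, where the truncated update would point
  to a wrong index.\<close>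

definition raise2 :: "'n \<Rightarrow> (('n \<Rightarrow> nat) \<Rightarrow> complex) \<Rightarrow> ('n \<Rightarrow> nat) \<Rightarrow> complex" where
  "raise2 j a \<alpha> = complex_of_real (sqrt (real (\<alpha> j) * real (\<alpha> j - 1))) * a (\<alpha>(j := \<alpha> j - 2))"

definition lower2 :: "'n \<Rightarrow> (('n \<Rightarrow> nat) \<Rightarrow> complex) \<Rightarrow> ('n \<Rightarrow> nat) \<Rightarrow> complex" where
  "lower2 j a \<alpha> = complex_of_real (sqrt (real (\<alpha> j + 1) * real (\<alpha> j + 2))) * a (shift2 j \<alpha>)"

lemma raise2_eq_0: "\<alpha> j < 2 \<Longrightarrow> raise2 j a \<alpha> = 0"
  by (auto simp: raise2_def less_2_cases_iff numeral_2_eq_2 less_Suc_eq)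

lemma raise2_shift2: "raise2 j a (shift2 j \<alpha>) = complex_of_real (sqrt (real (\<alpha> j + 1) * real (\<alpha> j + 2))) * a \<alpha>"
  by (simp add: raise2_def shift2_def mult.commute)

text \<open>The square root costs at most one power of the weight at the shifted index, and that
  weight is the larger one, so the constant is 1.\<close>

lemma wsum_lower2: "wsum (\<lambda>\<alpha>. weight1 j \<alpha> ^ (2 * N)) (lower2 j a) \<le> wsum (\<lambda>\<alpha>. weight1 j \<alpha> ^ (2 * Suc N)) a"
proof -
  let ?F = "\<lambda>\<alpha>. ennreal (weight1 j \<alpha> ^ (2 * Suc N) * (norm (a \<alpha>))\<^sup>2)"
  have "wsum (\<lambda>\<alpha>. weight1 j \<alpha> ^ (2 * N)) (lower2 j a) \<le> (\<integral>\<^sup>+\<alpha>. ?F (shift2 j \<alpha>) \<partial>count_space UNIV)"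
    unfolding wsum_def
  proof (intro nn_integral_mono ennreal_leI)
    fix \<alpha> :: "'a \<Rightarrow> nat"
    have "(norm (lower2 j a \<alpha>))\<^sup>2 = (real (\<alpha> j + 1) * real (\<alpha> j + 2)) * (norm (a (shift2 j \<alpha>)))\<^sup>2"
      unfolding lower2_def norm_mult power_mult_distrib norm_of_real power2_abs by simp
    also have "\<dots> \<le> weight1 j (shift2 j \<alpha>) ^ 2 * (norm (a (shift2 j \<alpha>)))\<^sup>2"
      unfolding weight1_def power2_eq_square by (intro mult_right_mono mult_mono) (auto simp: shift2_def)
    finally have 1: "(norm (lower2 j a \<alpha>))\<^sup>2 \<le> weight1 j (shift2 j \<alpha>) ^ 2 * (norm (a (shift2 j \<alpha>)))\<^sup>2" .
    have 2: "weight1 j \<alpha> ^ (2 * N) \<le> weight1 j (shift2 j \<alpha>) ^ (2 * N)"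
      using weight1_ge_1[of j \<alpha>] by (intro power_mono) (auto simp: weight1_shift2)
    have "weight1 j \<alpha> ^ (2 * N) * (norm (lower2 j a \<alpha>))\<^sup>2 \<le> weight1 j (shift2 j \<alpha>) ^ (2 * N) * (weight1 j (shift2 j \<alpha>) ^ 2 * (norm (a (shift2 j \<alpha>)))\<^sup>2)"
      using weight1_ge_1[of j \<alpha>] by (intro mult_mono 1 2) (auto simp: weight1_shift2)
    thus "weight1 j \<alpha> ^ (2 * N) * (norm (lower2 j a \<alpha>))\<^sup>2 \<le> weight1 j (shift2 j \<alpha>) ^ (2 * Suc N) * (norm (a (shift2 j \<alpha>)))\<^sup>2"
      by (simp add: power2_eq_square mult_ac)
  qed
  also have "\<dots> = (\<integral>\<^sup>+\<alpha>. ?F \<alpha> \<partial>count_space (range (shift2 j)))"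
    by (rule nn_integral_bij_count_space) (simp add: inj_on_imp_bij_betw inj_shift2)
  also have "\<dots> \<le> (\<integral>\<^sup>+\<alpha>. ?F \<alpha> \<partial>count_space UNIV)"
    by (subst nn_integral_count_space_indicator) (auto intro!: nn_integral_mono simp: indicator_def)
  finally show ?thesis by (simp add: wsum_def)
qed

text \<open>A shift by two adds 4 to the weight and so at most multiplies it by 5, whence 25^N. The
  factor 2 comes from (k+1)(k+2) \<le> 2 (2k+1)^2.\<close>

lemma wsum_raise2: "wsum (\<lambda>\<alpha>. weight1 j \<alpha> ^ (2 * N)) (raise2 j a) \<le> ennreal (2 * 25 ^ N) * wsum (\<lambda>\<alpha>. weight1 j \<alpha> ^ (2 * Suc N)) a"
proof -
  have "wsum (\<lambda>\<alpha>. weight1 j \<alpha> ^ (2 * N)) (raise2 j a) = (\<integral>\<^sup>+\<alpha>. ennreal (weight1 j (shift2 j \<alpha>) ^ (2 * N) * (norm (raise2 j a (shift2 j \<alpha>)))\<^sup>2) \<partial>count_space UNIV)"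
    unfolding wsum_def by (rule nn_integral_shift2) (simp add: raise2_eq_0)
  also have "\<dots> \<le> (\<integral>\<^sup>+\<alpha>. ennreal (2 * 25 ^ N) * ennreal (weight1 j \<alpha> ^ (2 * Suc N) * (norm (a \<alpha>))\<^sup>2) \<partial>count_space UNIV)"
  proof (rule nn_integral_mono)
    fix \<alpha> :: "'a \<Rightarrow> nat"
    have "(norm (raise2 j a (shift2 j \<alpha>)))\<^sup>2 = (real (\<alpha> j + 1) * real (\<alpha> j + 2)) * (norm (a \<alpha>))\<^sup>2"
      unfolding raise2_shift2 norm_mult power_mult_distrib norm_of_real power2_abs by simp
    also have "\<dots> \<le> (2 * weight1 j \<alpha> ^ 2) * (norm (a \<alpha>))\<^sup>2"
    proof (rule mult_right_mono)
      have "real (\<alpha> j + 1) * real (\<alpha> j + 2) \<le> weight1 j \<alpha> * (2 * weight1 j \<alpha>)"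
        unfolding weight1_def by (intro mult_mono) auto
      thus "real (\<alpha> j + 1) * real (\<alpha> j + 2) \<le> 2 * weight1 j \<alpha> ^ 2" by (simp add: power2_eq_square)
    qed simp
    finally have 1: "(norm (raise2 j a (shift2 j \<alpha>)))\<^sup>2 \<le> (2 * weight1 j \<alpha> ^ 2) * (norm (a \<alpha>))\<^sup>2" .
    have "weight1 j (shift2 j \<alpha>) ^ (2 * N) \<le> (5 * weight1 j \<alpha>) ^ (2 * N)"
      using weight1_ge_1[of j \<alpha>] by (intro power_mono) (auto simp: weight1_shift2)
    also have "\<dots> = 25 ^ N * weight1 j \<alpha> ^ (2 * N)" by (simp add: power_mult_distrib power_mult)
    finally have 2: "weight1 j (shift2 j \<alpha>) ^ (2 * N) \<le> 25 ^ N * weight1 j \<alpha> ^ (2 * N)" .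
    have "weight1 j (shift2 j \<alpha>) ^ (2 * N) * (norm (raise2 j a (shift2 j \<alpha>)))\<^sup>2 \<le> (25 ^ N * weight1 j \<alpha> ^ (2 * N)) * ((2 * weight1 j \<alpha> ^ 2) * (norm (a \<alpha>))\<^sup>2)"
      using weight1_ge_1[of j \<alpha>] by (intro mult_mono 1 2) auto
    also have "\<dots> = (2 * 25 ^ N) * (weight1 j \<alpha> ^ (2 * Suc N) * (norm (a \<alpha>))\<^sup>2)" by (simp add: power2_eq_square mult_ac)
    finally show "ennreal (weight1 j (shift2 j \<alpha>) ^ (2 * N) * (norm (raise2 j a (shift2 j \<alpha>)))\<^sup>2) \<le> ennreal (2 * 25 ^ N) * ennreal (weight1 j \<alpha> ^ (2 * Suc N) * (norm (a \<alpha>))\<^sup>2)"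
      by (subst ennreal_mult'[symmetric]) (auto intro: ennreal_leI)
  qed
  also have "\<dots> = ennreal (2 * 25 ^ N) * wsum (\<lambda>\<alpha>. weight1 j \<alpha> ^ (2 * Suc N)) a"
    unfolding wsum_def by (rule nn_integral_cmult) simp
  finally show ?thesis .
qed

lemma wsum_add3:
  assumes w: "\<And>i. w i \<ge> 0"
  shows "wsum w (\<lambda>i. p * a i + q * (b i + c i)) \<le> ennreal (3 * (p\<^sup>2 + q\<^sup>2)) * (wsum w a + (wsum w b + wsum w c))" (is "?L \<le> ?R")
proof -
  let ?w = "\<lambda>a i. ennreal (w i * (norm (a i))\<^sup>2)"
  have "?L \<le> (\<integral>\<^sup>+i. ennreal (3 * (p\<^sup>2 + q\<^sup>2)) * (?w a i + (?w b i + ?w c i)) \<partial>count_space UNIV)"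
    unfolding wsum_def
  proof (rule nn_integral_mono)
    fix i
    let ?x = "complex_of_real p * a i" and ?y = "complex_of_real q * b i" and ?z = "complex_of_real q * c i"
    have "norm (complex_of_real p * a i + complex_of_real q * (b i + c i)) \<le> norm ?x + norm ?y + norm ?z"
      using norm_triangle_ineq[of ?x "?y + ?z"] norm_triangle_ineq[of ?y ?z] by (simp add: distrib_left)
    hence "(norm (complex_of_real p * a i + complex_of_real q * (b i + c i)))\<^sup>2 \<le> (norm ?x + norm ?y + norm ?z)\<^sup>2"
      by (intro power_mono) auto
    also have "\<dots> \<le> 3 * ((norm ?x)\<^sup>2 + (norm ?y)\<^sup>2 + (norm ?z)\<^sup>2)"
    proof -
      have "(u + v + t)\<^sup>2 \<le> 3 * (u\<^sup>2 + v\<^sup>2 + t\<^sup>2)" for u v t :: real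
        using zero_le_power2[of "u - v"] zero_le_power2[of "u - t"] zero_le_power2[of "v - t"]
        by (simp add: power2_eq_square algebra_simps)
      thus ?thesis by blast
    qed
    also have "\<dots> \<le> 3 * ((p\<^sup>2 + q\<^sup>2) * (norm (a i))\<^sup>2 + (p\<^sup>2 + q\<^sup>2) * (norm (b i))\<^sup>2 + (p\<^sup>2 + q\<^sup>2) * (norm (c i))\<^sup>2)"
      unfolding norm_mult norm_of_real power_mult_distrib power2_abs by (intro mult_left_mono add_mono mult_right_mono) auto
    also have "\<dots> = (3 * (p\<^sup>2 + q\<^sup>2)) * ((norm (a i))\<^sup>2 + ((norm (b i))\<^sup>2 + (norm (c i))\<^sup>2))" by (simp add: algebra_simps)
    finally have "w i * (norm (complex_of_real p * a i + complex_of_real q * (b i + c i)))\<^sup>2 \<le> w i * ((3 * (p\<^sup>2 + q\<^sup>2)) * ((norm (a i))\<^sup>2 + ((norm (b i))\<^sup>2 + (norm (c i))\<^sup>2)))"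
      by (intro mult_left_mono w)
    also have "\<dots> = (3 * (p\<^sup>2 + q\<^sup>2)) * (w i * (norm (a i))\<^sup>2 + (w i * (norm (b i))\<^sup>2 + w i * (norm (c i))\<^sup>2))"
      by (simp add: algebra_simps)
    finally show "ennreal (w i * (norm (complex_of_real p * a i + complex_of_real q * (b i + c i)))\<^sup>2) \<le> ennreal (3 * (p\<^sup>2 + q\<^sup>2)) * (?w a i + (?w b i + ?w c i))"
      using w[of i] by (simp add: ennreal_mult'[symmetric] ennreal_plus[symmetric] ennreal_leI del: ennreal_plus)
  qed
  also have "\<dots> = ?R" unfolding wsum_def by (simp add: nn_integral_cmult nn_integral_add)
  finally show ?thesis .
qed

lemma l2_inner_add_left:
  assumes "f \<in> l2 M" "g \<in> l2 M" "h \<in> l2 M"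
  shows "l2_inner M (\<lambda>x. f x + g x) h = l2_inner M f h + l2_inner M g h"
  unfolding l2_inner_def using assms by (simp add: distrib_right l2_inner_integrable)

definition dilation_matrix :: "real \<Rightarrow> real \<Rightarrow> ('n::finite \<Rightarrow> nat) \<Rightarrow> ('n \<Rightarrow> nat) \<Rightarrow> complex" where
  "dilation_matrix c d \<alpha> \<beta> = l2_inner lborel (hermite_dil c \<alpha>) (hermite_dil d \<beta>)"

lemma dilation_matrix_eq:
  "c > 0 \<Longrightarrow> d > 0 \<Longrightarrow> dilation_matrix c d \<alpha> \<beta> = complex_of_real (\<Prod>j\<in>UNIV. dilation_coeff c d (\<alpha> j) (\<beta> j))"
  by (simp add: dilation_matrix_def l2_inner_def integral_hermite_dil_mult)

text \<open>The matrix entry is a product over the coordinates, so the one-dimensional recurrence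
  acts on factor j and the remaining factors are carried along.\<close>

lemma dilation_matrix_rec:
  fixes \<alpha> \<beta> :: "'n::finite \<Rightarrow> nat"
  assumes c: "c > 0" and d: "d > 0"
  defines "b \<equiv> (d^4 - c^4) / (2 * c\<^sup>2 * d\<^sup>2)"
  shows "complex_of_real (weight1 j \<beta>) * dilation_matrix c d \<alpha> \<beta> =
    complex_of_real (c\<^sup>2 / d\<^sup>2 + b) * (complex_of_real (weight1 j \<alpha>) * dilation_matrix c d \<alpha> \<beta>)
    + complex_of_real b * (complex_of_real (sqrt (real (\<alpha> j) * real (\<alpha> j - 1))) * dilation_matrix c d (\<alpha>(j := \<alpha> j - 2)) \<beta>
      + complex_of_real (sqrt (real (\<alpha> j + 1) * real (\<alpha> j + 2))) * dilation_matrix c d (shift2 j \<alpha>) \<beta>)"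
proof -
  define r where "r = (\<Prod>i\<in>UNIV - {j}. dilation_coeff c d (\<alpha> i) (\<beta> i))"
  have upd: "dilation_matrix c d (\<alpha>(j := k)) \<beta> = complex_of_real (dilation_coeff c d k (\<beta> j) * r)" for k
  proof -
    have "(\<Prod>i\<in>UNIV. dilation_coeff c d ((\<alpha>(j := k)) i) (\<beta> i)) = dilation_coeff c d k (\<beta> j) * (\<Prod>i\<in>UNIV - {j}. dilation_coeff c d ((\<alpha>(j := k)) i) (\<beta> i))"
      by (subst prod.remove[of UNIV j]) auto
    also have "(\<Prod>i\<in>UNIV - {j}. dilation_coeff c d ((\<alpha>(j := k)) i) (\<beta> i)) = r"
      unfolding r_def by (intro prod.cong) auto
    finally show ?thesis by (simp only: dilation_matrix_eq[OF c d])
  qed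
  have self: "dilation_matrix c d \<alpha> \<beta> = complex_of_real (dilation_coeff c d (\<alpha> j) (\<beta> j) * r)"
    using upd[of "\<alpha> j"] by simp
  have "weight1 j \<beta> * dilation_coeff c d (\<alpha> j) (\<beta> j) * r = ((c\<^sup>2 / d\<^sup>2 + b) * weight1 j \<alpha> * dilation_coeff c d (\<alpha> j) (\<beta> j)
      + b * (sqrt (real (\<alpha> j + 1) * real (\<alpha> j + 2)) * dilation_coeff c d (\<alpha> j + 2) (\<beta> j)
        + sqrt (real (\<alpha> j) * real (\<alpha> j - 1)) * dilation_coeff c d (\<alpha> j - 2) (\<beta> j))) * r"
    unfolding weight1_def b_def using dilation_coeff_rec[OF c d, of "\<beta> j" "\<alpha> j"] by simp
  also have "\<dots> = (c\<^sup>2 / d\<^sup>2 + b) * (weight1 j \<alpha> * (dilation_coeff c d (\<alpha> j) (\<beta> j) * r))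
      + b * (sqrt (real (\<alpha> j) * real (\<alpha> j - 1)) * (dilation_coeff c d (\<alpha> j - 2) (\<beta> j) * r)
        + sqrt (real (\<alpha> j + 1) * real (\<alpha> j + 2)) * (dilation_coeff c d (\<alpha> j + 2) (\<beta> j) * r))"
    by (simp add: algebra_simps)
  finally have "complex_of_real (weight1 j \<beta> * (dilation_coeff c d (\<alpha> j) (\<beta> j) * r)) = complex_of_real ((c\<^sup>2 / d\<^sup>2 + b) * (weight1 j \<alpha> * (dilation_coeff c d (\<alpha> j) (\<beta> j) * r))
      + b * (sqrt (real (\<alpha> j) * real (\<alpha> j - 1)) * (dilation_coeff c d (\<alpha> j - 2) (\<beta> j) * r)
        + sqrt (real (\<alpha> j + 1) * real (\<alpha> j + 2)) * (dilation_coeff c d (\<alpha> j + 2) (\<beta> j) * r)))"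
    by (simp only: mult.assoc)
  thus ?thesis unfolding shift2_def upd self by (simp only: of_real_mult of_real_add)
qed

lemma coeff_has_sum_dilation:
  assumes c: "c > 0" and d: "d > 0" and f: "orthonormal_family.l2_expansion lborel (hermite_dil c) a f"
  shows "((\<lambda>\<alpha>. a \<alpha> * dilation_matrix c d \<alpha> \<beta>) has_sum hermite_coeff d f \<beta>) UNIV"
  unfolding dilation_matrix_def
  by (rule orthonormal_family.l2_expansion_inner[OF orthonormal_family_hermite_dil[OF c] f
        orthonormal_family.e_l2[OF orthonormal_family_hermite_dil[OF d]]])

text \<open>Formally g is d^(-2) times the operator -u'' + d^4 x^2 u in direction j, applied to f.
  No derivative is taken: g is assembled from its coefficients in the basis of c, and the matrix
  recurrence shows that its coefficients in the basis of d are those of f times the weight.\<close>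

lemma dilation_step:
  fixes f :: "real ^ 'n \<Rightarrow> complex"
  assumes c: "c > 0" and d: "d > 0" and f: "f \<in> l2 lborel"
  defines "b \<equiv> (d^4 - c^4) / (2 * c\<^sup>2 * d\<^sup>2)"
  defines "a \<equiv> \<lambda>\<alpha>. hermite_coeff c f \<alpha>"
  assumes fin: "wsum (\<lambda>\<alpha>. weight1 j \<alpha> ^ 2) a < \<infinity>"
  obtains g where "g \<in> l2 lborel"
    "\<And>\<beta>. hermite_coeff d g \<beta> = complex_of_real (weight1 j \<beta>) * hermite_coeff d f \<beta>"
    "\<And>\<alpha>. hermite_coeff c g \<alpha> = complex_of_real (c\<^sup>2 / d\<^sup>2 + b) * (complex_of_real (weight1 j \<alpha>) * a \<alpha>)
      + complex_of_real b * (lower2 j a \<alpha> + raise2 j a \<alpha>)"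
proof -
  interpret C: orthonormal_basis lborel "hermite_dil c :: ('n \<Rightarrow> nat) \<Rightarrow> _" by (rule orthonormal_basis_hermite_dil[OF c])
  interpret D: orthonormal_basis lborel "hermite_dil d :: ('n \<Rightarrow> nat) \<Rightarrow> _" by (rule orthonormal_basis_hermite_dil[OF d])
  have rf: "\<exists>h. C.l2_expansion e h" if "wsum (\<lambda>\<alpha>. weight1 j \<alpha> ^ (2 * 0)) e < \<infinity>" for e :: "('n \<Rightarrow> nat) \<Rightarrow> complex"
  proof -
    have "(\<lambda>\<alpha>. (norm (e \<alpha>))\<^sup>2) summable_on UNIV"
      using that wsum_finite_iff[of "\<lambda>_. 1" e] by simp
    thus ?thesis using C.Riesz_Fischer by blast
  qed
  have "wsum (\<lambda>\<alpha>. weight1 j \<alpha> ^ (2 * 0)) (\<lambda>\<alpha>. complex_of_real (weight1 j \<alpha>) * a \<alpha>) = wsum (\<lambda>\<alpha>. weight1 j \<alpha> ^ 2) a"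
    unfolding wsum_def by (simp add: norm_mult power_mult_distrib)
  then obtain f1 where f1: "C.l2_expansion (\<lambda>\<alpha>. complex_of_real (weight1 j \<alpha>) * a \<alpha>) f1"
    using rf[of "\<lambda>\<alpha>. complex_of_real (weight1 j \<alpha>) * a \<alpha>"] fin by auto
  have "wsum (\<lambda>\<alpha>. weight1 j \<alpha> ^ (2 * 0)) (lower2 j a) \<le> wsum (\<lambda>\<alpha>. weight1 j \<alpha> ^ 2) a"
    using wsum_lower2[of j 0 a] by (simp add: numeral_2_eq_2)
  then obtain f2 where f2: "C.l2_expansion (lower2 j a) f2"
    using rf[of "lower2 j a"] fin le_less_trans by blast
  have "wsum (\<lambda>\<alpha>. weight1 j \<alpha> ^ (2 * 0)) (raise2 j a) \<le> ennreal 2 * wsum (\<lambda>\<alpha>. weight1 j \<alpha> ^ 2) a"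
    using wsum_raise2[of j 0 a] by (simp add: numeral_2_eq_2)
  also have "\<dots> < \<infinity>" using fin by (simp add: ennreal_mult_less_top)
  finally obtain f3 where f3: "C.l2_expansion (raise2 j a) f3" using rf by blast
  have l: "f1 \<in> l2 lborel" "f2 \<in> l2 lborel" "f3 \<in> l2 lborel"
    using f1 f2 f3 C.l2_expansion_l2 by auto
  define A where "A = complex_of_real (c\<^sup>2 / d\<^sup>2 + b)"
  define B where "B = complex_of_real b"
  define g where "g x = A * f1 x + B * (f2 x + f3 x)" for x
  have g: "g \<in> l2 lborel" unfolding g_def by (intro l2_add l2_scale l)
  have gi: "l2_inner lborel g h = A * l2_inner lborel f1 h + B * (l2_inner lborel f2 h + l2_inner lborel f3 h)" if h: "h \<in> l2 lborel" for h
    unfolding g_def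
    by (subst l2_inner_add_left) (auto intro!: l2_add l2_scale l h simp: l2_inner_scale_left l2_inner_add_left[OF l(2,3) h])
  let ?T = "dilation_matrix c d"
  have 2: "hermite_coeff d g \<beta> = complex_of_real (weight1 j \<beta>) * hermite_coeff d f \<beta>" for \<beta>
  proof -
    have s0: "((\<lambda>\<alpha>. a \<alpha> * ?T \<alpha> \<beta>) has_sum hermite_coeff d f \<beta>) UNIV"
      unfolding a_def by (rule coeff_has_sum_dilation[OF c d C.l2_expansion_self[OF f]])
    have s1: "((\<lambda>\<alpha>. complex_of_real (weight1 j \<alpha>) * a \<alpha> * ?T \<alpha> \<beta>) has_sum hermite_coeff d f1 \<beta>) UNIV"
      by (rule coeff_has_sum_dilation[OF c d f1])
    \<comment> \<open>Reindexing the series transposes the shift, moving it from the coefficients to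
      the matrix entries where the recurrence applies. The added terms with \<alpha> j < 2 are
      zero.\<close>
    have s2: "((\<lambda>\<alpha>. a \<alpha> * (complex_of_real (sqrt (real (\<alpha> j) * real (\<alpha> j - 1))) * ?T (\<alpha>(j := \<alpha> j - 2)) \<beta>)) has_sum hermite_coeff d f2 \<beta>) UNIV"
    proof (subst has_sum_shift2[symmetric, of j])
      fix \<alpha> :: "'n \<Rightarrow> nat" assume "\<alpha> j < 2"
      thus "a \<alpha> * (complex_of_real (sqrt (real (\<alpha> j) * real (\<alpha> j - 1))) * ?T (\<alpha>(j := \<alpha> j - 2)) \<beta>) = 0"
        by (auto simp: numeral_2_eq_2 less_Suc_eq)
    next
      have "a (shift2 j \<alpha>) * (complex_of_real (sqrt (real (shift2 j \<alpha> j) * real (shift2 j \<alpha> j - 1))) * ?T ((shift2 j \<alpha>)(j := shift2 j \<alpha> j - 2)) \<beta>)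
          = lower2 j a \<alpha> * ?T \<alpha> \<beta>" for \<alpha>
        by (simp add: lower2_def shift2_def mult_ac)
      thus "((\<lambda>\<alpha>. a (shift2 j \<alpha>) * (complex_of_real (sqrt (real (shift2 j \<alpha> j) * real (shift2 j \<alpha> j - 1))) * ?T ((shift2 j \<alpha>)(j := shift2 j \<alpha> j - 2)) \<beta>)) has_sum hermite_coeff d f2 \<beta>) UNIV"
        using coeff_has_sum_dilation[OF c d f2, of \<beta>] by (simp only:)
    qed
    have s3: "((\<lambda>\<alpha>. a \<alpha> * (complex_of_real (sqrt (real (\<alpha> j + 1) * real (\<alpha> j + 2))) * ?T (shift2 j \<alpha>) \<beta>)) has_sum hermite_coeff d f3 \<beta>) UNIV"
    proof -
      have "((\<lambda>\<alpha>. raise2 j a (shift2 j \<alpha>) * ?T (shift2 j \<alpha>) \<beta>) has_sum hermite_coeff d f3 \<beta>) UNIV"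
        by (subst has_sum_shift2[of j "\<lambda>\<alpha>. raise2 j a \<alpha> * ?T \<alpha> \<beta>"]) (auto simp: raise2_eq_0 coeff_has_sum_dilation[OF c d f3])
      thus ?thesis unfolding raise2_shift2 by (simp only: mult_ac)
    qed
    have "((\<lambda>\<alpha>. A * (complex_of_real (weight1 j \<alpha>) * a \<alpha> * ?T \<alpha> \<beta>) +
        B * (a \<alpha> * (complex_of_real (sqrt (real (\<alpha> j) * real (\<alpha> j - 1))) * ?T (\<alpha>(j := \<alpha> j - 2)) \<beta>)
          + a \<alpha> * (complex_of_real (sqrt (real (\<alpha> j + 1) * real (\<alpha> j + 2))) * ?T (shift2 j \<alpha>) \<beta>)))
        has_sum (A * hermite_coeff d f1 \<beta> + B * (hermite_coeff d f2 \<beta> + hermite_coeff d f3 \<beta>))) UNIV"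
      by (intro has_sum_add has_sum_cmult_right s1 s2 s3)
    moreover have "A * (complex_of_real (weight1 j \<alpha>) * a \<alpha> * ?T \<alpha> \<beta>) +
        B * (a \<alpha> * (complex_of_real (sqrt (real (\<alpha> j) * real (\<alpha> j - 1))) * ?T (\<alpha>(j := \<alpha> j - 2)) \<beta>)
          + a \<alpha> * (complex_of_real (sqrt (real (\<alpha> j + 1) * real (\<alpha> j + 2))) * ?T (shift2 j \<alpha>) \<beta>))
        = complex_of_real (weight1 j \<beta>) * (a \<alpha> * ?T \<alpha> \<beta>)" for \<alpha>
    proof -
      have "complex_of_real (weight1 j \<beta>) * (a \<alpha> * ?T \<alpha> \<beta>) = a \<alpha> * (complex_of_real (weight1 j \<beta>) * ?T \<alpha> \<beta>)" by simp
      also have "complex_of_real (weight1 j \<beta>) * ?T \<alpha> \<beta> = A * (complex_of_real (weight1 j \<alpha>) * ?T \<alpha> \<beta>) + B * (complex_of_real (sqrt (real (\<alpha> j) * real (\<alpha> j - 1))) * ?T (\<alpha>(j := \<alpha> j - 2)) \<beta>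
          + complex_of_real (sqrt (real (\<alpha> j + 1) * real (\<alpha> j + 2))) * ?T (shift2 j \<alpha>) \<beta>)"
        unfolding A_def B_def b_def by (rule dilation_matrix_rec[OF c d])
      finally show ?thesis by (simp add: distrib_left mult_ac)
    qed
    ultimately have "((\<lambda>\<alpha>. complex_of_real (weight1 j \<beta>) * (a \<alpha> * ?T \<alpha> \<beta>)) has_sum hermite_coeff d g \<beta>) UNIV"
      unfolding gi[OF D.e_l2] by (simp only:)
    moreover have "((\<lambda>\<alpha>. complex_of_real (weight1 j \<beta>) * (a \<alpha> * ?T \<alpha> \<beta>)) has_sum complex_of_real (weight1 j \<beta>) * hermite_coeff d f \<beta>) UNIV"
      by (intro has_sum_cmult_right s0)
    ultimately show ?thesis by (rule has_sum_unique)
  qed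
  have 3: "hermite_coeff c g \<alpha> = A * (complex_of_real (weight1 j \<alpha>) * a \<alpha>) + B * (lower2 j a \<alpha> + raise2 j a \<alpha>)" for \<alpha>
    unfolding gi[OF C.e_l2] C.l2_expansion_coeff[OF f1] C.l2_expansion_coeff[OF f2] C.l2_expansion_coeff[OF f3] ..
  show ?thesis using that[OF g 2 3[unfolded A_def B_def]] .
qed

lemma wsum_one_hermite:
  assumes c: "c > 0" and f: "f \<in> l2 lborel"
  shows "wsum (\<lambda>_. 1) (hermite_coeff c f) = ennreal (l2_sq lborel f)"
  using orthonormal_basis.Parseval[OF orthonormal_basis_hermite_dil[OF c] f]
  by (subst wsum_eq_infsum) (auto simp: has_sum_imp_summable infsumI)

text \<open>Induction with \<open>dilation_step\<close>: in the basis of d one weight factor is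
  absorbed into g, to which the induction hypothesis applies; in the basis of c the coefficients of
  g are controlled by one more weight factor. The case N = 0 is Parseval's identity for both
  bases.\<close>

lemma dilation_integer_weight:
  assumes c: "c > 0" and d: "d > 0"
  shows "\<exists>K\<ge>1. \<forall>f\<in>l2 lborel. wsum (\<lambda>\<alpha>. weight1 j \<alpha> ^ (2 * N)) (hermite_coeff d f)
     \<le> ennreal K * wsum (\<lambda>\<alpha>. weight1 (j :: 'n::finite) \<alpha> ^ (2 * N)) (hermite_coeff c f)"
proof (induction N)
  case 0
  show ?case by (intro exI[of _ 1]) (simp add: wsum_one_hermite[OF c] wsum_one_hermite[OF d])
next
  case (Suc N)
  let ?w = "\<lambda>N \<alpha>. weight1 j \<alpha> ^ (2 * N)"
  obtain K where K: "K \<ge> 1" and IH: "\<And>f. f \<in> l2 lborel \<Longrightarrow> wsum (?w N) (hermite_coeff d f)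
     \<le> ennreal K * wsum (?w N) (hermite_coeff c f)" using Suc by blast
  define b where "b = (d^4 - c^4) / (2 * c\<^sup>2 * d\<^sup>2)"
  define A where "A = c\<^sup>2 / d\<^sup>2 + b"
  define L where "L = 3 * (A\<^sup>2 + b\<^sup>2) * (2 + 2 * 25 ^ N)"
  have L: "L \<ge> 0" unfolding L_def by (intro mult_nonneg_nonneg add_nonneg_nonneg) auto
  \<comment> \<open>The summand 1 keeps the constant at least 1; in particular it is positive when
    the right-hand sum is infinite.\<close>
  have "wsum (?w (Suc N)) (hermite_coeff d f) \<le> ennreal (K * L + 1) * wsum (?w (Suc N)) (hermite_coeff c f)"
    if f: "f \<in> l2 lborel" for f
  proof (cases "wsum (?w (Suc N)) (hermite_coeff c f) = \<infinity>")
    case True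
    thus ?thesis using K L by (simp add: ennreal_mult_top)
  next
    case False
    let ?a = "\<lambda>\<alpha>. hermite_coeff c f \<alpha>"
    have "wsum (\<lambda>\<alpha>. weight1 j \<alpha> ^ 2) ?a \<le> wsum (?w (Suc N)) ?a"
      by (intro wsum_mono mult_right_mono power_increasing weight1_ge_1) auto
    also have "\<dots> < \<infinity>" using False by (simp add: less_top)
    finally have fin: "wsum (\<lambda>\<alpha>. weight1 j \<alpha> ^ 2) ?a < \<infinity>" .
    obtain g where g: "g \<in> l2 lborel"
      and gd: "\<And>\<beta>. hermite_coeff d g \<beta> = complex_of_real (weight1 j \<beta>) * hermite_coeff d f \<beta>"
      and gc: "\<And>\<alpha>. hermite_coeff c g \<alpha> = complex_of_real A * (complex_of_real (weight1 j \<alpha>) * ?a \<alpha>)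
        + complex_of_real b * (lower2 j ?a \<alpha> + raise2 j ?a \<alpha>)"
      unfolding A_def b_def by (rule dilation_step[OF c d f fin]) blast
    have w1: "wsum (?w N) (\<lambda>\<alpha>. complex_of_real (weight1 j \<alpha>) * e \<alpha>) = wsum (?w (Suc N)) e" for e
      unfolding wsum_def norm_mult power_mult_distrib norm_of_real power2_abs by (simp add: mult_ac power2_eq_square)
    have "wsum (?w (Suc N)) (hermite_coeff d f) = wsum (?w N) (hermite_coeff d g)"
      unfolding gd w1 ..
    also have "\<dots> \<le> ennreal K * wsum (?w N) (hermite_coeff c g)" by (rule IH[OF g])
    also have "wsum (?w N) (hermite_coeff c g) \<le> ennreal (3 * (A\<^sup>2 + b\<^sup>2)) * (wsum (?w N) (\<lambda>\<alpha>. complex_of_real (weight1 j \<alpha>) * ?a \<alpha>) + (wsum (?w N) (lower2 j ?a) + wsum (?w N) (raise2 j ?a)))"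
      unfolding gc by (rule wsum_add3) (use weight1_ge_1[of j] in \<open>auto intro!: zero_le_power order_trans[OF zero_le_one]\<close>)
    also have "\<dots> \<le> ennreal (3 * (A\<^sup>2 + b\<^sup>2)) * (wsum (?w (Suc N)) ?a + (wsum (?w (Suc N)) ?a + ennreal (2 * 25 ^ N) * wsum (?w (Suc N)) ?a))"
      unfolding w1 by (intro mult_left_mono add_mono order_refl wsum_lower2 wsum_raise2) auto
    also have "\<dots> = ennreal L * wsum (?w (Suc N)) ?a"
    proof -
      have "wsum (?w (Suc N)) ?a + (wsum (?w (Suc N)) ?a + ennreal (2 * 25 ^ N) * wsum (?w (Suc N)) ?a) = (1 + (1 + ennreal (2 * 25 ^ N))) * wsum (?w (Suc N)) ?a"
        by (simp add: distrib_right)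
      also have "1 + (1 + ennreal (2 * 25 ^ N)) = ennreal (2 + 2 * 25 ^ N)"
        by (simp add: ennreal_plus[symmetric] ennreal_1[symmetric] del: ennreal_plus ennreal_1)
      finally show ?thesis unfolding L_def by (simp add: ennreal_mult' mult.assoc)
    qed
    also have "ennreal K * (ennreal L * wsum (?w (Suc N)) ?a) = ennreal (K * L) * wsum (?w (Suc N)) ?a"
      using K by (simp add: ennreal_mult' mult.assoc)
    also have "\<dots> \<le> ennreal (K * L + 1) * wsum (?w (Suc N)) ?a"
      by (intro mult_right_mono ennreal_leI) auto
    finally show ?thesis by (simp add: mult_left_mono)
  qed
  thus ?case using K L by (intro exI[of _ "K * L + 1"]) auto
qed

text \<open>Interpolation between \<open>\<ell>\<^sup>2\<close> and \<open>\<ell>\<^sup>2(W)\<close> by the \<open>K\<close>-functional: the minimum of \<open>|x|\<^sup>2 + t W |y|\<^sup>2\<close>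
  under \<open>x + y = c\<close> is \<open>t W / (1 + t W) |c|\<^sup>2\<close>.\<close>

lemma K_functional_le:
  fixes x y :: complex
  assumes p: "p \<ge> 0"
  shows "p / (1 + p) * (norm (x + y))\<^sup>2 \<le> (norm x)\<^sup>2 + p * (norm y)\<^sup>2"
proof -
  \<comment> \<open>The defect in the inequality is this square; equality holds for x = p y.\<close>
  have "0 \<le> (norm (x - p *\<^sub>R y))\<^sup>2" by simp
  also have "\<dots> = (1 + p) * ((norm x)\<^sup>2 + p * (norm y)\<^sup>2) - p * (norm (x + y))\<^sup>2"
    unfolding cmod_power2 by (simp add: power2_eq_square algebra_simps)
  finally show ?thesis using p by (simp add: field_simps)
qed

text \<open>Split f = g + h optimally for the basis of c, where the K-functional is then attained
  with equality. In the basis of d the same splitting is merely admissible and gives an upper bound;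
  the part g is compared by Parseval and the part h by \<open>bound\<close>.\<close>

lemma K_functional_step:
  fixes f :: "real ^ 'n \<Rightarrow> complex" and W :: "('n \<Rightarrow> nat) \<Rightarrow> real"
  assumes c: "c > 0" and d: "d > 0" and W: "\<And>\<alpha>. W \<alpha> \<ge> 1" and K: "K \<ge> 1"
    and bound: "\<And>f. f \<in> l2 lborel \<Longrightarrow> wsum W (hermite_coeff d f) \<le> ennreal K * wsum W (hermite_coeff c f)"
    and f: "f \<in> l2 lborel" and t: "t > 0"
  shows "wsum (\<lambda>\<alpha>. t * W \<alpha> / (1 + t * W \<alpha>)) (hermite_coeff d f)
    \<le> ennreal K * wsum (\<lambda>\<alpha>. t * W \<alpha> / (1 + t * W \<alpha>)) (hermite_coeff c f)"
proof -
  interpret C: orthonormal_basis lborel "hermite_dil c :: ('n \<Rightarrow> nat) \<Rightarrow> _" by (rule orthonormal_basis_hermite_dil[OF c])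
  interpret D: orthonormal_basis lborel "hermite_dil d :: ('n \<Rightarrow> nat) \<Rightarrow> _" by (rule orthonormal_basis_hermite_dil[OF d])
  let ?a = "\<lambda>f \<alpha>. hermite_coeff c f \<alpha>" and ?b = "\<lambda>f \<alpha>. hermite_coeff d f \<alpha>"
  define p where "p \<alpha> = t * W \<alpha>" for \<alpha>
  have p: "p \<alpha> > 0" for \<alpha> unfolding p_def using t W[of \<alpha>] by simp
  have "(\<lambda>\<alpha>. (norm (?a f \<alpha> / complex_of_real (1 + p \<alpha>)))\<^sup>2) summable_on UNIV"
  proof (rule summable_on_comparison_test[OF C.bessel_summable[OF f]])
    fix \<alpha>
    have "norm (?a f \<alpha>) / (1 + p \<alpha>) \<le> norm (?a f \<alpha>) / 1" using p[of \<alpha>] by (intro divide_left_mono) auto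
    moreover have "norm (?a f \<alpha> / complex_of_real (1 + p \<alpha>)) = norm (?a f \<alpha>) / (1 + p \<alpha>)"
      using p[of \<alpha>] unfolding norm_divide norm_of_real by simp
    ultimately have "norm (?a f \<alpha> / complex_of_real (1 + p \<alpha>)) \<le> norm (?a f \<alpha>)" by (simp only: div_by_1)
    thus "(norm (?a f \<alpha> / complex_of_real (1 + p \<alpha>)))\<^sup>2 \<le> (norm (?a f \<alpha>))\<^sup>2" by (rule power_mono) simp
  qed simp
  \<comment> \<open>The minimiser puts the share 1 / (1 + p) into h and p / (1 + p) into g,
    separately for each coefficient.\<close>
  then obtain h where h: "C.l2_expansion (\<lambda>\<alpha>. ?a f \<alpha> / complex_of_real (1 + p \<alpha>)) h" by (rule C.Riesz_Fischer)
  have hl: "h \<in> l2 lborel" using C.l2_expansion_l2[OF h] .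
  define g where "g x = f x - h x" for x
  have gl: "g \<in> l2 lborel" unfolding g_def by (rule l2_diff[OF f hl])
  have ah: "?a h \<alpha> = ?a f \<alpha> / complex_of_real (1 + p \<alpha>)" for \<alpha> by (rule C.l2_expansion_coeff[OF h])
  have ag: "?a g \<alpha> = ?a f \<alpha> * complex_of_real (p \<alpha> / (1 + p \<alpha>))" for \<alpha>
  proof -
    have n0: "complex_of_real (1 + p \<alpha>) \<noteq> 0" using p[of \<alpha>] unfolding of_real_eq_0_iff by simp
    have "?a g \<alpha> = ?a f \<alpha> - ?a f \<alpha> / complex_of_real (1 + p \<alpha>)"
      unfolding g_def l2_inner_diff_left[OF f hl C.e_l2] ah ..
    also have "\<dots> = ?a f \<alpha> * complex_of_real (p \<alpha> / (1 + p \<alpha>))"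
      using n0 by (simp add: field_simps)
    finally show ?thesis .
  qed
  have bf: "?b f \<alpha> = ?b g \<alpha> + ?b h \<alpha>" for \<alpha>
    unfolding g_def l2_inner_diff_left[OF f hl D.e_l2] by simp
  have "wsum (\<lambda>\<alpha>. p \<alpha> / (1 + p \<alpha>)) (?b f) \<le> (\<integral>\<^sup>+\<alpha>. (ennreal (1 * (norm (?b g \<alpha>))\<^sup>2) + ennreal t * ennreal (W \<alpha> * (norm (?b h \<alpha>))\<^sup>2)) \<partial>count_space UNIV)"
    unfolding wsum_def
  proof (rule nn_integral_mono)
    fix \<alpha>
    have "p \<alpha> / (1 + p \<alpha>) * (norm (?b f \<alpha>))\<^sup>2 \<le> (norm (?b g \<alpha>))\<^sup>2 + p \<alpha> * (norm (?b h \<alpha>))\<^sup>2"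
      unfolding bf by (rule K_functional_le) (use p[of \<alpha>] in simp)
    hence "ennreal (p \<alpha> / (1 + p \<alpha>) * (norm (?b f \<alpha>))\<^sup>2) \<le> ennreal ((norm (?b g \<alpha>))\<^sup>2 + p \<alpha> * (norm (?b h \<alpha>))\<^sup>2)" by (rule ennreal_leI)
    also have "\<dots> = ennreal (1 * (norm (?b g \<alpha>))\<^sup>2) + ennreal t * ennreal (W \<alpha> * (norm (?b h \<alpha>))\<^sup>2)"
      using t p[of \<alpha>] W[of \<alpha>] by (simp add: p_def ennreal_mult'[symmetric] mult.assoc)
    finally show "ennreal (p \<alpha> / (1 + p \<alpha>) * (norm (?b f \<alpha>))\<^sup>2) \<le> ennreal (1 * (norm (?b g \<alpha>))\<^sup>2) + ennreal t * ennreal (W \<alpha> * (norm (?b h \<alpha>))\<^sup>2)" .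
  qed
  also have "\<dots> = wsum (\<lambda>_. 1) (?b g) + ennreal t * wsum W (?b h)"
    unfolding wsum_def by (simp add: nn_integral_add nn_integral_cmult)
  also have "wsum (\<lambda>_. 1) (?b g) = wsum (\<lambda>_. 1) (?a g)" by (simp add: wsum_one_hermite c d gl)
  also have "wsum (\<lambda>_. 1) (?a g) + ennreal t * wsum W (?b h) \<le> ennreal K * wsum (\<lambda>_. 1) (?a g) + ennreal t * (ennreal K * wsum W (?a h))"
  proof (intro add_mono mult_left_mono bound hl)
    have "1 * wsum (\<lambda>_. 1) (?a g) \<le> ennreal K * wsum (\<lambda>_. 1) (?a g)" using K by (intro mult_right_mono) (auto simp flip: ennreal_1 intro: ennreal_leI)
    thus "wsum (\<lambda>_. 1) (?a g) \<le> ennreal K * wsum (\<lambda>_. 1) (?a g)" by simp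
  qed simp
  also have "\<dots> = ennreal K * (wsum (\<lambda>_. 1) (?a g) + ennreal t * wsum W (?a h))" by (simp add: distrib_left mult.left_commute)
  also have "wsum (\<lambda>_. 1) (?a g) + ennreal t * wsum W (?a h) = (\<integral>\<^sup>+\<alpha>. (ennreal (1 * (norm (?a g \<alpha>))\<^sup>2) + ennreal t * ennreal (W \<alpha> * (norm (?a h \<alpha>))\<^sup>2)) \<partial>count_space UNIV)"
    unfolding wsum_def by (simp add: nn_integral_add nn_integral_cmult)
  also have "\<dots> = wsum (\<lambda>\<alpha>. p \<alpha> / (1 + p \<alpha>)) (?a f)"
    unfolding wsum_def
  proof (rule nn_integral_cong)
    fix \<alpha>
    have "(norm (?a g \<alpha>))\<^sup>2 + t * (W \<alpha> * (norm (?a h \<alpha>))\<^sup>2) = p \<alpha> / (1 + p \<alpha>) * (norm (?a f \<alpha>))\<^sup>2"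
    proof -
      define q where "q = p \<alpha>"
      have q: "1 + q \<noteq> 0" "q > 0" using p[of \<alpha>] by (auto simp: q_def)
      have 1: "norm (?a g \<alpha>) = norm (?a f \<alpha>) * (q / (1 + q))" "norm (?a h \<alpha>) = norm (?a f \<alpha>) / (1 + q)"
        unfolding ag ah norm_mult norm_divide norm_of_real q_def[symmetric] using q by auto
      have "(norm (?a g \<alpha>))\<^sup>2 + q * (norm (?a h \<alpha>))\<^sup>2 = (q\<^sup>2 + q) / (1 + q)\<^sup>2 * (norm (?a f \<alpha>))\<^sup>2"
        unfolding 1 using q by (simp add: power_mult_distrib power_divide add_divide_distrib algebra_simps)
      also have "(q\<^sup>2 + q) / (1 + q)\<^sup>2 = q / (1 + q)" using q by (simp add: divide_simps power2_eq_square) (simp add: algebra_simps)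
      finally show ?thesis by (simp add: q_def p_def mult.assoc)
    qed
    thus "ennreal (1 * (norm (?a g \<alpha>))\<^sup>2) + ennreal t * ennreal (W \<alpha> * (norm (?a h \<alpha>))\<^sup>2) = ennreal (p \<alpha> / (1 + p \<alpha>) * (norm (?a f \<alpha>))\<^sup>2)"
      using t W[of \<alpha>] by (simp add: ennreal_mult'[symmetric] ennreal_plus[symmetric] del: ennreal_plus)
  qed
  finally show ?thesis by (simp add: p_def mult_left_mono)
qed

text \<open>The constant by which averaging the K-functional weights with t^(-\<theta>-1) reproduces
  W^\<theta>. It has to be neither 0 nor infinite in order to be cancelled at the end.\<close>

definition interp_const :: "real \<Rightarrow> ennreal" where
  "interp_const \<theta> = (\<integral>\<^sup>+u. indicator {0<..} u * ennreal (u powr (- \<theta>) / (1 + u)) \<partial>lborel)"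

text \<open>Substitution u = t W.\<close>

lemma interp_const_scale:
  assumes W: "W > 0"
  shows "(\<integral>\<^sup>+t. indicator {0<..} t * ennreal (t powr (- \<theta> - 1) * (t * W / (1 + t * W))) \<partial>lborel) = ennreal (W powr \<theta>) * interp_const \<theta>"
proof -
  have "(\<integral>\<^sup>+t. indicator {0<..} t * ennreal (t powr (- \<theta> - 1) * (t * W / (1 + t * W))) \<partial>lborel)
    = ennreal \<bar>1 / W\<bar> * (\<integral>\<^sup>+u. indicator {0<..} (0 + 1 / W * u) * ennreal ((0 + 1 / W * u) powr (- \<theta> - 1) * ((0 + 1 / W * u) * W / (1 + (0 + 1 / W * u) * W))) \<partial>lborel)"
    using W by (intro nn_integral_real_affine) auto
  also have "\<dots> = (\<integral>\<^sup>+u. ennreal (1 / W) * (indicator {0<..} (0 + 1 / W * u) * ennreal ((0 + 1 / W * u) powr (- \<theta> - 1) * ((0 + 1 / W * u) * W / (1 + (0 + 1 / W * u) * W)))) \<partial>lborel)"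
    using W by (subst nn_integral_cmult) auto
  also have "\<dots> = (\<integral>\<^sup>+u. ennreal (W powr \<theta>) * (indicator {0<..} u * ennreal (u powr (- \<theta>) / (1 + u))) \<partial>lborel)"
  proof (rule nn_integral_cong)
    fix u :: real
    show "ennreal (1 / W) * (indicator {0<..} (0 + 1 / W * u) * ennreal ((0 + 1 / W * u) powr (- \<theta> - 1) * ((0 + 1 / W * u) * W / (1 + (0 + 1 / W * u) * W)))) =
        ennreal (W powr \<theta>) * (indicator {0<..} u * ennreal (u powr (- \<theta>) / (1 + u)))"
    proof (cases "u > 0")
      case True
      have "(u / W) powr (- \<theta> - 1) = (u powr (- \<theta>) / u) * (W powr \<theta> * W)"
        using True W by (simp add: powr_divide powr_diff powr_minus divide_simps)
      hence "1 / W * ((u / W) powr (- \<theta> - 1) * (u / (1 + u))) = W powr \<theta> * (u powr (- \<theta>) / (1 + u))"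
        using True W by simp
      thus ?thesis using True W by (simp add: ennreal_mult'[symmetric])
    next
      case False
      hence "\<not> 0 < 1 / W * u" using W by (simp add: not_less divide_nonpos_pos)
      thus ?thesis using False by (simp add: indicator_def)
    qed
  qed
  also have "\<dots> = ennreal (W powr \<theta>) * interp_const \<theta>"
    unfolding interp_const_def by (rule nn_integral_cmult) measurable
  finally show ?thesis .
qed

lemma interp_const_nonzero: "interp_const \<theta> \<noteq> 0" if "\<theta> \<ge> 0"
proof -
  have "ennreal (2 powr (- \<theta>) / 3) * indicator {1..2} u \<le> indicator {0<..} u * ennreal (u powr (- \<theta>) / (1 + u))" for u :: real
  proof (cases "u \<in> {1..2}")
    case True
    hence "2 powr (- \<theta>) \<le> u powr (- \<theta>)" using that by (intro powr_mono2') auto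
    hence "2 powr (- \<theta>) / 3 \<le> u powr (- \<theta>) / (1 + u)" using True by (intro frac_le) auto
    thus ?thesis using True by (auto intro: ennreal_leI)
  qed simp
  hence "(\<integral>\<^sup>+u. ennreal (2 powr (- \<theta>) / 3) * indicator {1..2::real} u \<partial>lborel) \<le> interp_const \<theta>"
    unfolding interp_const_def by (intro nn_integral_mono)
  moreover have "(\<integral>\<^sup>+u. ennreal (2 powr (- \<theta>) / 3) * indicator {1..2::real} u \<partial>lborel) = ennreal (2 powr (- \<theta>) / 3)"
    by (subst nn_integral_cmult_indicator) auto
  ultimately have "ennreal (2 powr (- \<theta>) / 3) \<le> interp_const \<theta>" by simp
  moreover have "ennreal (2 powr (- \<theta>) / 3) > 0" by simp
  ultimately have "interp_const \<theta> > 0" by (rule less_le_trans[rotated])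
  thus ?thesis by simp
qed

text \<open>The integrand is compared with u^(-\<theta>) near 0 and with u^(-\<theta>-1) near
  infinity; \<theta> < 1 and \<theta> > 0 are the respective conditions of integrability.\<close>

lemma interp_const_finite: "interp_const \<theta> \<noteq> \<infinity>" if \<theta>: "0 < \<theta>" "\<theta> < 1"
proof -
  have 1: "(\<integral>\<^sup>+u. ennreal (u powr (- \<theta>) * indicator {0..1::real} u) \<partial>lborel) < \<infinity>"
  proof -
    have "((\<lambda>u. u powr (- \<theta>)) has_integral (1 powr (- \<theta> + 1) / (- \<theta> + 1))) {0..1}"
      by (rule has_integral_powr_from_0) (use \<theta> in auto)
    hence "((\<lambda>u. if u \<in> {0..1} then u powr (- \<theta>) else 0) has_integral (1 powr (- \<theta> + 1) / (- \<theta> + 1))) UNIV"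
      by (simp only: has_integral_restrict_UNIV)
    hence "((\<lambda>u. u powr (- \<theta>) * indicator {0..1} u) has_integral (1 powr (- \<theta> + 1) / (- \<theta> + 1))) UNIV"
      by (rule has_integral_eq[rotated]) (auto simp: indicator_def)
    from nn_integral_has_integral_lborel[OF _ _ this] show ?thesis by simp
  qed
  have 2: "(\<integral>\<^sup>+u. ennreal (u powr (- \<theta> - 1) * indicator {1::real..} u) \<partial>lborel) < \<infinity>"
  proof -
    have "((\<lambda>u. u powr (- \<theta> - 1)) has_integral (- (1 powr ((- \<theta> - 1) + 1)) / ((- \<theta> - 1) + 1))) {1..}"
      by (rule has_integral_powr_to_inf) (use \<theta> in auto)
    hence "((\<lambda>u. if u \<in> {1..} then u powr (- \<theta> - 1) else 0) has_integral (- (1 powr ((- \<theta> - 1) + 1)) / ((- \<theta> - 1) + 1))) UNIV"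
      by (simp only: has_integral_restrict_UNIV)
    hence "((\<lambda>u. u powr (- \<theta> - 1) * indicator {1..} u) has_integral (- (1 powr ((- \<theta> - 1) + 1)) / ((- \<theta> - 1) + 1))) UNIV"
      by (rule has_integral_eq[rotated]) (auto simp: indicator_def)
    from nn_integral_has_integral_lborel[OF _ _ this] show ?thesis by simp
  qed
  have "interp_const \<theta> \<le> (\<integral>\<^sup>+u. (ennreal (u powr (- \<theta>) * indicator {0..1::real} u) + ennreal (u powr (- \<theta> - 1) * indicator {1::real..} u)) \<partial>lborel)"
    unfolding interp_const_def
  proof (rule nn_integral_mono)
    fix u :: real
    consider "u \<le> 0" | "0 < u" "u \<le> 1" | "u > 1" by linarith
    thus "indicator {0<..} u * ennreal (u powr (- \<theta>) / (1 + u)) \<le> ennreal (u powr (- \<theta>) * indicator {0..1::real} u) + ennreal (u powr (- \<theta> - 1) * indicator {1::real..} u)"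
    proof cases
      case 2
      hence "u powr (- \<theta>) / (1 + u) \<le> u powr (- \<theta>)" by (simp add: divide_le_eq mult_le_cancel_left1)
      hence "ennreal (u powr (- \<theta>) / (1 + u)) \<le> ennreal (u powr (- \<theta>) * indicator {0..1} u)" using 2 by (intro ennreal_leI) simp
      hence "indicator {0<..} u * ennreal (u powr (- \<theta>) / (1 + u)) \<le> ennreal (u powr (- \<theta>) * indicator {0..1} u)" using 2 by simp
      thus ?thesis by (rule order_trans) simp
    next
      case 3
      hence "u powr (- \<theta>) / (1 + u) \<le> u powr (- \<theta>) / u" by (intro divide_left_mono) auto
      also have "\<dots> = u powr (- \<theta> - 1)" using 3 by (simp add: powr_diff)
      finally have "ennreal (u powr (- \<theta>) / (1 + u)) \<le> ennreal (u powr (- \<theta> - 1))" by (rule ennreal_leI)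
      thus ?thesis using 3 by simp
    qed simp
  qed
  also have "\<dots> < \<infinity>" using 1 2 by (subst nn_integral_add) auto
  finally show ?thesis by simp
qed

text \<open>Tonelli exchanges the average over t with the sum over indices, and
  \<open>interp_const_scale\<close> evaluates it for each index.\<close>

lemma wsum_interp_integral:
  fixes W :: "'i::countable \<Rightarrow> real"
  assumes W: "\<And>i. W i \<ge> 1"
  shows "(\<integral>\<^sup>+t. indicator {0<..} t * ennreal (t powr (- \<theta> - 1)) * wsum (\<lambda>i. t * W i / (1 + t * W i)) a \<partial>lborel)
    = interp_const \<theta> * wsum (\<lambda>i. W i powr \<theta>) a"
proof -
  have "(\<integral>\<^sup>+t. indicator {0<..} t * ennreal (t powr (- \<theta> - 1)) * wsum (\<lambda>i. t * W i / (1 + t * W i)) a \<partial>lborel)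
    = (\<integral>\<^sup>+t. \<integral>\<^sup>+i. ennreal ((norm (a i))\<^sup>2) * (indicator {0<..} t * ennreal (t powr (- \<theta> - 1) * (t * W i / (1 + t * W i)))) \<partial>count_space UNIV \<partial>lborel)"
  proof (rule nn_integral_cong)
    fix t :: real
    have "indicator {0<..} t * ennreal (t powr (- \<theta> - 1)) * ennreal (t * W i / (1 + t * W i) * (norm (a i))\<^sup>2)
      = ennreal ((norm (a i))\<^sup>2) * (indicator {0<..} t * ennreal (t powr (- \<theta> - 1) * (t * W i / (1 + t * W i))))" for i
    proof (cases "t > 0")
      case True
      define q n where "q = t * W i / (1 + t * W i)" and "n = (norm (a i))\<^sup>2"
      have "ennreal (t powr (- \<theta> - 1)) * ennreal (q * n) = ennreal (t powr (- \<theta> - 1) * (q * n))" by (rule ennreal_mult'[symmetric]) simp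
      moreover have "ennreal n * ennreal (t powr (- \<theta> - 1) * q) = ennreal (n * (t powr (- \<theta> - 1) * q))" by (rule ennreal_mult'[symmetric]) (simp add: n_def)
      moreover have "t powr (- \<theta> - 1) * (q * n) = n * (t powr (- \<theta> - 1) * q)" by simp
      ultimately have e: "ennreal (t powr (- \<theta> - 1)) * ennreal (q * n) = ennreal n * ennreal (t powr (- \<theta> - 1) * q)" by (simp only:)
      have ind: "indicator {0<..} t = (1 :: ennreal)" using True by simp
      show ?thesis using e unfolding q_def n_def ind mult_1_left .
    qed simp
    thus "indicator {0<..} t * ennreal (t powr (- \<theta> - 1)) * wsum (\<lambda>i. t * W i / (1 + t * W i)) a =
      (\<integral>\<^sup>+i. ennreal ((norm (a i))\<^sup>2) * (indicator {0<..} t * ennreal (t powr (- \<theta> - 1) * (t * W i / (1 + t * W i)))) \<partial>count_space UNIV)"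
      unfolding wsum_def by (subst nn_integral_cmult[symmetric]) auto
  qed
  also have "\<dots> = (\<integral>\<^sup>+i. \<integral>\<^sup>+t. ennreal ((norm (a i))\<^sup>2) * (indicator {0<..} t * ennreal (t powr (- \<theta> - 1) * (t * W i / (1 + t * W i)))) \<partial>lborel \<partial>count_space UNIV)"
    by (rule nn_integral_count_space_nn_integral) auto
  also have "\<dots> = (\<integral>\<^sup>+i. interp_const \<theta> * ennreal (W i powr \<theta> * (norm (a i))\<^sup>2) \<partial>count_space UNIV)"
  proof (rule nn_integral_cong)
    fix i
    have pos: "W i > 0" using W[of i] by linarith
    have "(\<integral>\<^sup>+t. ennreal ((norm (a i))\<^sup>2) * (indicator {0<..} t * ennreal (t powr (- \<theta> - 1) * (t * W i / (1 + t * W i)))) \<partial>lborel)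
      = ennreal ((norm (a i))\<^sup>2) * (\<integral>\<^sup>+t. indicator {0<..} t * ennreal (t powr (- \<theta> - 1) * (t * W i / (1 + t * W i))) \<partial>lborel)"
      by (rule nn_integral_cmult) measurable
    also have "\<dots> = ennreal ((norm (a i))\<^sup>2) * (ennreal (W i powr \<theta>) * interp_const \<theta>)"
      by (simp only: interp_const_scale[OF pos])
    also have "\<dots> = interp_const \<theta> * ennreal (W i powr \<theta> * (norm (a i))\<^sup>2)"
      by (simp add: ennreal_mult mult_ac)
    finally show "(\<integral>\<^sup>+t. ennreal ((norm (a i))\<^sup>2) * (indicator {0<..} t * ennreal (t powr (- \<theta> - 1) * (t * W i / (1 + t * W i)))) \<partial>lborel) = interp_const \<theta> * ennreal (W i powr \<theta> * (norm (a i))\<^sup>2)" .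
  qed
  also have "\<dots> = interp_const \<theta> * wsum (\<lambda>i. W i powr \<theta>) a"
    unfolding wsum_def by (rule nn_integral_cmult) simp
  finally show ?thesis .
qed

lemma wsum_scale: "wsum w (\<lambda>i. complex_of_real r * a i) = ennreal (r\<^sup>2) * wsum w a"
proof -
  have "ennreal (w i * (norm (complex_of_real r * a i))\<^sup>2) = ennreal (r\<^sup>2) * ennreal (w i * (norm (a i))\<^sup>2)" for i
    by (simp add: ennreal_mult'[symmetric] norm_mult power_mult_distrib mult.left_commute)
  thus ?thesis unfolding wsum_def by (simp add: nn_integral_cmult)
qed

lemma dilation_interpolation:
  fixes f :: "real ^ 'n \<Rightarrow> complex" and W :: "('n \<Rightarrow> nat) \<Rightarrow> real"
  assumes c: "c > 0" and d: "d > 0" and W: "\<And>\<alpha>. W \<alpha> \<ge> 1" and K: "K \<ge> 1"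
    and bound: "\<And>f. f \<in> l2 lborel \<Longrightarrow> wsum W (hermite_coeff d f) \<le> ennreal K * wsum W (hermite_coeff c f)"
    and f: "f \<in> l2 lborel" and \<theta>: "0 < \<theta>" "\<theta> < 1"
  shows "wsum (\<lambda>\<alpha>. W \<alpha> powr \<theta>) (hermite_coeff d f)
    \<le> ennreal K * wsum (\<lambda>\<alpha>. W \<alpha> powr \<theta>) (hermite_coeff c f)"
proof -
  let ?a = "\<lambda>\<alpha>. hermite_coeff c f \<alpha>" and ?b = "\<lambda>\<alpha>. hermite_coeff d f \<alpha>"
  let ?w = "\<lambda>t \<alpha>. t * W \<alpha> / (1 + t * W \<alpha>)"
  \<comment> \<open>The constant K is absorbed into the coefficients, so that the integral formula
    applies to the right-hand side as it stands.\<close>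
  define a' where "a' \<alpha> = complex_of_real (sqrt K) * ?a \<alpha>" for \<alpha>
  have a': "wsum w a' = ennreal K * wsum w ?a" for w
    unfolding a'_def wsum_scale using K by simp
  have "interp_const \<theta> * wsum (\<lambda>\<alpha>. W \<alpha> powr \<theta>) ?b = (\<integral>\<^sup>+t. indicator {0<..} t * ennreal (t powr (- \<theta> - 1)) * wsum (?w t) ?b \<partial>lborel)"
    by (rule wsum_interp_integral[symmetric, OF W])
  also have "\<dots> \<le> (\<integral>\<^sup>+t. indicator {0<..} t * ennreal (t powr (- \<theta> - 1)) * wsum (?w t) a' \<partial>lborel)"
  proof (rule nn_integral_mono)
    fix t :: real
    show "indicator {0<..} t * ennreal (t powr (- \<theta> - 1)) * wsum (?w t) ?b \<le> indicator {0<..} t * ennreal (t powr (- \<theta> - 1)) * wsum (?w t) a'"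
    proof (cases "t > 0")
      case True
      have "ennreal (t powr (- \<theta> - 1)) * wsum (?w t) ?b \<le> ennreal (t powr (- \<theta> - 1)) * (ennreal K * wsum (?w t) ?a)"
        by (intro mult_left_mono K_functional_step c d W K bound f True) auto
      thus ?thesis unfolding a' using True by simp
    qed simp
  qed
  also have "\<dots> = interp_const \<theta> * (ennreal K * wsum (\<lambda>\<alpha>. W \<alpha> powr \<theta>) ?a)"
    unfolding a'[symmetric] by (rule wsum_interp_integral[OF W])
  finally have "interp_const \<theta> * wsum (\<lambda>\<alpha>. W \<alpha> powr \<theta>) ?b \<le> interp_const \<theta> * (ennreal K * wsum (\<lambda>\<alpha>. W \<alpha> powr \<theta>) ?a)" .
  thus ?thesis using interp_const_nonzero[of \<theta>] interp_const_finite[OF \<theta>] \<theta> by (simp add: ennreal_mult_le_mult_iff)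
qed

lemma dilation_weight1_powr:
  fixes s :: real
  assumes c: "c > 0" and d: "d > 0" and s: "s \<ge> 0"
  shows "\<exists>K\<ge>1. \<forall>f\<in>l2 lborel. wsum (\<lambda>\<alpha>. weight1 j \<alpha> powr s) (hermite_coeff d f)
     \<le> ennreal K * wsum (\<lambda>\<alpha>. weight1 (j :: 'n::finite) \<alpha> powr s) (hermite_coeff c f)"
proof (cases "s = 0")
  case True
  have "weight1 j \<alpha> powr 0 = 1" for \<alpha> using weight1_ge_1[of j \<alpha>] by simp
  thus ?thesis using True by (intro exI[of _ 1]) (simp add: wsum_one_hermite[OF c] wsum_one_hermite[OF d])
next
  case False
  obtain N :: nat where N: "s < real N" using reals_Archimedean2 by blast
  \<comment> \<open>Chosen so that the power \<theta> of the weight of order 2N is the weight of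
    order s. Taking N > s keeps \<theta> below 1; the value s = 0 was treated apart because \<theta>
    must be positive.\<close>
  define \<theta> where "\<theta> = s / real (2 * N)"
  have \<theta>: "0 < \<theta>" "\<theta> < 1" using N s False by (auto simp: \<theta>_def divide_simps)
  obtain K where K: "K \<ge> 1" and bound: "\<And>f. f \<in> l2 lborel \<Longrightarrow> wsum (\<lambda>\<alpha>. weight1 j \<alpha> ^ (2 * N)) (hermite_coeff d f)
     \<le> ennreal K * wsum (\<lambda>\<alpha>. weight1 j \<alpha> ^ (2 * N)) (hermite_coeff c f)"
    using dilation_integer_weight[OF c d, of j N] by blast
  have W: "weight1 j \<alpha> ^ (2 * N) \<ge> 1" for \<alpha> by (rule one_le_power[OF weight1_ge_1])
  have "(weight1 j \<alpha> ^ (2 * N)) powr \<theta> = weight1 j \<alpha> powr s" for \<alpha>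
  proof -
    have "weight1 j \<alpha> > 0" using weight1_ge_1[of j \<alpha>] by linarith
    hence "(weight1 j \<alpha> ^ (2 * N)) powr \<theta> = weight1 j \<alpha> powr (real (2 * N) * \<theta>)"
      by (simp only: powr_realpow[symmetric] powr_powr)
    thus ?thesis using N s by (simp add: \<theta>_def)
  qed
  thus ?thesis using dilation_interpolation[OF c d W K bound _ \<theta>] K by auto
qed

section \<open>From single coordinates to the full eigenvalue\<close>

lemma hermite_eigenvalue_eq_sum: "hermite_eigenvalue \<alpha> = (\<Sum>j\<in>UNIV. weight1 j \<alpha>)"
  by (simp add: hermite_eigenvalue_def multi_deg_def weight1_def sum.distrib sum_distrib_left)

text \<open>The eigenvalue is a sum of n directional weights, hence at most n times the largest and
  at least each of them. Its power is therefore comparable to the sum of their powers, and the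
  directional bounds add up.\<close>

lemma dilation_sobolev_bound:
  fixes s :: real
  assumes c: "c > 0" and d: "d > 0" and s: "s \<ge> 0"
  shows "\<exists>K\<ge>0. \<forall>f\<in>l2 (lborel :: (real ^ 'n) measure). wsum (\<lambda>\<alpha>. hermite_eigenvalue \<alpha> powr s) (hermite_coeff d f)
     \<le> ennreal K * wsum (\<lambda>\<alpha>. hermite_eigenvalue \<alpha> powr s) (hermite_coeff c f)"
proof -
  have "\<forall>j. \<exists>K\<ge>1. \<forall>f\<in>l2 lborel. wsum (\<lambda>\<alpha>. weight1 j \<alpha> powr s) (hermite_coeff d f)
     \<le> ennreal K * wsum (\<lambda>\<alpha>. weight1 (j :: 'n) \<alpha> powr s) (hermite_coeff c f)"
    using dilation_weight1_powr[OF c d s] by blast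
  from choice[OF this] obtain K where K: "\<And>j. K j \<ge> 1" and b: "\<And>j f. f \<in> l2 lborel \<Longrightarrow> wsum (\<lambda>\<alpha>. weight1 j \<alpha> powr s) (hermite_coeff d f)
     \<le> ennreal (K j) * wsum (\<lambda>\<alpha>. weight1 (j :: 'n) \<alpha> powr s) (hermite_coeff c f)"
    by blast
  have K0: "K j \<ge> 0" for j using K[of j] by linarith
  let ?n = "real CARD('n)"
  have le: "hermite_eigenvalue \<alpha> powr s \<le> ?n powr s * (\<Sum>j\<in>UNIV. weight1 j \<alpha> powr s)" for \<alpha> :: "'n \<Rightarrow> nat"
  proof -
    define m where "m = Max (range (\<lambda>j. weight1 j \<alpha>))"
    have "m \<in> range (\<lambda>j. weight1 j \<alpha>)" unfolding m_def by (rule Max_in) auto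
    then obtain i where i: "m = weight1 i \<alpha>" by auto
    have "weight1 j \<alpha> \<le> m" for j unfolding m_def by (rule Max_ge) auto
    hence "hermite_eigenvalue \<alpha> \<le> ?n * m"
      unfolding hermite_eigenvalue_eq_sum using sum_bounded_above[of UNIV "\<lambda>j. weight1 j \<alpha>" m] by simp
    hence "hermite_eigenvalue \<alpha> powr s \<le> (?n * m) powr s"
      using hermite_eigenvalue_ge_1[of \<alpha>] s by (intro powr_mono2) auto
    also have "\<dots> = ?n powr s * m powr s" using weight1_ge_1[of i \<alpha>] i by (intro powr_mult) 
    also have "m powr s \<le> (\<Sum>j\<in>UNIV. weight1 j \<alpha> powr s)" unfolding i by (rule member_le_sum) auto
    finally show ?thesis by (simp add: mult_left_mono)
  qed
  have ge: "weight1 j \<alpha> powr s \<le> hermite_eigenvalue \<alpha> powr s" for j and \<alpha> :: "'n \<Rightarrow> nat"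
  proof -
    have "weight1 i \<alpha> \<ge> 0" for i using weight1_ge_1[of i \<alpha>] by linarith
    thus ?thesis using s unfolding hermite_eigenvalue_eq_sum by (intro powr_mono2 member_le_sum) auto
  qed
  show ?thesis
  proof (intro exI[of _ "?n powr s * (\<Sum>j\<in>UNIV. K j)"] conjI ballI)
    have "(\<Sum>j\<in>UNIV. K j) \<ge> 0" by (intro sum_nonneg K0)
    thus "?n powr s * (\<Sum>j\<in>UNIV. K j) \<ge> 0" by simp
    fix f :: "real ^ 'n \<Rightarrow> complex" assume f: "f \<in> l2 lborel"
    let ?a = "\<lambda>\<alpha>. hermite_coeff c f \<alpha>" and ?b = "\<lambda>\<alpha>. hermite_coeff d f \<alpha>"
    have "wsum (\<lambda>\<alpha>. hermite_eigenvalue \<alpha> powr s) ?b \<le> (\<integral>\<^sup>+\<alpha>. ennreal (?n powr s) * (\<Sum>j\<in>UNIV. ennreal (weight1 j \<alpha> powr s * (norm (?b \<alpha>))\<^sup>2)) \<partial>count_space UNIV)"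
      unfolding wsum_def
    proof (rule nn_integral_mono)
      fix \<alpha> :: "'n \<Rightarrow> nat"
      have "hermite_eigenvalue \<alpha> powr s * (norm (?b \<alpha>))\<^sup>2 \<le> ?n powr s * (\<Sum>j\<in>UNIV. weight1 j \<alpha> powr s * (norm (?b \<alpha>))\<^sup>2)"
        using mult_right_mono[OF le, of "(norm (?b \<alpha>))\<^sup>2" \<alpha>] by (simp add: sum_distrib_right mult.assoc)
      hence "ennreal (hermite_eigenvalue \<alpha> powr s * (norm (?b \<alpha>))\<^sup>2) \<le> ennreal (?n powr s * (\<Sum>j\<in>UNIV. weight1 j \<alpha> powr s * (norm (?b \<alpha>))\<^sup>2))" by (rule ennreal_leI)
      also have "\<dots> = ennreal (?n powr s) * (\<Sum>j\<in>UNIV. ennreal (weight1 j \<alpha> powr s * (norm (?b \<alpha>))\<^sup>2))"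
        by (subst sum_ennreal) (auto simp: ennreal_mult')
      finally show "ennreal (hermite_eigenvalue \<alpha> powr s * (norm (?b \<alpha>))\<^sup>2) \<le> ennreal (?n powr s) * (\<Sum>j\<in>UNIV. ennreal (weight1 j \<alpha> powr s * (norm (?b \<alpha>))\<^sup>2))" .
    qed
    also have "\<dots> = ennreal (?n powr s) * (\<Sum>j\<in>UNIV. wsum (\<lambda>\<alpha>. weight1 j \<alpha> powr s) ?b)"
      unfolding wsum_def by (simp add: nn_integral_cmult nn_integral_sum del: sum_ennreal)
    also have "\<dots> \<le> ennreal (?n powr s) * (\<Sum>j\<in>UNIV. ennreal (K j) * wsum (\<lambda>\<alpha>. hermite_eigenvalue \<alpha> powr s) ?a)"
    proof (intro mult_left_mono sum_mono)
      fix j :: 'n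
      have "wsum (\<lambda>\<alpha>. weight1 j \<alpha> powr s) ?b \<le> ennreal (K j) * wsum (\<lambda>\<alpha>. weight1 j \<alpha> powr s) ?a" by (rule b[OF f])
      also have "\<dots> \<le> ennreal (K j) * wsum (\<lambda>\<alpha>. hermite_eigenvalue \<alpha> powr s) ?a"
        by (intro mult_left_mono wsum_mono mult_right_mono ge) auto
      finally show "wsum (\<lambda>\<alpha>. weight1 j \<alpha> powr s) ?b \<le> ennreal (K j) * wsum (\<lambda>\<alpha>. hermite_eigenvalue \<alpha> powr s) ?a" .
    qed simp
    also have "\<dots> = ennreal (?n powr s * (\<Sum>j\<in>UNIV. K j)) * wsum (\<lambda>\<alpha>. hermite_eigenvalue \<alpha> powr s) ?a"
    proof -
      have "(\<Sum>j\<in>UNIV. ennreal (K j)) = ennreal (\<Sum>j\<in>UNIV. K j)" by (intro sum_ennreal K0)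
      thus ?thesis by (simp add: sum_distrib_right[symmetric] ennreal_mult' mult.assoc)
    qed
    finally show "wsum (\<lambda>\<alpha>. hermite_eigenvalue \<alpha> powr s) ?b \<le> ennreal (?n powr s * (\<Sum>j\<in>UNIV. K j)) * wsum (\<lambda>\<alpha>. hermite_eigenvalue \<alpha> powr s) ?a" .
  qed
qed


subsection \<open>Hermite-Sobolev and Fock-Sobolev spaces\<close>

text \<open>The parameter c selects the dilation: c = 1 describes the given Hermite-Sobolev space, c
  = sqrt 2 the one that the Bargmann transform carries onto the Fock-Sobolev space.\<close>

definition sobolev_summable :: "real \<Rightarrow> real \<Rightarrow> (real ^ 'n \<Rightarrow> complex) \<Rightarrow> bool" where
  "sobolev_summable c s f \<longleftrightarrow> (\<lambda>\<alpha>. hermite_eigenvalue \<alpha> powr s * (norm (hermite_coeff c f \<alpha>))\<^sup>2) summable_on UNIV"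

definition sobolev_sq :: "real \<Rightarrow> real \<Rightarrow> (real ^ 'n \<Rightarrow> complex) \<Rightarrow> real" where
  "sobolev_sq c s f = (\<Sum>\<^sub>\<infinity>\<alpha>. hermite_eigenvalue \<alpha> powr s * (norm (hermite_coeff c f \<alpha>))\<^sup>2)"

lemma L2_space_eq: "L2_space = l2 lborel"
  by (auto simp: L2_space_def l2_def)

lemma hermite_eigenvalue_half_powr: "(hermite_eigenvalue \<alpha> powr (s / 2))\<^sup>2 = hermite_eigenvalue \<alpha> powr s"
  by (simp add: power2_eq_square powr_add[symmetric])

lemma hermite_power_iff:
  fixes f :: "real ^ 'n \<Rightarrow> complex"
  shows "hermite_power t f g \<longleftrightarrow> orthonormal_family.l2_expansion lborel (hermite_dil 1)
     (\<lambda>\<alpha>. complex_of_real (hermite_eigenvalue \<alpha> powr t) * hermite_coeff 1 f \<alpha>) g"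
proof -
  interpret orthonormal_family lborel "hermite_dil 1 :: ('n \<Rightarrow> nat) \<Rightarrow> _" by (rule orthonormal_family_hermite_dil) simp
  let ?a = "\<lambda>\<alpha>. complex_of_real (hermite_eigenvalue \<alpha> powr t) * hermite_coeff 1 f \<alpha>"
  have inn: "L2_inner f (\<lambda>y. complex_of_real (hermite_fun \<alpha> y)) = hermite_coeff 1 f \<alpha>" for \<alpha>
    by (simp add: L2_inner_def l2_inner_def hermite_dil_one)
  have eq: "L2_fnorm (\<lambda>x. g x - (\<Sum>\<alpha>\<in>A. complex_of_real (hermite_eigenvalue \<alpha> powr t) *
                 L2_inner f (\<lambda>y. complex_of_real (hermite_fun \<alpha> y)) *
                 complex_of_real (hermite_fun \<alpha> x))) = sqrt (l2_sq lborel (\<lambda>x. g x - psum ?a A x))" for A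
    unfolding inn by (simp add: L2_fnorm_def l2_sq_def psum_def hermite_dil_one)
  have "((\<lambda>A. sqrt (l2_sq lborel (\<lambda>x. g x - psum ?a A x))) \<longlongrightarrow> 0) (finite_subsets_at_top UNIV) \<longleftrightarrow>
      ((\<lambda>A. l2_sq lborel (\<lambda>x. g x - psum ?a A x)) \<longlongrightarrow> 0) (finite_subsets_at_top UNIV)"
  proof
    assume "((\<lambda>A. sqrt (l2_sq lborel (\<lambda>x. g x - psum ?a A x))) \<longlongrightarrow> 0) (finite_subsets_at_top UNIV)"
    from tendsto_power[OF this, of 2] show "((\<lambda>A. l2_sq lborel (\<lambda>x. g x - psum ?a A x)) \<longlongrightarrow> 0) (finite_subsets_at_top UNIV)" by simp
  next
    assume "((\<lambda>A. l2_sq lborel (\<lambda>x. g x - psum ?a A x)) \<longlongrightarrow> 0) (finite_subsets_at_top UNIV)"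
    from tendsto_real_sqrt[OF this] show "((\<lambda>A. sqrt (l2_sq lborel (\<lambda>x. g x - psum ?a A x))) \<longlongrightarrow> 0) (finite_subsets_at_top UNIV)" by simp
  qed
  thus ?thesis unfolding hermite_power_def l2_expansion_def eq L2_space_eq by blast
qed

lemma norm_weighted_sq: "(norm (complex_of_real (hermite_eigenvalue \<alpha> powr (s / 2)) * z))\<^sup>2 = hermite_eigenvalue \<alpha> powr s * (norm z)\<^sup>2"
  unfolding norm_mult power_mult_distrib norm_of_real power2_abs hermite_eigenvalue_half_powr ..

text \<open>Weighted summability is square summability of the coefficients of H^(s/2) f, so
  Riesz-Fischer supplies that function and the norm identity gives the converse.\<close>

lemma hermite_sobolev_iff:
  fixes f :: "real ^ 'n \<Rightarrow> complex"
  shows "f \<in> hermite_sobolev s \<longleftrightarrow> f \<in> l2 lborel \<and> sobolev_summable 1 s f"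
proof -
  interpret orthonormal_family lborel "hermite_dil 1 :: ('n \<Rightarrow> nat) \<Rightarrow> _" by (rule orthonormal_family_hermite_dil) simp
  have "(\<exists>g. hermite_power (s / 2) f g) \<longleftrightarrow> sobolev_summable 1 s f"
  proof
    assume "\<exists>g. hermite_power (s / 2) f g"
    then obtain g where "hermite_power (s / 2) f g" ..
    from l2_expansion_norm[OF this[unfolded hermite_power_iff]] show "sobolev_summable 1 s f"
      unfolding norm_weighted_sq sobolev_summable_def by (rule has_sum_imp_summable)
  next
    assume "sobolev_summable 1 s f"
    hence "(\<lambda>\<alpha>. (norm (complex_of_real (hermite_eigenvalue \<alpha> powr (s / 2)) * hermite_coeff 1 f \<alpha>))\<^sup>2) summable_on UNIV"
      unfolding norm_weighted_sq sobolev_summable_def .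
    thus "\<exists>g. hermite_power (s / 2) f g"
      unfolding hermite_power_iff by (rule Riesz_Fischer) blast
  qed
  thus ?thesis by (simp add: hermite_sobolev_def L2_space_eq)
qed

text \<open>Every admissible g has the same coefficients and hence the same norm, so the choice in
  the definition does no harm.\<close>

lemma hermite_sobolev_norm_eq:
  fixes f :: "real ^ 'n \<Rightarrow> complex"
  assumes f: "f \<in> hermite_sobolev s"
  shows "hermite_sobolev_norm s f = sqrt (sobolev_sq 1 s f)"
proof -
  interpret orthonormal_family lborel "hermite_dil 1 :: ('n \<Rightarrow> nat) \<Rightarrow> _" by (rule orthonormal_family_hermite_dil) simp
  define g where "g = (SOME g. hermite_power (s / 2) f g)"
  have "\<exists>g. hermite_power (s / 2) f g" using f by (simp add: hermite_sobolev_def)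
  hence "hermite_power (s / 2) f g" unfolding g_def by (rule someI_ex)
  from l2_expansion_norm[OF this[unfolded hermite_power_iff]] have "l2_sq lborel g = sobolev_sq 1 s f"
    unfolding norm_weighted_sq sobolev_sq_def by (rule infsumI[symmetric])
  thus ?thesis by (simp add: hermite_sobolev_norm_def g_def L2_fnorm_def l2_sq_def)
qed

lemma sobolev_sq_nonneg: "sobolev_sq c s f \<ge> 0"
  unfolding sobolev_sq_def by (intro infsum_nonneg) auto

lemma sobolev_equiv:
  assumes c: "c > 0" and d: "d > 0" and s: "s \<ge> 0"
  shows "\<exists>K\<ge>0. \<forall>f\<in>l2 (lborel :: (real ^ 'n) measure). sobolev_summable c s f \<longrightarrow> sobolev_summable d s f \<and> sqrt (sobolev_sq d s f) \<le> K * sqrt (sobolev_sq c s f)"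
proof -
  obtain K where K: "K \<ge> 0" and b: "\<And>f. f \<in> l2 (lborel :: (real ^ 'n) measure) \<Longrightarrow> wsum (\<lambda>\<alpha>. hermite_eigenvalue \<alpha> powr s) (hermite_coeff d f)
     \<le> ennreal K * wsum (\<lambda>\<alpha>. hermite_eigenvalue \<alpha> powr s) (hermite_coeff c f)"
    using dilation_sobolev_bound[OF c d s] by blast
  show ?thesis
  proof (intro exI[of _ "sqrt K"] conjI ballI impI)
    fix f :: "real ^ 'n \<Rightarrow> complex" assume f: "f \<in> l2 lborel" and fc: "sobolev_summable c s f"
    have wc: "wsum (\<lambda>\<alpha>. hermite_eigenvalue \<alpha> powr s) (hermite_coeff c f) = ennreal (sobolev_sq c s f)"
      unfolding sobolev_sq_def by (rule wsum_eq_infsum) (use fc in \<open>simp_all add: sobolev_summable_def\<close>)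
    have "wsum (\<lambda>\<alpha>. hermite_eigenvalue \<alpha> powr s) (hermite_coeff d f) < \<infinity>"
      using b[OF f] unfolding wc by (simp add: ennreal_mult'[symmetric] K le_less_trans[OF _ ennreal_less_top])
    thus fd: "sobolev_summable d s f" unfolding sobolev_summable_def by (subst (asm) wsum_finite_iff) auto
    have wd: "wsum (\<lambda>\<alpha>. hermite_eigenvalue \<alpha> powr s) (hermite_coeff d f) = ennreal (sobolev_sq d s f)"
      unfolding sobolev_sq_def by (rule wsum_eq_infsum) (use fd in \<open>simp_all add: sobolev_summable_def\<close>)
    have "sobolev_sq d s f \<le> K * sobolev_sq c s f"
      using b[OF f] K sobolev_sq_nonneg[of c s f] unfolding wc wd by (simp add: ennreal_mult[symmetric] ennreal_le_iff)
    thus "sqrt (sobolev_sq d s f) \<le> sqrt K * sqrt (sobolev_sq c s f)" by (simp flip: real_sqrt_mult)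
  qed (use K in simp)
qed

text \<open>The coefficients of the transform differ from those of f by powers of i, so the weighted
  sums agree exactly.\<close>

lemma fock_sobolev_bargmann:
  assumes c: "c > 0" and f: "f \<in> l2 lborel" and fs: "sobolev_summable c s f"
  shows "(\<lambda>z. bargmann c f z) \<in> fock_sobolev s"
    and "fock_sobolev_norm s (\<lambda>z. bargmann c f z) = sqrt (sobolev_sq c s f)"
proof -
  let ?a = "\<lambda>\<alpha>. hermite_coeff c f \<alpha> * \<i> ^ multi_deg \<alpha>"
  have n: "norm (?a \<alpha>) = norm (hermite_coeff c f \<alpha>)" for \<alpha> by (simp add: norm_mult norm_power)
  have e: "fock_expansion ?a (\<lambda>z. bargmann c f z)"
    unfolding fock_expansion_def
    using bargmann_transform_has_sum[OF c f] by (simp add: fock_ibasis_eq mult.assoc)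
  show "(\<lambda>z. bargmann c f z) \<in> fock_sobolev s"
    unfolding fock_sobolev_def mem_Collect_eq using e fs
    by (intro exI[of _ ?a] conjI) (simp_all only: n sobolev_summable_def)
  show "fock_sobolev_norm s (\<lambda>z. bargmann c f z) = sqrt (sobolev_sq c s f)"
    unfolding fock_sobolev_norm_def fock_coeff_eq[OF e] n sobolev_sq_def ..
qed

text \<open>Surjectivity: for s \<ge> 0 the weights are at least 1, so the Fock coefficients are
  square summable and Riesz-Fischer yields f. The conjugate phases undo the powers of i.\<close>

lemma fock_sobolev_obtain:
  fixes F :: "complex ^ 'n \<Rightarrow> complex"
  assumes c: "c > 0" and s: "s \<ge> 0" and F: "F \<in> fock_sobolev s"
  obtains f where "f \<in> l2 lborel" "sobolev_summable c s f" "F = (\<lambda>z. bargmann c f z)"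
proof -
  interpret orthonormal_family lborel "hermite_dil c :: ('n \<Rightarrow> nat) \<Rightarrow> _" by (rule orthonormal_family_hermite_dil[OF c])
  obtain a where a: "fock_expansion a F" and as: "(\<lambda>\<alpha>. hermite_eigenvalue \<alpha> powr s * (norm (a \<alpha>))\<^sup>2) summable_on UNIV"
    using F by (auto simp: fock_sobolev_def)
  let ?b = "\<lambda>\<alpha>. a \<alpha> * cnj (\<i> ^ multi_deg \<alpha>)"
  have n: "norm (?b \<alpha>) = norm (a \<alpha>)" for \<alpha> by (simp add: norm_mult norm_power)
  have "(\<lambda>\<alpha>. (norm (?b \<alpha>))\<^sup>2) summable_on UNIV"
    unfolding n
  proof (rule summable_on_comparison_test[OF as])
    fix \<alpha> :: "'n \<Rightarrow> nat"
    have "hermite_eigenvalue \<alpha> powr s \<ge> 1" using hermite_eigenvalue_ge_1[of \<alpha>] s by (simp add: ge_one_powr_ge_zero)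
    thus "(norm (a \<alpha>))\<^sup>2 \<le> hermite_eigenvalue \<alpha> powr s * (norm (a \<alpha>))\<^sup>2" by (simp add: mult_le_cancel_right1)
  qed simp
  then obtain f where f: "l2_expansion ?b f" by (rule Riesz_Fischer)
  have co: "hermite_coeff c f \<alpha> = ?b \<alpha>" for \<alpha> by (rule l2_expansion_coeff[OF f])
  have fl: "f \<in> l2 lborel" by (rule l2_expansion_l2[OF f])
  have i: "cnj (\<i> ^ k) * \<i> ^ k = 1" for k by (simp flip: power_mult_distrib)
  have "F z = bargmann c f z" for z
  proof (rule has_sum_unique)
    show "((\<lambda>\<alpha>. a \<alpha> * fock_basis \<alpha> z) has_sum F z) UNIV" using a by (simp add: fock_expansion_def)
    have "?b \<alpha> * fock_ibasis \<alpha> z = a \<alpha> * fock_basis \<alpha> z" for \<alpha>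
    proof -
      have "?b \<alpha> * fock_ibasis \<alpha> z = a \<alpha> * (cnj (\<i> ^ multi_deg \<alpha>) * \<i> ^ multi_deg \<alpha>) * fock_basis \<alpha> z"
        by (simp only: fock_ibasis_eq mult.assoc)
      thus ?thesis unfolding i by simp
    qed
    thus "((\<lambda>\<alpha>. a \<alpha> * fock_basis \<alpha> z) has_sum bargmann c f z) UNIV"
      using bargmann_transform_has_sum[OF c fl, of z] unfolding co by (simp only:)
  qed
  moreover have "sobolev_summable c s f" unfolding sobolev_summable_def co n by (rule as)
  ultimately show ?thesis using that[OF fl] by blast
qed

text \<open>Polarised isometry: both inner products are the same series in the Hermite coefficients
  of f and g.\<close>

lemma
  fixes f g :: "real ^ 'n \<Rightarrow> complex"
  assumes c: "c > 0" and f: "f \<in> l2 lborel" and g: "g \<in> l2 lborel"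
  shows bargmann_inner_integrable: "integrable gauss_measure (\<lambda>w. bargmann c f w * cnj (bargmann c g w))"
    and bargmann_inner: "(LINT w|gauss_measure. bargmann c f w * cnj (bargmann c g w)) = l2_inner lborel f g"
proof -
  interpret H: orthonormal_basis lborel "hermite_dil c :: ('n \<Rightarrow> nat) \<Rightarrow> _" by (rule orthonormal_basis_hermite_dil[OF c])
  interpret E: orthonormal_family gauss_measure "fock_ibasis :: ('n \<Rightarrow> nat) \<Rightarrow> _" by (rule orthonormal_family_fock_ibasis)
  let ?B = "\<lambda>f w. bargmann c f w"
  have ex: "E.l2_expansion (hermite_coeff c f) (?B f)" if "f \<in> l2 lborel" for f
    by (rule E.l2_expansion_of_pointwise[OF H.bessel_summable[OF that] bargmann_transform_has_sum[OF c that]])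
  note l = E.l2_expansion_l2[OF ex]
  show "integrable gauss_measure (\<lambda>w. ?B f w * cnj (?B g w))" by (rule l2_inner_integrable[OF l[OF f] l[OF g]])
  have "l2_inner gauss_measure (?B f) (?B g) = l2_inner lborel f g"
    using has_sum_unique[OF E.l2_expansion_inner'[OF ex[OF f] l[OF g]] H.l2_expansion_inner'[OF H.l2_expansion_self[OF f] g, folded E.l2_expansion_coeff[OF ex[OF g]]]] .
  thus "(LINT w|gauss_measure. ?B f w * cnj (?B g w)) = l2_inner lborel f g" by (simp only: l2_inner_def)
qed

section \<open>Identities for the kernel of dilation \<open>sqrt 2\<close>\<close>

abbreviation bkernel :: "complex ^ 'n \<Rightarrow> real ^ 'n \<Rightarrow> complex" where
  "bkernel \<equiv> bargmann_kernel (sqrt 2)"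

lemma bkernel_factor:
  "bkernel z x = bkernel 0 x * exp (2 * \<i> * (\<Sum>j\<in>UNIV. complex_of_real (x $ j) * z $ j) + (\<Sum>j\<in>UNIV. (z $ j)\<^sup>2) / 2)"
  using bargmann_kernel_factor[of "sqrt 2" z x] by (simp add: mult.commute)

lemma bkernel_0: "bkernel 0 x = complex_of_real (\<Prod>j\<in>UNIV. sqrt (sqrt 2) * hermite_norm 0 * exp (- (x $ j)\<^sup>2))"
proof -
  have "exp (- (complex_of_real (sqrt 2 * x $ j))\<^sup>2 / 2) = complex_of_real (exp (- (x $ j)\<^sup>2))" for j
    by (simp flip: exp_of_real of_real_power add: power_mult_distrib)
  thus ?thesis by (simp add: bargmann_kernel_def)
qed

lemma bkernel_measurable: "bkernel z \<in> borel_measurable borel"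
  using l2_measurable[OF bargmann_kernel_l2[of "sqrt 2" z]] by simp

lemma cnj_bkernel: "cnj (bkernel w x) = bkernel (- vec_cnj w) x"
proof -
  have "cnj (bkernel w x) = bkernel 0 x * exp (cnj (2 * \<i> * (\<Sum>j\<in>UNIV. complex_of_real (x $ j) * w $ j) + (\<Sum>j\<in>UNIV. (w $ j)\<^sup>2) / 2))"
    unfolding bkernel_factor[of w] by (simp add: bkernel_0 exp_cnj)
  also have "cnj (2 * \<i> * (\<Sum>j\<in>UNIV. complex_of_real (x $ j) * w $ j) + (\<Sum>j\<in>UNIV. (w $ j)\<^sup>2) / 2)
    = 2 * \<i> * (\<Sum>j\<in>UNIV. complex_of_real (x $ j) * (- vec_cnj w) $ j) + (\<Sum>j\<in>UNIV. ((- vec_cnj w) $ j)\<^sup>2) / 2"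
    by (simp add: vec_cnj_def sum_negf)
  finally show ?thesis unfolding bkernel_factor[of "- vec_cnj w"] .
qed

text \<open>Expanding (z - cnj w)^2 / 2 produces the cross term -z . cnj w. This accounts for both
  the exponential and the argument z - cnj w in the definition of S.\<close>

lemma bkernel_mult:
  "bkernel z x * cnj (bkernel w x) = exp (dot_cnj z w) * (bkernel 0 x * bkernel (z - vec_cnj w) x)"
proof -
  have "(2 * \<i> * (\<Sum>j\<in>UNIV. complex_of_real (x $ j) * z $ j) + (\<Sum>j\<in>UNIV. (z $ j)\<^sup>2) / 2)
      + (2 * \<i> * (\<Sum>j\<in>UNIV. complex_of_real (x $ j) * (- vec_cnj w) $ j) + (\<Sum>j\<in>UNIV. ((- vec_cnj w) $ j)\<^sup>2) / 2)
    = dot_cnj z w + (2 * \<i> * (\<Sum>j\<in>UNIV. complex_of_real (x $ j) * (z - vec_cnj w) $ j) + (\<Sum>j\<in>UNIV. ((z - vec_cnj w) $ j)\<^sup>2) / 2)"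
    unfolding dot_cnj_def vec_cnj_def
    by (simp add: power2_diff sum.distrib sum_subtractf sum_negf sum_distrib_left algebra_simps add_divide_distrib diff_divide_distrib sum_divide_distrib)
  hence "exp (2 * \<i> * (\<Sum>j\<in>UNIV. complex_of_real (x $ j) * z $ j) + (\<Sum>j\<in>UNIV. (z $ j)\<^sup>2) / 2)
      * exp (2 * \<i> * (\<Sum>j\<in>UNIV. complex_of_real (x $ j) * (- vec_cnj w) $ j) + (\<Sum>j\<in>UNIV. ((- vec_cnj w) $ j)\<^sup>2) / 2)
    = exp (dot_cnj z w) * exp (2 * \<i> * (\<Sum>j\<in>UNIV. complex_of_real (x $ j) * (z - vec_cnj w) $ j) + (\<Sum>j\<in>UNIV. ((z - vec_cnj w) $ j)\<^sup>2) / 2)"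
    by (simp only: exp_add[symmetric])
  moreover have "b * P * (b * Q) = R * (b * (b * S))" if "P * Q = R * S" for b P Q R S :: complex
  proof -
    have "b * P * (b * Q) = b * b * (P * Q)" by (simp add: mult_ac)
    thus ?thesis unfolding that by (simp add: mult_ac)
  qed
  ultimately show ?thesis
    unfolding cnj_bkernel unfolding bkernel_factor[of z] bkernel_factor[of "- vec_cnj w"] bkernel_factor[of "z - vec_cnj w"]
    by blast
qed

text \<open>The exponent is -2 x^2 + 2 i x z + z^2 / 2. Each coordinate of K_0 carries the constant
  (2/pi)^(1/4), and the two kernels together give (2/pi)^(n/2).\<close>

lemma symbol_kernel_eq:
  fixes z :: "complex ^ 'n"
  shows "complex_of_real ((2 / pi) powr (real CARD('n) / 2)) * exp (- 2 * vec_sq (\<chi> j. complex_of_real (x $ j) - \<i> / 2 * z $ j))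
    = bkernel 0 x * bkernel z x"
proof -
  define k where "k = sqrt (sqrt 2) * hermite_norm 0"
  have k2: "k * k = sqrt (2 / pi)"
  proof -
    have "k * k = (sqrt (sqrt 2) * sqrt (sqrt 2)) * (1 / (sqrt (sqrt pi) * sqrt (sqrt pi)))"
      by (simp add: k_def hermite_norm_def)
    thus ?thesis by (simp add: real_sqrt_divide)
  qed
  have "bkernel 0 x * bkernel 0 x = complex_of_real (\<Prod>j\<in>UNIV. (k * exp (- (x $ j)\<^sup>2)) * (k * exp (- (x $ j)\<^sup>2)))"
    unfolding bkernel_0 k_def of_real_mult[symmetric] prod.distrib[symmetric] ..
  also have "(\<Prod>j\<in>UNIV. (k * exp (- (x $ j)\<^sup>2)) * (k * exp (- (x $ j)\<^sup>2))) = (\<Prod>j\<in>(UNIV :: 'n set). (k * k) * exp (- 2 * (x $ j)\<^sup>2))"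
  proof (rule prod.cong[OF refl])
    fix j
    have "exp (- 2 * (x $ j)\<^sup>2) = exp (- (x $ j)\<^sup>2) * exp (- (x $ j)\<^sup>2)" unfolding exp_add[symmetric] by simp
    thus "(k * exp (- (x $ j)\<^sup>2)) * (k * exp (- (x $ j)\<^sup>2)) = (k * k) * exp (- 2 * (x $ j)\<^sup>2)" by simp
  qed
  also have "\<dots> = (2 / pi) powr (real CARD('n) / 2) * exp (\<Sum>j\<in>UNIV. - 2 * (x $ j)\<^sup>2)"
  proof -
    have "(2 / pi) powr (real CARD('n) / 2) = ((2 / pi) powr (1 / 2)) ^ CARD('n)"
      by (simp add: powr_power)
    also have "(2 / pi) powr (1 / 2) = sqrt (2 / pi)" by (rule powr_half_sqrt) simp
    finally show ?thesis unfolding k2 by (simp add: prod.distrib exp_sum)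
  qed
  finally have b: "bkernel 0 x * bkernel 0 x = complex_of_real ((2 / pi) powr (real CARD('n) / 2)) * exp (complex_of_real (\<Sum>j\<in>UNIV. - 2 * (x $ j)\<^sup>2))"
    by (simp only: of_real_mult exp_of_real)
  have "- 2 * vec_sq (\<chi> j. complex_of_real (x $ j) - \<i> / 2 * z $ j) =
      complex_of_real (\<Sum>j\<in>UNIV. - 2 * (x $ j)\<^sup>2) + (2 * \<i> * (\<Sum>j\<in>UNIV. complex_of_real (x $ j) * z $ j) + (\<Sum>j\<in>UNIV. (z $ j)\<^sup>2) / 2)"
    unfolding vec_sq_def
    by (simp add: power2_diff power_mult_distrib power_divide sum_distrib_left sum_divide_distrib sum.distrib[symmetric] algebra_simps)
  hence "exp (- 2 * vec_sq (\<chi> j. complex_of_real (x $ j) - \<i> / 2 * z $ j)) =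
      exp (complex_of_real (\<Sum>j\<in>UNIV. - 2 * (x $ j)\<^sup>2)) * exp (2 * \<i> * (\<Sum>j\<in>UNIV. complex_of_real (x $ j) * z $ j) + (\<Sum>j\<in>UNIV. (z $ j)\<^sup>2) / 2)"
    by (simp only: exp_add)
  thus ?thesis unfolding bkernel_factor[of z] mult.assoc[symmetric] b by (simp only: mult.assoc)
qed

lemma symbol_integral_eq:
  fixes z :: "complex ^ 'n"
  shows "complex_of_real ((2 / pi) powr (real CARD('n) / 2)) *
                (LINT x|lborel. m x * exp (- 2 * vec_sq (\<chi> j. complex_of_real (x $ j) - \<i> / 2 * z $ j)))
    = (LINT x|lborel. m x * (bkernel 0 x * bkernel z x))"
  unfolding symbol_kernel_eq[symmetric] integral_mult_right_zero[symmetric] by (simp only: mult.left_commute)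


subsection \<open>The integral operator\<close>

text \<open>The coefficients of K_z are Fock monomials at z, up to phases. This is what permits
  applying a multiplier to K_z.\<close>

lemma sobolev_summable_bkernel: "sobolev_summable (sqrt 2) s (bkernel z)"
  unfolding sobolev_summable_def
    orthonormal_family.l2_expansion_coeff[OF orthonormal_family_hermite_dil bargmann_kernel_expansion, of "sqrt 2", simplified]
    norm_fock_ibasis
  by (rule fock_basis_weighted_summable)

text \<open>For fixed z the second factor is the conjugate of the Bargmann transform of cnj(m K_z),
  so the integral over w becomes an inner product of two transforms.\<close>

lemma S_integrand_eq:
  assumes phi: "\<And>z. \<phi> z = (LINT x|lborel. m x * (bkernel 0 x * bkernel z x))"
    and F: "\<And>w. F w = bargmann (sqrt 2) f w"
  shows "S_integrand \<phi> F z w = bargmann (sqrt 2) f w * cnj (LINT x|lborel. cnj (m x * bkernel z x) * bkernel w x)"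
proof -
  have "exp (dot_cnj z w) * \<phi> (z - vec_cnj w) = (LINT x|lborel. exp (dot_cnj z w) * (m x * (bkernel 0 x * bkernel (z - vec_cnj w) x)))"
    unfolding phi by simp
  also have "\<dots> = (LINT x|lborel. m x * (exp (dot_cnj z w) * (bkernel 0 x * bkernel (z - vec_cnj w) x)))"
    by (simp only: mult.left_commute)
  also have "\<dots> = (LINT x|lborel. cnj (cnj (m x * bkernel z x) * bkernel w x))"
    unfolding bkernel_mult[symmetric] by (simp add: mult.assoc)
  also have "\<dots> = cnj (LINT x|lborel. cnj (m x * bkernel z x) * bkernel w x)" by (rule Bochner_Integration.integral_cnj)
  finally show ?thesis by (simp add: S_integrand_def F mult.assoc)
qed

text \<open>By the isometry of the Bargmann transform S sends the transform of f to that of m f. The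
  bound is the multiplier bound framed by the two norm comparisons between c = 1 and c = sqrt
  2.\<close>

lemma S_bounded_of_multiplier:
  fixes \<phi> :: "complex ^ 'n \<Rightarrow> complex"
  assumes s: "s \<ge> 0" and m: "m \<in> hermite_multipliers s"
    and phi: "\<And>z. \<phi> z = (LINT x|lborel. m x * (bkernel 0 x * bkernel z x))"
  shows "S_bounded_on_fock_sobolev s \<phi>"
proof -
  let ?c = "sqrt 2"
  have c: "?c > 0" by simp
  obtain K1 where K1: "K1 \<ge> 0" and to1: "\<And>f. f \<in> l2 (lborel :: (real ^ 'n) measure) \<Longrightarrow> sobolev_summable ?c s f \<Longrightarrow> sobolev_summable 1 s f \<and> sqrt (sobolev_sq 1 s f) \<le> K1 * sqrt (sobolev_sq ?c s f)"
    using sobolev_equiv[OF c _ s, of 1] by auto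
  obtain K2 where K2: "K2 \<ge> 0" and toc: "\<And>f. f \<in> l2 (lborel :: (real ^ 'n) measure) \<Longrightarrow> sobolev_summable 1 s f \<Longrightarrow> sobolev_summable ?c s f \<and> sqrt (sobolev_sq ?c s f) \<le> K2 * sqrt (sobolev_sq 1 s f)"
    using sobolev_equiv[OF _ c s, of 1] by auto
  obtain B where B: "\<And>f. f \<in> hermite_sobolev s \<Longrightarrow> (\<lambda>x. m x * f x) \<in> hermite_sobolev s \<and> hermite_sobolev_norm s (\<lambda>x. m x * f x) \<le> B * hermite_sobolev_norm s f"
    using m unfolding hermite_multipliers_def by blast
  \<comment> \<open>Nothing is known about m itself; measurability and square integrability of m K_z
    come from applying the multiplier to K_z.\<close>
  have mk: "(\<lambda>x. m x * bkernel z x) \<in> l2 lborel" for z :: "complex ^ 'n"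
  proof -
    have "bkernel z \<in> hermite_sobolev s"
      unfolding hermite_sobolev_iff using to1[OF bargmann_kernel_l2[OF c] sobolev_summable_bkernel] bargmann_kernel_l2[OF c] by blast
    thus ?thesis using B hermite_sobolev_iff by blast
  qed
  have main: "(\<forall>z. integrable gauss_measure (S_integrand \<phi> F z)) \<and> S_op \<phi> F \<in> fock_sobolev s \<and>
      fock_sobolev_norm s (S_op \<phi> F) \<le> (K2 * (\<bar>B\<bar> * K1)) * fock_sobolev_norm s F" if F: "F \<in> fock_sobolev s" for F
  proof -
    obtain f where f: "f \<in> l2 lborel" "sobolev_summable ?c s f" and Ff: "F = (\<lambda>z. bargmann (sqrt 2) f z)"
      using fock_sobolev_obtain[OF c s F] by blast
    have Fw: "F w = bargmann (sqrt 2) f w" for w using Ff by simp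
    have ieq: "S_integrand \<phi> F z = (\<lambda>w. bargmann (sqrt 2) f w * cnj (LINT x|lborel. cnj (m x * bkernel z x) * bkernel w x))" for z
      by (rule ext) (rule S_integrand_eq[OF phi Fw])
    note mkc = l2_cnj[OF mk]
    have int: "integrable gauss_measure (S_integrand \<phi> F z)" for z
      unfolding ieq by (rule bargmann_inner_integrable[OF c f(1) mkc])
    have "S_op \<phi> F z = (LINT x|lborel. (m x * f x) * bkernel z x)" for z
    proof -
      have "S_op \<phi> F z = l2_inner lborel f (\<lambda>x. cnj (m x * bkernel z x))"
        unfolding S_op_def ieq by (rule bargmann_inner[OF c f(1) mkc])
      thus ?thesis by (simp add: l2_inner_def mult_ac)
    qed
    hence Seq: "S_op \<phi> F = (\<lambda>z. LINT x|lborel. (m x * f x) * bkernel z x)" by auto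
    have fh: "f \<in> hermite_sobolev s" using to1[OF f] f by (simp add: hermite_sobolev_iff)
    have mf: "(\<lambda>x. m x * f x) \<in> l2 lborel" "sobolev_summable 1 s (\<lambda>x. m x * f x)"
      using B[OF fh] by (auto simp: hermite_sobolev_iff)
    have mfc: "sobolev_summable ?c s (\<lambda>x. m x * f x)" using toc[OF mf] by blast
    have "fock_sobolev_norm s (S_op \<phi> F) = sqrt (sobolev_sq ?c s (\<lambda>x. m x * f x))"
      unfolding Seq by (rule fock_sobolev_bargmann(2)[OF c mf(1) mfc])
    also have "\<dots> \<le> K2 * sqrt (sobolev_sq 1 s (\<lambda>x. m x * f x))" using toc[OF mf] by blast
    also have "sqrt (sobolev_sq 1 s (\<lambda>x. m x * f x)) = hermite_sobolev_norm s (\<lambda>x. m x * f x)"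
      using B[OF fh] by (simp add: hermite_sobolev_norm_eq)
    also have "K2 * hermite_sobolev_norm s (\<lambda>x. m x * f x) \<le> K2 * (B * hermite_sobolev_norm s f)"
      using B[OF fh] K2 by (intro mult_left_mono) auto
    \<comment> \<open>The absolute value is taken because the multiplier bound comes without a
      sign.\<close>
    also have "\<dots> \<le> K2 * (\<bar>B\<bar> * (K1 * sqrt (sobolev_sq ?c s f)))"
      using K2 to1[OF f] by (intro mult_left_mono mult_mono) (auto simp: hermite_sobolev_norm_eq[OF fh] sobolev_sq_nonneg)
    also have "sqrt (sobolev_sq ?c s f) = fock_sobolev_norm s F"
      unfolding Ff by (rule fock_sobolev_bargmann(2)[OF c f, symmetric])
    finally have "fock_sobolev_norm s (S_op \<phi> F) \<le> (K2 * (\<bar>B\<bar> * K1)) * fock_sobolev_norm s F" by (simp add: mult.assoc)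
    moreover have "S_op \<phi> F \<in> fock_sobolev s"
      unfolding Seq by (rule fock_sobolev_bargmann(1)[OF c mf(1) mfc])
    ultimately show ?thesis using int by blast
  qed
  show ?thesis unfolding S_bounded_on_fock_sobolev_def using main by blast
qed

section \<open>From a bounded operator back to its multiplier\<close>

lemma entire_Cn_continuous: "entire_Cn F \<Longrightarrow> continuous_on UNIV F"
  unfolding entire_Cn_def by (intro continuous_at_imp_continuous_on) (blast intro: has_derivative_continuous)

lemma entire_Cn_holomorphic_line:
  fixes F :: "complex ^ 'n \<Rightarrow> complex"
  assumes F: "entire_Cn F"
  shows "(\<lambda>t. F (z - t *s v)) holomorphic_on UNIV"
proof -
  have "\<exists>d. ((\<lambda>t. F (z - t *s v)) has_field_derivative d) (at t)" for t
  proof -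
    obtain F' where F': "(F has_derivative F') (at (z - t *s v))" and lin: "\<And>c v. F' (c *s v) = c * F' v"
      using F unfolding entire_Cn_def by blast
    have "linear (\<lambda>t::complex. t *s v)"
      by (rule linearI) (simp_all add: vec_eq_iff distrib_right)
    hence "((\<lambda>t::complex. t *s v) has_derivative (\<lambda>t. t *s v)) (at t)"
      by (intro bounded_linear_imp_has_derivative linear_conv_bounded_linear[THEN iffD1])
    hence "((\<lambda>t. z - t *s v) has_derivative (\<lambda>h. 0 - h *s v)) (at t)"
      by (intro has_derivative_diff has_derivative_const)
    from has_derivative_compose[OF this F'] have "((\<lambda>t. F (z - t *s v)) has_derivative (\<lambda>h. F' (0 - h *s v))) (at t)" .
    moreover have "(\<lambda>h. F' (0 - h *s v)) = (*) (- F' v)"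
    proof
      fix h
      have "0 - h *s v = (- h) *s v" by (simp add: vec_eq_iff)
      hence "F' (0 - h *s v) = (- h) * F' v" by (simp only: lin)
      thus "F' (0 - h *s v) = - F' v * h" by simp
    qed
    ultimately show ?thesis unfolding has_field_derivative_def by (intro exI[of _ "- F' v"]) (simp only:)
  qed
  thus ?thesis unfolding holomorphic_on_def field_differentiable_def by simp
qed

lemma fock_expansion_one: "fock_expansion (\<lambda>\<alpha>. if \<alpha> = (\<lambda>_. 0) then 1 else 0) (\<lambda>_. 1)"
  unfolding fock_expansion_def
proof
  fix z :: "complex ^ 'a"
  show "((\<lambda>\<alpha>. (if \<alpha> = (\<lambda>_. 0) then 1 else 0) * fock_basis \<alpha> z) has_sum 1) UNIV"
    by (rule has_sum_finite_neutralI[where B="{\<lambda>_. 0}"]) (auto simp: fock_basis_def)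
qed

lemma one_fock_sobolev: "(\<lambda>_. 1) \<in> fock_sobolev s"
proof -
  have "(\<lambda>\<alpha>::'a \<Rightarrow> nat. hermite_eigenvalue \<alpha> powr s * (norm (if \<alpha> = (\<lambda>_. 0) then 1 else 0 :: complex))\<^sup>2) summable_on UNIV"
    by (rule summable_on_cong_neutral[where T="{\<lambda>_. 0}", THEN iffD2]) auto
  thus ?thesis using fock_expansion_one unfolding fock_sobolev_def by blast
qed

text \<open>With F = 1 the integrand is antiholomorphic in w, so its conjugate has the mean value
  property. At w = 0 the integrand equals \<phi> z.\<close>

lemma S_op_one:
  assumes phi: "entire_Cn \<phi>" and int: "integrable gauss_measure (S_integrand \<phi> (\<lambda>_. 1) z)"
  shows "S_op \<phi> (\<lambda>_. 1) z = \<phi> z"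
proof -
  let ?G = "S_integrand \<phi> (\<lambda>_. 1) z"
  have G: "?G w = exp (dot_cnj z w) * \<phi> (z - vec_cnj w)" for w by (simp add: S_integrand_def)
  have "(LINT w|gauss_measure. cnj (?G w)) = cnj (?G 0)"
  proof (rule gauss_measure_mean_value)
    have "continuous_on UNIV (\<lambda>w. \<phi> (z - vec_cnj w))"
      by (rule continuous_on_compose2[OF entire_Cn_continuous[OF phi]]) (auto simp: vec_cnj_def intro!: continuous_intros)
    thus "continuous_on UNIV (\<lambda>w. cnj (?G w))"
      unfolding G dot_cnj_def by (intro continuous_intros)
    show "integrable gauss_measure (\<lambda>w. cnj (?G w))" using int by simp
    fix w
    \<comment> \<open>On the line through w the integrand is g evaluated at cnj t; conjugating on
      both sides makes it holomorphic in t.\<close>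
    define g where "g t = exp (t * dot_cnj z w) * \<phi> (z - t *s vec_cnj w)" for t
    have "g holomorphic_on UNIV" unfolding g_def by (intro holomorphic_intros entire_Cn_holomorphic_line[OF phi])
    hence "cnj \<circ> g \<circ> cnj holomorphic_on UNIV" by (intro holomorphic_on_compose_cnj_cnj) (auto intro: holomorphic_on_subset)
    moreover have "cnj (?G (t *s w)) = (cnj \<circ> g \<circ> cnj) t" for t
    proof -
      have "dot_cnj z (t *s w) = cnj t * dot_cnj z w" by (simp add: dot_cnj_def sum_distrib_left mult_ac)
      moreover have "vec_cnj (t *s w) = cnj t *s vec_cnj w" by (simp add: vec_cnj_def vec_eq_iff)
      ultimately show ?thesis by (simp add: G g_def)
    qed
    ultimately show "(\<lambda>t. cnj (?G (t *s w))) holomorphic_on UNIV" by (simp add: comp_def)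
  qed
  hence "cnj (S_op \<phi> (\<lambda>_. 1) z) = cnj (?G 0)" by (simp add: S_op_def)
  moreover have "vec_cnj 0 = (0 :: complex ^ 'a)" by (simp add: vec_cnj_def vec_eq_iff)
  moreover have "dot_cnj z 0 = 0" by (simp add: dot_cnj_def)
  ultimately show ?thesis by (simp add: G)
qed

lemma symbol_fock_sobolev:
  assumes "entire_Cn \<phi>" "S_bounded_on_fock_sobolev s \<phi>"
  shows "\<phi> \<in> fock_sobolev s"
proof -
  have "S_op \<phi> (\<lambda>_. 1) = \<phi>"
    using S_op_one[OF assms(1)] assms(2) one_fock_sobolev unfolding S_bounded_on_fock_sobolev_def by blast
  moreover have "S_op \<phi> (\<lambda>_. 1) \<in> fock_sobolev s"
    using assms(2) one_fock_sobolev unfolding S_bounded_on_fock_sobolev_def by blast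
  ultimately show ?thesis by simp
qed

text \<open>At real z the kernel is K_0 times a unimodular character and a constant, so u times the
  character stays in L2 and the pairing formula applies. Letting z vary gives equal Fourier
  transforms of u f and v K_0.\<close>

lemma S_op_eq_bargmann_imp_AE:
  fixes u f v :: "real ^ 'n \<Rightarrow> complex"
  assumes u: "u \<in> l2 lborel" and f: "f \<in> l2 lborel" and v: "v \<in> l2 lborel"
    and phi: "\<And>z. \<phi> z = bargmann (sqrt 2) u z"
    and S: "\<And>z. S_op \<phi> (\<lambda>w. bargmann (sqrt 2) f w) z = bargmann (sqrt 2) v z"
  shows "AE x in lborel. u x / bkernel 0 x * f x = v x"
proof -
  have c: "sqrt 2 > (0::real)" by simp
  have k0: "bkernel 0 x \<noteq> 0" for x :: "real ^ 'n" by (rule bargmann_kernel_nonzero[OF c])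
  have kl: "bkernel 0 \<in> l2 (lborel :: (real ^ 'n) measure)" by (rule bargmann_kernel_l2[OF c])
  let ?E = "\<lambda>y x. exp (\<i> * complex_of_real (y \<bullet> x))"
  have nE: "norm (?E y x) \<le> 1" for y x :: "real ^ 'n" by simp
  have mE: "?E y \<in> borel_measurable lborel" for y :: "real ^ 'n" by measurable
  have uE: "(\<lambda>x. u x * ?E y x) \<in> l2 lborel" for y by (rule l2_bounded_mult[OF u mE nE])
  have i1: "integrable lborel (\<lambda>x. u x * f x)" by (rule l2_mult_integrable[OF u f])
  have i2: "integrable lborel (\<lambda>x. v x * bkernel 0 x)" by (rule l2_mult_integrable[OF v kl])
  have i1E: "integrable lborel (\<lambda>x. u x * f x * ?E y x)" for y
    using l2_mult_integrable[OF uE f] by (simp add: mult_ac)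
  have i2E: "integrable lborel (\<lambda>x. v x * bkernel 0 x * ?E y x)" for y
    using l2_mult_integrable[OF l2_bounded_mult[OF v mE nE] kl] by (simp add: mult_ac)
  have "AE x in lborel. u x * f x - v x * bkernel 0 x = 0"
  proof (rule Fourier_transform_eq_0_imp_AE_eq_0)
    show "integrable lborel (\<lambda>x. u x * f x - v x * bkernel 0 x)" using i1 i2 by simp
    fix y :: "real ^ 'n"
    \<comment> \<open>The exponent of the kernel contains 2 i x z, so z = y / 2 produces the
      frequency y.\<close>
    define z :: "complex ^ 'n" where "z = (\<chi> j. complex_of_real (y $ j / 2))"
    define q where "q = (\<Sum>j\<in>UNIV. (z $ j)\<^sup>2) / 2"
    have kz: "bkernel z x = exp q * (bkernel 0 x * ?E y x)" for x
    proof -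
      have "2 * \<i> * (\<Sum>j\<in>UNIV. complex_of_real (x $ j) * z $ j) = \<i> * complex_of_real (y \<bullet> x)"
        by (simp add: z_def inner_vec_def sum_distrib_left mult_ac)
      thus ?thesis unfolding bkernel_factor[of z] q_def exp_add by (simp add: mult_ac)
    qed
    \<comment> \<open>This is \<open>bkernel_mult\<close> divided by K_0, possible because K_0 has
      no zeros.\<close>
    have kw: "exp (dot_cnj z w) * bkernel (z - vec_cnj w) x = exp q * (?E y x * cnj (bkernel w x))" for w x
      using bkernel_mult[of z x w] k0[of x] unfolding kz by (simp add: mult_ac)
    have "exp (dot_cnj z w) * \<phi> (z - vec_cnj w) = exp q * cnj (LINT x|lborel. cnj (u x * ?E y x) * bkernel w x)" for w
    proof -
      have "exp (dot_cnj z w) * \<phi> (z - vec_cnj w) = (LINT x|lborel. u x * (exp (dot_cnj z w) * bkernel (z - vec_cnj w) x))"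
        unfolding phi integral_mult_right_zero[symmetric] by (simp only: mult.left_commute)
      also have "\<dots> = (LINT x|lborel. exp q * cnj (cnj (u x * ?E y x) * bkernel w x))"
        unfolding kw by (simp add: mult_ac)
      also have "\<dots> = exp q * cnj (LINT x|lborel. cnj (u x * ?E y x) * bkernel w x)"
        by (simp only: integral_mult_right_zero Bochner_Integration.integral_cnj)
      finally show ?thesis .
    qed
    hence "S_integrand \<phi> (\<lambda>w. bargmann (sqrt 2) f w) z =
        (\<lambda>w. exp q * (bargmann (sqrt 2) f w * cnj (LINT x|lborel. cnj (u x * ?E y x) * bkernel w x)))"
      by (auto simp: S_integrand_def mult_ac)
    hence "S_op \<phi> (\<lambda>w. bargmann (sqrt 2) f w) z = exp q * l2_inner lborel f (\<lambda>x. cnj (u x * ?E y x))"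
      unfolding S_op_def by (simp only: integral_mult_right_zero bargmann_inner[OF c f l2_cnj[OF uE]])
    also have "l2_inner lborel f (\<lambda>x. cnj (u x * ?E y x)) = (LINT x|lborel. u x * f x * ?E y x)"
      by (simp add: l2_inner_def mult_ac)
    finally have "exp q * (LINT x|lborel. u x * f x * ?E y x) = exp q * (LINT x|lborel. v x * bkernel 0 x * ?E y x)"
      unfolding S kz integral_mult_right_zero[symmetric] by (simp only: mult_ac)
    hence "(LINT x|lborel. u x * f x * ?E y x) = (LINT x|lborel. v x * bkernel 0 x * ?E y x)" by simp
    thus "(LINT x|lborel. (u x * f x - v x * bkernel 0 x) * ?E y x) = 0"
      unfolding left_diff_distrib using i1E[of y] i2E[of y] by simp
  qed
  thus ?thesis
  proof eventually_elim
    case (elim x)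
    thus ?case using k0[of x] by (simp add: field_simps)
  qed
qed

text \<open>Surjectivity of the Bargmann transform gives u for the symbol and, for each f, a v
  representing S applied to the transform of f. Since m f = v almost everywhere, the bound for S
  becomes a bound for m after the same norm comparisons.\<close>

lemma multiplier_of_S_bounded:
  fixes \<phi> :: "complex ^ 'n \<Rightarrow> complex"
  assumes s: "s \<ge> 0" and phi: "entire_Cn \<phi>" and S: "S_bounded_on_fock_sobolev s \<phi>"
  shows "\<exists>m\<in>hermite_multipliers s. \<forall>z. \<phi> z = (LINT x|lborel. m x * (bkernel 0 x * bkernel z x))"
proof -
  let ?c = "sqrt 2"
  have c: "?c > 0" by simp
  obtain K1 where K1: "K1 \<ge> 0" and to1: "\<And>f. f \<in> l2 (lborel :: (real ^ 'n) measure) \<Longrightarrow> sobolev_summable ?c s f \<Longrightarrow> sobolev_summable 1 s f \<and> sqrt (sobolev_sq 1 s f) \<le> K1 * sqrt (sobolev_sq ?c s f)"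
    using sobolev_equiv[OF c _ s, of 1] by auto
  obtain K2 where K2: "K2 \<ge> 0" and toc: "\<And>f. f \<in> l2 (lborel :: (real ^ 'n) measure) \<Longrightarrow> sobolev_summable 1 s f \<Longrightarrow> sobolev_summable ?c s f \<and> sqrt (sobolev_sq ?c s f) \<le> K2 * sqrt (sobolev_sq 1 s f)"
    using sobolev_equiv[OF _ c s, of 1] by auto
  obtain B where B: "\<And>F. F \<in> fock_sobolev s \<Longrightarrow> S_op \<phi> F \<in> fock_sobolev s \<and> fock_sobolev_norm s (S_op \<phi> F) \<le> B * fock_sobolev_norm s F"
    using S unfolding S_bounded_on_fock_sobolev_def by blast
  obtain u where u: "u \<in> l2 lborel" and phiu: "\<phi> = (\<lambda>z. bargmann (sqrt 2) u z)"
    using fock_sobolev_obtain[OF c s symbol_fock_sobolev[OF phi S]] by blast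
  define m where "m x = u x / bkernel 0 x" for x
  have k0: "bkernel 0 x \<noteq> 0" for x :: "real ^ 'n" by (rule bargmann_kernel_nonzero[OF c])
  have mult: "(\<lambda>x. m x * f x) \<in> hermite_sobolev s \<and> hermite_sobolev_norm s (\<lambda>x. m x * f x) \<le> (K1 * (\<bar>B\<bar> * K2)) * hermite_sobolev_norm s f"
    if fh: "f \<in> hermite_sobolev s" for f
  proof -
    have f: "f \<in> l2 lborel" "sobolev_summable 1 s f" using fh by (auto simp: hermite_sobolev_iff)
    have fc: "sobolev_summable ?c s f" using toc[OF f] by blast
    let ?F = "\<lambda>z. bargmann (sqrt 2) f z"
    note F = fock_sobolev_bargmann[OF c f(1) fc]
    obtain v where v: "v \<in> l2 lborel" "sobolev_summable ?c s v" and Sv: "S_op \<phi> ?F = (\<lambda>z. bargmann (sqrt 2) v z)"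
      using fock_sobolev_obtain[OF c s conjunct1[OF B[OF F(1)]]] by blast
    have ae: "AE x in lborel. m x * f x = v x"
      unfolding m_def by (rule S_op_eq_bargmann_imp_AE[OF u f(1) v(1), of \<phi>]) (simp_all add: phiu[symmetric] Sv fun_cong[OF phiu])
    \<comment> \<open>Members of the function spaces are genuine Borel functions and m f agrees with
      v only almost everywhere, so its measurability is checked directly.\<close>
    have meas: "(\<lambda>x. m x * f x) \<in> borel_measurable lborel"
      unfolding m_def using l2_measurable[OF u] l2_measurable[OF f(1)] bkernel_measurable[of 0]
      by (simp only: measurable_lborel2) (intro borel_measurable_times borel_measurable_divide)
    have mf: "(\<lambda>x. m x * f x) \<in> l2 lborel"
      by (rule l2_cong_AE[OF v(1) meas]) (use ae in \<open>auto elim: eventually_mono\<close>)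
    have "hermite_dil ?c \<alpha> \<in> borel_measurable (lborel :: (real ^ 'n) measure)" for \<alpha> using measurable_hermite_dil[OF c] by simp
    \<comment> \<open>Coefficients ignore null sets, so the Sobolev sums of v carry over to m
      f.\<close>
    hence co: "hermite_coeff ?c (\<lambda>x. m x * f x) \<alpha> = hermite_coeff ?c v \<alpha>" for \<alpha>
      by (intro l2_inner_cong_AE meas l2_measurable[OF v(1)] ae)
    have mfc: "sobolev_summable ?c s (\<lambda>x. m x * f x)" using v(2) unfolding sobolev_summable_def co .
    have eq: "sobolev_sq ?c s (\<lambda>x. m x * f x) = sobolev_sq ?c s v" unfolding sobolev_sq_def co ..
    have mfh: "(\<lambda>x. m x * f x) \<in> hermite_sobolev s" using to1[OF mf mfc] mf by (simp add: hermite_sobolev_iff)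
    have "hermite_sobolev_norm s (\<lambda>x. m x * f x) = sqrt (sobolev_sq 1 s (\<lambda>x. m x * f x))" by (rule hermite_sobolev_norm_eq[OF mfh])
    also have "\<dots> \<le> K1 * sqrt (sobolev_sq ?c s (\<lambda>x. m x * f x))" using to1[OF mf mfc] by blast
    also have "sqrt (sobolev_sq ?c s (\<lambda>x. m x * f x)) = fock_sobolev_norm s (S_op \<phi> ?F)"
      unfolding eq Sv by (rule fock_sobolev_bargmann(2)[OF c v, symmetric])
    also have "K1 * fock_sobolev_norm s (S_op \<phi> ?F) \<le> K1 * (B * fock_sobolev_norm s ?F)"
      using B[OF F(1)] K1 by (intro mult_left_mono) auto
    also have "\<dots> \<le> K1 * (\<bar>B\<bar> * (K2 * sqrt (sobolev_sq 1 s f)))"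
      unfolding F(2) using K1 toc[OF f] by (intro mult_left_mono mult_mono) (auto simp: sobolev_sq_nonneg)
    also have "sqrt (sobolev_sq 1 s f) = hermite_sobolev_norm s f" by (rule hermite_sobolev_norm_eq[OF fh, symmetric])
    finally show ?thesis using mfh by (simp add: mult.assoc)
  qed
  have "\<phi> z = (LINT x|lborel. m x * (bkernel 0 x * bkernel z x))" for z
    unfolding phiu m_def using k0 by simp
  moreover have "m \<in> hermite_multipliers s" unfolding hermite_multipliers_def using mult by blast
  ultimately show ?thesis by blast
qed

theorem theorem1:
  fixes s :: real and \<phi> :: "complex ^ 'n \<Rightarrow> complex"
  assumes "s \<ge> 0" and "\<phi> \<in> fock_space"
  shows "(S_bounded_on_fock_sobolev s \<phi> \<longleftrightarrow>
           (\<exists>m\<in>hermite_multipliers s. \<forall>z.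
              \<phi> z = complex_of_real ((2 / pi) powr (real CARD('n) / 2)) *
                (LINT x|lborel. m x *
                   exp (- 2 * vec_sq (\<chi> j. complex_of_real (x $ j) - \<i> / 2 * z $ j))))) \<and>
         (S_bounded_on_fock_sobolev s \<phi> \<longrightarrow> \<phi> \<in> fock_sobolev s)"
proof -
  have phi: "entire_Cn \<phi>" using assms(2) by (simp add: fock_space_def)
  show ?thesis
    unfolding symbol_integral_eq
    using S_bounded_of_multiplier[OF assms(1)] multiplier_of_S_bounded[OF assms(1) phi] symbol_fock_sobolev[OF phi] by blast
qed

end
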